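(* Let $\alpha>0$ and let $X=\{(\lambda,m_\lambda)\}_{\lambda\in\Lambda}$ be a divisor. (a) If $X$ is a sampling divisor for $\mathcal F_\alpha^2$, then $X$ satisfies the finite overlap condition and there exists $C>0$ such that $$\bigcup_{\lambda\in\Lambda} D\bigl(\lambda,\sqrt{m_\lambda/\alpha}+C\bigr)=\mathbb C .$$ (b) Conversely, if $X$ satisfies the finite overlap condition and for every $C>0$ there is a compact subset $K$ of $\mathbb C$ such that $$\bigcup_{\lambda\in\Lambda,\; m_\lambda>\alpha C^2} D\bigl(\lambda,\sqrt{m_\lambda/\alpha}-C\bigr)=\mathbb C\setminus K,$$ then $X$ is a sampling divisor for $\mathcal F_\alpha^2$.
   Context: For $\alpha>0$, the Fock space is $$\mathcal F_\alpha^2=\Bigl\{f\in \operatorname{Hol}(\mathbb C): \|f\|_2^2:=\frac{\alpha}{\pi}\int_{\mathbb C}|f(z)|^2e^{-\alpha|z|^2}\,dm(z)<\infty\Bigr\},$$ where $\operatorname{Hol}(\mathbb C)$ is the set of entire functions and $m$ is planar Lebesgue measure. It is a Hilbert space with inner product $\langle f,g\rangle=\frac{\alpha}{\pi}\int_{\mathbb C} f(z)\overline{g(z)}e^{-\alpha|z|^2}\,dm(z)$, and $e_k(z)=\frac{\sqrt{\alpha^k}}{\sqrt{k!}}z^k$, $k\ge 0$, is an orthonormal basis of it. For $z\in\mathbb C$, the translation $T_z$, acting isometrically on $\mathcal F_\alpha^2$, is $T_zf(\zeta)=e^{\alpha\bar z\zeta-\frac{\alpha}{2}|z|^2}f(\zeta-z)$.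 A divisor $X=\{(\lambda,m_\lambda)\}_{\lambda\in\Lambda}$ consists of a sequence $\Lambda$ of (distinct) points in $\mathbb C$ and, for each $\lambda\in\Lambda$, a positive integer $m_\lambda$ (the multiplicity associated with $\lambda$); the multiplicities may be unbounded. $X$ is called sampling for $\mathcal F_\alpha^2$ if $$\|f\|_2^2\asymp\sum_{\lambda\in\Lambda}\sum_{k=0}^{m_\lambda-1}|\langle f,T_\lambda e_k\rangle|^2,\qquad f\in\mathcal F_\alpha^2,$$ i.e. each side is bounded by a positive constant times the other, with constants independent of $f$. $D(z,r)$ denotes the disc of radius $r$ centered at $z$, and $\chi_E$ the characteristic function of a set $E$. $X$ satisfies the finite overlap condition if $$\sup_{z\in\mathbb C}\sum_{\lambda\in\Lambda}\chi_{D(\lambda,\sqrt{m_\lambda/\alpha})}(z)<\infty .$$ *)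

theory Defs
  imports "HOL-Complex_Analysis.Complex_Analysis"
begin

definition fock_space :: "real \<Rightarrow> (complex \<Rightarrow> complex) set" where
  "fock_space \<alpha> = {f. f holomorphic_on UNIV \<and>
     integrable lborel (\<lambda>z. (cmod (f z))\<^sup>2 * exp (- \<alpha> * (cmod z)\<^sup>2))}"

definition fock_norm2 :: "real \<Rightarrow> (complex \<Rightarrow> complex) \<Rightarrow> real" where
  "fock_norm2 \<alpha> f =
     \<alpha> / pi * (LINT z|lborel. (cmod (f z))\<^sup>2 * exp (- \<alpha> * (cmod z)\<^sup>2))"

definition fock_inner :: "real \<Rightarrow> (complex \<Rightarrow> complex) \<Rightarrow> (complex \<Rightarrow> complex) \<Rightarrow> complex" where
  "fock_inner \<alpha> f g =
     of_real (\<alpha> / pi) *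
       (LINT z|lborel. f z * cnj (g z) * of_real (exp (- \<alpha> * (cmod z)\<^sup>2)))"

definition fock_basis :: "real \<Rightarrow> nat \<Rightarrow> complex \<Rightarrow> complex" where
  "fock_basis \<alpha> k z = of_real (sqrt (\<alpha> ^ k) / sqrt (fact k)) * z ^ k"

definition fock_translation ::
    "real \<Rightarrow> complex \<Rightarrow> (complex \<Rightarrow> complex) \<Rightarrow> complex \<Rightarrow> complex" where
  "fock_translation \<alpha> z f \<zeta> =
     exp (of_real \<alpha> * cnj z * \<zeta> - of_real (\<alpha> / 2 * (cmod z)\<^sup>2)) * f (\<zeta> - z)"

text \<open>The sequence of distinct points is given by its countable range, and the multiplicity
  function is only relevant on that set.\<close>

definition divisor :: "complex set \<Rightarrow> (complex \<Rightarrow> nat) \<Rightarrow> bool" where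
  "divisor \<Lambda> m \<longleftrightarrow> countable \<Lambda> \<and> (\<forall>l\<in>\<Lambda>. 0 < m l)"

text \<open>The possibly infinite sums below are taken in the extended nonnegative reals, where they
  always converge (a divergent series of nonnegative terms has the value \<open>\<infinity>\<close>).\<close>

definition sampling_sum ::
    "real \<Rightarrow> complex set \<Rightarrow> (complex \<Rightarrow> nat) \<Rightarrow> (complex \<Rightarrow> complex) \<Rightarrow> ennreal" where
  "sampling_sum \<alpha> \<Lambda> m f =
     (\<Sum>\<^sub>\<infinity>l\<in>\<Lambda>. \<Sum>k<m l.
        ennreal ((cmod (fock_inner \<alpha> f (fock_translation \<alpha> l (fock_basis \<alpha> k))))\<^sup>2))"

definition sampling_divisor :: "real \<Rightarrow> complex set \<Rightarrow> (complex \<Rightarrow> nat) \<Rightarrow> bool" where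
  "sampling_divisor \<alpha> \<Lambda> m \<longleftrightarrow>
     (\<exists>A B :: real. 0 < A \<and> 0 < B \<and>
        (\<forall>f\<in>fock_space \<alpha>.
           ennreal (fock_norm2 \<alpha> f) \<le> ennreal A * sampling_sum \<alpha> \<Lambda> m f \<and>
           sampling_sum \<alpha> \<Lambda> m f \<le> ennreal B * ennreal (fock_norm2 \<alpha> f)))"

definition finite_overlap :: "real \<Rightarrow> complex set \<Rightarrow> (complex \<Rightarrow> nat) \<Rightarrow> bool" where
  "finite_overlap \<alpha> \<Lambda> m \<longleftrightarrow>
     (SUP z. \<Sum>\<^sub>\<infinity>l\<in>\<Lambda>. indicator (ball l (sqrt (real (m l) / \<alpha>))) z :: ennreal) < \<infinity>"

end

theory Submission imports Defs begin

text \<open>Expanding the translate of \<open>f\<close> to a point \<open>l\<close> in normalised monomials, with coefficients \<open>c\<^sub>k\<close>, the mass of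
  \<open>|f|\<^sup>2\<close> on the disc of radius \<open>R\<close> around \<open>l\<close> is \<open>\<Sum>k. |c\<^sub>k|\<^sup>2 * p\<^sub>k\<close>, where \<open>p\<^sub>k\<close> is the probability
  that a Poisson variable of mean \<open>\<alpha> R\<^sup>2\<close> exceeds \<open>k\<close> (\<open>emeasure_fock_mass_ball\<close>). For \<open>\<alpha> R\<^sup>2 = m\<close> these
  weights are at least \<open>1/2\<close> when \<open>k < m\<close>. So the sampled energy at \<open>l\<close> is at most twice the mass of the disc
  (\<open>local_energy_le_disc_mass\<close>), and finite overlap gives the upper sampling inequality. In the other direction,
  coefficients with \<open>k \<ge> m\<close> have little mass on the disc of radius \<open>R - C\<close>, relative to the disc of radius \<open>R\<close>
  (\<open>shrunken_disc_mass_le_local_energy\<close>).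

  For part (a) the test functions are the coherent states, the translates of the constant function. The
  sampled energy at \<open>l\<close> of the coherent state at \<open>z\<close> is the probability that a Poisson variable of mean
  \<open>\<alpha> |z - l|\<^sup>2\<close> is below \<open>m\<close>, which is at least \<open>1/e\<close> if \<open>z\<close> lies in the disc of \<open>l\<close>; this bounds the overlap.
  If no disc meets a large disc around \<open>z\<close>, the upper estimate shows that the sampling sum of the
  coherent state at \<open>z\<close> is tiny; this gives the covering.

  For part (b), summing the estimate for shrunken discs gives
  \<open>\<parallel>f\<parallel>\<^sup>2 \<le> 2 * (sampling sum + mass of K)\<close> for some compact \<open>K\<close> (\<open>sampling_lower_modulo_compact\<close>). By normal
  families the mass of \<open>K\<close> can be dropped as soon as a function in the Fock space whose sampled
  coefficients all vanish is zero (\<open>uniqueness_set\<close>). To see this, note that \<open>f\<close> vanishes to order \<open>m\<close>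
  at \<open>l\<close>, so the maximum principle for \<open>f / (z - l)\<^sup>m\<close> shows that at depth \<open>C\<close> inside the disc the
  density \<open>|f|\<^sup>2 exp (- \<alpha> |z|\<^sup>2)\<close> is at most \<open>exp (- \<alpha> C\<^sup>2)\<close> times its supremum. Hence the supremum over the plane is
  the supremum over a compact set. The same holds for \<open>z\<^sup>N f\<close>, once its density is known to be bounded, with the same
  compact set for every \<open>N\<close>; this forces \<open>f\<close> to vanish outside a disc. Boundedness comes from trading zeros: \<open>N\<close> of
  the zeros of \<open>f\<close> at a far away point of \<open>\<Lambda>\<close> are moved to the origin, which costs only a bounded amount in each
  radius (\<open>uniqueness_polynomial_growth\<close>).\<close>

section \<open>Poisson probabilities at the mean\<close>

text \<open>The probability that a Poisson variable of mean \<open>x\<close> is smaller than \<open>n\<close>; with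
  \<open>x = \<alpha> R\<^sup>2\<close>, the complementary probability is the share of the norm of the monomial \<open>z ^ (n - 1)\<close>
  carried by the disc of radius \<open>R\<close>.\<close>

definition poisson_below :: "nat \<Rightarrow> real \<Rightarrow> real" where
  "poisson_below n x = exp (- x) * (\<Sum>j<n. x ^ j / fact j)"

lemma poisson_below_0_left [simp]: "poisson_below 0 x = 0"
  by (simp add: poisson_below_def)

lemma poisson_below_at_0 [simp]: "n > 0 \<Longrightarrow> poisson_below n 0 = 1"
  by (induction n) (auto simp: poisson_below_def power_0_left if_distrib cong: if_cong)

lemma poisson_below_nonneg: "x \<ge> 0 \<Longrightarrow> poisson_below n x \<ge> 0"
  by (auto simp: poisson_below_def intro!: mult_nonneg_nonneg sum_nonneg)

lemma sum_le_exp: "x \<ge> 0 \<Longrightarrow> finite A \<Longrightarrow> (\<Sum>j\<in>A. x ^ j / fact j) \<le> exp (x::real)"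
  using sum_le_suminf[OF summable_exp[of x], of A]
  by (simp add: exp_def divide_inverse mult.commute)

lemma poisson_below_le_1: "x \<ge> 0 \<Longrightarrow> poisson_below n x \<le> 1"
proof -
  assume x: "x \<ge> 0"
  have "exp (- x) * (\<Sum>j<n. x ^ j / fact j) \<le> exp (- x) * exp x"
    using sum_le_exp[OF x] by (intro mult_left_mono) auto
  then show ?thesis by (simp add: poisson_below_def flip: exp_add)
qed

lemma poisson_below_mono: "x \<ge> 0 \<Longrightarrow> i \<le> n \<Longrightarrow> poisson_below i x \<le> poisson_below n x"
  by (auto simp: poisson_below_def intro!: mult_left_mono sum_mono2)

lemma has_real_derivative_poisson_below:
  "(poisson_below (Suc n) has_real_derivative - (exp (- x) * x ^ n / fact n)) (at x)"
proof (induction n)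
  case 0
  have "poisson_below (Suc 0) = (\<lambda>x. exp (- x))"
    by (simp add: poisson_below_def fun_eq_iff)
  then show ?case by (auto intro!: derivative_eq_intros)
next
  case (Suc n)
  have "poisson_below (Suc (Suc n)) =
      (\<lambda>x. poisson_below (Suc n) x + exp (- x) * x ^ Suc n / fact (Suc n))"
    by (simp add: poisson_below_def fun_eq_iff algebra_simps)
  moreover have "((\<lambda>x. poisson_below (Suc n) x + exp (- x) * x ^ Suc n / fact (Suc n))
      has_real_derivative - (exp (- x) * x ^ n / fact n) +
        (exp (- x) * (real (Suc n) * x ^ n) / fact (Suc n) - exp (- x) * x ^ Suc n / fact (Suc n))) (at x)"
  proof (intro DERIV_add Suc.IH)
    have "((\<lambda>x. x ^ Suc n) has_real_derivative real (Suc n) * x ^ n) (at x)"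
      by (rule DERIV_cong[OF DERIV_pow]) simp
    moreover have "((\<lambda>x. exp (- x)) has_real_derivative - exp (- x)) (at x)"
      by (auto intro!: derivative_eq_intros)
    ultimately have "((\<lambda>x. exp (- x) * x ^ Suc n / fact (Suc n)) has_real_derivative
        (- exp (- x) * x ^ Suc n + real (Suc n) * x ^ n * exp (- x)) / fact (Suc n)) (at x)"
      by (intro DERIV_cdivide DERIV_mult)
    then show "((\<lambda>x. exp (- x) * x ^ Suc n / fact (Suc n)) has_real_derivative
        exp (- x) * (real (Suc n) * x ^ n) / fact (Suc n) - exp (- x) * x ^ Suc n / fact (Suc n)) (at x)"
      by (rule DERIV_cong) (simp only: diff_divide_distrib[symmetric], simp only: mult_ac minus_mult_left[symmetric] add.commute diff_conv_add_uminus)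
  qed
  moreover have "exp (- x) * (real (Suc n) * x ^ n) / fact (Suc n) = exp (- x) * x ^ n / fact n"
    by (simp add: divide_simps)
  ultimately show ?case by simp
qed

lemma poisson_below_antimono:
  assumes "0 \<le> x" "x \<le> y"
  shows "poisson_below n y \<le> poisson_below n x"
proof (cases n)
  case (Suc k)
  show ?thesis unfolding Suc
    by (rule DERIV_nonpos_imp_nonincreasing[OF assms(2)])
       (use assms has_real_derivative_poisson_below in \<open>auto intro!: exI\<close>)
qed simp

lemma fact_add_le_power_mult_fact:
  "i < m \<Longrightarrow> (fact (m + i) :: nat) \<le> m ^ (2 * i + 1) * fact (m - 1 - i)"
proof (induction i)
  case 0
  then show ?case by (cases m) auto
next
  case (Suc i)
  define d where "d = m - 1 - Suc i"
  have m: "m = d + i + 2" using Suc.prems by (simp add: d_def)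
  have "fact (m + Suc i) = (m + Suc i) * (fact (m + i) :: nat)" by simp
  also have "\<dots> \<le> (m + Suc i) * (m ^ (2 * i + 1) * fact (m - 1 - i))"
    using Suc by (intro mult_left_mono) auto
  also have "m - 1 - i = Suc d" using m by simp
  also have "(m + Suc i) * (m ^ (2 * i + 1) * fact (Suc d)) =
      ((m + Suc i) * Suc d) * (m ^ (2 * i + 1) * fact d)"
    by (simp only: fact_Suc of_nat_id mult_ac)
  also have "(m + Suc i) * Suc d \<le> m * m"
    unfolding m by (simp add: algebra_simps)
  also have "m * m * (m ^ (2 * i + 1) * fact d) = m ^ (2 * Suc i + 1) * fact d" by simp
  finally show ?case by (simp add: d_def)
qed

text \<open>The terms at \<open>m + i\<close> and \<open>m - 1 - i\<close> are paired: the first dominates, because their quotient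
  is \<open>m ^ (2 * i + 1)\<close> over the product of the factors between them, and that product is
  \<open>m\<close> times factors \<open>m\<^sup>2 - j\<^sup>2\<close>. Hence at least half of the mass lies at or above the mean.\<close>

lemma poisson_below_mean_le: "poisson_below m (real m) \<le> 1 / 2"
proof -
  define p where "p j = real m ^ j / fact j" for j
  have "p (m - 1 - i) \<le> p (m + i)" if "i < m" for i
  proof -
    have "real (fact (m + i)) \<le> real (m ^ (2 * i + 1) * fact (m - 1 - i))"
      using fact_add_le_power_mult_fact[OF that] by (simp only: of_nat_le_iff)
    then have *: "(fact (m + i) :: real) \<le> real m ^ (2 * i + 1) * fact (m - 1 - i)"
      by simp
    have e: "m - 1 - i + (2 * i + 1) = m + i" using that by simp
    have "real m ^ (m - 1 - i) * fact (m + i) \<le>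
        real m ^ (m - 1 - i) * (real m ^ (2 * i + 1) * fact (m - 1 - i))"
      using * by (intro mult_left_mono) auto
    also have "\<dots> = real m ^ (m + i) * fact (m - 1 - i)"
      by (simp only: mult.assoc[symmetric] power_add[symmetric] e)
    finally show ?thesis by (simp add: p_def divide_simps mult.commute)
  qed
  then have "(\<Sum>i<m. p (m - 1 - i)) \<le> (\<Sum>i<m. p (m + i))" by (intro sum_mono) auto
  moreover have "(\<Sum>i<m. p (m - 1 - i)) = (\<Sum>j<m. p j)"
    by (rule sum.reindex_bij_witness[of _ "\<lambda>i. m - 1 - i" "\<lambda>i. m - 1 - i"]) auto
  moreover have "(\<Sum>i<m. p (m + i)) = (\<Sum>j\<in>{m..<2 * m}. p j)"
    by (rule sum.reindex_bij_witness[of _ "\<lambda>i. i - m" "\<lambda>i. m + i"]) auto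
  moreover have "(\<Sum>j<m. p j) + (\<Sum>j\<in>{m..<2 * m}. p j) = (\<Sum>j<2 * m. p j)"
    using sum.atLeastLessThan_concat[of 0 m "2 * m" p] by (simp add: atLeast0LessThan)
  moreover have "(\<Sum>j<2 * m. p j) \<le> exp (real m)" unfolding p_def by (rule sum_le_exp) auto
  ultimately have "2 * (\<Sum>j<m. p j) \<le> exp (real m)" by linarith
  then have "exp (- real m) * (2 * (\<Sum>j<m. p j)) \<le> exp (- real m) * exp (real m)"
    by (intro mult_left_mono) auto
  then show ?thesis by (simp add: poisson_below_def p_def flip: exp_add)
qed

text \<open>The quotient of the two sides is monotone in \<open>m\<close>; the step is the inequality
  \<open>(m + 1/2) * ln (1 + 1/m) \<ge> 1\<close>, and equality holds at \<open>m = 1\<close>.\<close>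

lemma fact_le_stirling:
  assumes "m \<ge> 1"
  shows "fact m \<le> exp 1 * sqrt (real m) * (real m / exp 1) ^ m"
  using assms
proof (induction m rule: dec_induct)
  case base
  show ?case by simp
next
  case (step m)
  define x where "x = real m"
  have x: "x \<ge> 1" using step by (simp add: x_def)
  define h where "h t = (t + 1 / 2) * (ln (t + 1) - ln t)" for t :: real
  have h: "h x \<ge> 1"
  proof -
    \<comment> \<open>with this \<open>s\<close>, \<open>(1 + s) / (1 - s) = (x + 1) / x\<close>, and \<open>ln ((1 + s) / (1 - s)) \<ge> 2 s\<close>\<close>
    define s where "s = 1 / (2 * x + 1)"
    have s: "0 < s" "s < 1" using x by (auto simp: s_def)
    define \<phi> where "\<phi> t = ln (1 + t) - ln (1 - t) - 2 * t" for t :: real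
    have "\<phi> 0 \<le> \<phi> s"
    proof (rule DERIV_nonneg_imp_nondecreasing[of 0 s \<phi>])
      fix t assume t: "0 \<le> t" "t \<le> s"
      have "(\<phi> has_real_derivative 1 / (1 + t) + 1 / (1 - t) - 2) (at t)"
        unfolding \<phi>_def using t s by (auto intro!: derivative_eq_intros)
      moreover have "1 / (1 + t) + 1 / (1 - t) - 2 = 2 * t\<^sup>2 / ((1 + t) * (1 - t))"
        using t s by (simp add: divide_simps) (simp add: algebra_simps power2_eq_square)
      moreover have "\<dots> \<ge> 0" using t s by auto
      ultimately show "\<exists>y. (\<phi> has_real_derivative y) (at t) \<and> 0 \<le> y" by metis
    qed (use s in simp)
    moreover have "1 + s = (x + 1) * (2 * s)" "1 - s = x * (2 * s)"
      using x by (auto simp: s_def field_simps)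
    then have "ln (1 + s) - ln (1 - s) = ln (x + 1) - ln x"
      using x s by (simp add: ln_mult)
    ultimately have "2 * s \<le> ln (x + 1) - ln x" by (simp add: \<phi>_def)
    then have "(x + 1 / 2) * (2 * s) \<le> h x" unfolding h_def using x by (intro mult_left_mono) auto
    then show ?thesis using x by (simp add: s_def field_simps)
  qed
  have pos: "x > 0" "x + 1 > 0" using x by auto
  have "ln (exp 1 * sqrt x * (x / exp 1) ^ m * (x + 1)) = 1 + ln x / 2 + x * (ln x - 1) + ln (x + 1)"
    using pos by (simp add: ln_mult ln_div ln_realpow ln_sqrt flip: x_def)
  moreover have "ln (exp 1 * sqrt (x + 1) * ((x + 1) / exp 1) ^ Suc m) =
      1 + ln (x + 1) / 2 + (x + 1) * (ln (x + 1) - 1)"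
    using pos by (subst ln_mult ln_div ln_realpow ln_sqrt; simp add: ln_mult ln_div ln_realpow ln_sqrt x_def del: power_Suc)+
  ultimately have "ln (exp 1 * sqrt x * (x / exp 1) ^ m * (x + 1)) \<le>
      ln (exp 1 * sqrt (x + 1) * ((x + 1) / exp 1) ^ Suc m)"
    using h by (simp add: h_def algebra_simps)
  then have "exp 1 * sqrt x * (x / exp 1) ^ m * (x + 1) \<le>
      exp 1 * sqrt (x + 1) * ((x + 1) / exp 1) ^ Suc m"
    using pos by (subst (asm) ln_le_cancel_iff) auto
  moreover have "(x + 1) * fact m \<le> (x + 1) * (exp 1 * sqrt x * (x / exp 1) ^ m)"
    using step pos unfolding x_def by (intro mult_left_mono) auto
  moreover have "fact (Suc m) = (x + 1) * fact m" by (simp add: x_def)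
  ultimately have "fact (Suc m) \<le> exp 1 * sqrt (x + 1) * ((x + 1) / exp 1) ^ Suc m"
    by (simp only: mult.commute[of "x + 1"])
  then show ?case by (simp add: x_def add.commute)
qed

text \<open>This uniform lower bound makes the overlap of the discs with radius exactly
  \<open>sqrt (m / \<alpha>)\<close> visible to a single test function. The truncated moments
  \<open>\<Sum>j<m. (m - j) p\<^sub>j = m p\<^sub>m\<close> and \<open>\<Sum>j<m. (m - j)\<^sup>2 p\<^sub>j = m P\<close>, with
  \<open>P = \<Sum>j<m. p\<^sub>j\<close>, both telescope. Cauchy-Schwarz gives \<open>P \<ge> sqrt m * p\<^sub>m\<close>, and Stirling's bound
  turns the right side into \<open>1/e\<close> after normalisation.\<close>

lemma poisson_below_mean_ge:
  assumes "m \<ge> 1"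
  shows "exp (- 1) \<le> poisson_below m (real m)"
proof -
  define x where "x = real m"
  have x: "x > 0" using assms by (simp add: x_def)
  define p where "p j = x ^ j / fact j" for j
  have p0: "p j \<ge> 0" for j using x by (simp add: p_def)
  have rec: "real (Suc j) * p (Suc j) = x * p j" for j
    by (simp add: p_def divide_simps)
  define P where "P = (\<Sum>j<m. p j)"
  have first: "(\<Sum>j<n. (x - real j) * p j) = real n * p n" for n
  proof (induction n)
    case (Suc n)
    then show ?case using rec[of n] by (simp add: algebra_simps)
  qed simp
  have second: "(\<Sum>j<n. (x - real j)\<^sup>2 * p j) = (x - real n) * (real n * p n) + x * (\<Sum>j<n. p j)" for n
  proof (induction n)
    case (Suc n)
    have "(x - real (Suc n)) * (real (Suc n) * p (Suc n)) = (x - real (Suc n)) * (x * p n)"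
      by (simp only: rec)
    then show ?case using Suc by (simp add: algebra_simps power2_eq_square)
  qed simp
  have "(\<Sum>j<m. (sqrt (p j)) * ((x - real j) * sqrt (p j)))\<^sup>2 \<le>
      (\<Sum>j<m. (sqrt (p j))\<^sup>2) * (\<Sum>j<m. ((x - real j) * sqrt (p j))\<^sup>2)"
    by (rule Cauchy_Schwarz_ineq_sum)
  also have "(\<Sum>j<m. (sqrt (p j)) * ((x - real j) * sqrt (p j))) = x * p m"
    using first[of m] p0 by (simp add: x_def[symmetric] algebra_simps)
  also have "(\<Sum>j<m. (sqrt (p j))\<^sup>2) = P" using p0 by (simp add: P_def)
  also have "(\<Sum>j<m. ((x - real j) * sqrt (p j))\<^sup>2) = x * P"
    using second[of m] p0 by (simp add: x_def[symmetric] P_def power_mult_distrib)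
  finally have "x * (x * (p m)\<^sup>2) \<le> x * P\<^sup>2" by (simp add: power2_eq_square mult_ac)
  then have "x * (p m)\<^sup>2 \<le> P\<^sup>2" using x by simp
  then have "(sqrt x * p m)\<^sup>2 \<le> P\<^sup>2" using x by (simp add: power_mult_distrib)
  then have 1: "sqrt x * p m \<le> P" by (rule power2_le_imp_le) (auto simp: P_def p0 intro: sum_nonneg)
  have "x ^ m / (exp 1 * sqrt x * (x / exp 1) ^ m) \<le> p m"
    using fact_le_stirling[OF assms] x unfolding p_def x_def by (intro divide_left_mono) auto
  then have "sqrt x * (x ^ m / (exp 1 * sqrt x * (x / exp 1) ^ m)) \<le> sqrt x * p m"
    using x by (intro mult_left_mono) auto
  moreover have "sqrt x * (x ^ m / (exp 1 * sqrt x * (x / exp 1) ^ m)) = exp x / exp 1"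
    using x by (simp add: x_def power_divide divide_simps flip: exp_of_nat_mult)
  ultimately have "exp x / exp 1 \<le> P" using 1 by linarith
  then have "exp (- x) * (exp x / exp 1) \<le> exp (- x) * P" by (intro mult_left_mono) auto
  then show ?thesis
    by (simp add: poisson_below_def P_def p_def x_def exp_minus divide_simps)
qed

text \<open>Among monomials of degree \<open>k \<ge> \<alpha> R\<^sup>2\<close> the radial density \<open>h\<close> of the mass is increasing up to
  \<open>R\<close>, and below \<open>R - C\<close> it grows at least by the factor \<open>exp (\<alpha> C\<^sup>2 / 2)\<close> when the radius grows by
  \<open>C / 2\<close>. Integrating this comparison shows that such monomials put almost no mass
  at depth \<open>C\<close> inside the disc, uniformly in the radius.\<close>

lemma poisson_above_shrink:
  fixes \<alpha> C R r :: real
  assumes "\<alpha> > 0" "C \<ge> 0" "0 \<le> r" "r \<le> R - C" "\<alpha> * R\<^sup>2 \<le> real k"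
  shows "1 - poisson_below (Suc k) (\<alpha> * r\<^sup>2) \<le>
    exp (- (\<alpha> * C\<^sup>2 / 2)) * (1 - poisson_below (Suc k) (\<alpha> * R\<^sup>2))"
proof -
  define s where "s = C / 2"
  have s: "s \<ge> 0" using assms by (simp add: s_def)
  define e where "e = exp (- (2 * \<alpha> * s\<^sup>2))"
  define h where "h t = 2 * \<alpha> * t * (exp (- (\<alpha> * t\<^sup>2)) * (\<alpha> * t\<^sup>2) ^ k / fact k)" for t
  define D where "D t = e * (1 - poisson_below (Suc k) (\<alpha> * (t + s)\<^sup>2)) -
    (1 - poisson_below (Suc k) (\<alpha> * t\<^sup>2))" for t
  have dF: "((\<lambda>t. 1 - poisson_below (Suc k) (\<alpha> * t\<^sup>2)) has_real_derivative h t) (at t)" for t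
    unfolding h_def
    by (rule derivative_eq_intros DERIV_chain2[OF has_real_derivative_poisson_below] refl | simp)+
  have dF': "((\<lambda>t. 1 - poisson_below (Suc k) (\<alpha> * (t + s)\<^sup>2)) has_real_derivative h (t + s)) (at t)" for t
    using DERIV_shift[of "\<lambda>t. 1 - poisson_below (Suc k) (\<alpha> * t\<^sup>2)" "h (t + s)" t s] dF[of "t + s"] by simp
  \<comment> \<open>in logarithms it suffices that \<open>2 k ln ((t + s) / t) \<ge> \<alpha> (2 t s + 3 s\<^sup>2)\<close>, which follows from
    \<open>ln q \<ge> 1 - 1/q\<close> and \<open>k \<ge> \<alpha> (t + 2 s)\<^sup>2\<close>\<close>
  have h: "h t \<le> e * h (t + s)" if t: "0 \<le> t" "t \<le> r" for t
  proof (cases "t = 0")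
    case True
    then show ?thesis using assms s by (simp add: h_def e_def)
  next
    case False
    then have t0: "t > 0" using t by simp
    define q where "q = (t + s) / t"
    have q: "q \<ge> 1" using t0 s by (simp add: q_def)
    have "\<alpha> * (2 * t * s + 3 * s\<^sup>2) \<le> 2 * real k * (s / (t + s))"
    proof -
      have "(t + 2 * s)\<^sup>2 \<le> R\<^sup>2"
        using t assms s by (intro power_mono) (auto simp: s_def)
      then have "\<alpha> * (t + 2 * s)\<^sup>2 \<le> real k"
        using assms by (meson mult_left_mono order.trans less_imp_le)
      then have "\<alpha> * (t + 2 * s)\<^sup>2 * (2 * (s / (t + s))) \<le> real k * (2 * (s / (t + s)))"
        using t0 s by (intro mult_right_mono) auto
      moreover have "(2 * t * s + 3 * s\<^sup>2) * (t + s) \<le> (t + 2 * s)\<^sup>2 * (2 * s)"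
      proof -
        have "(t + 2 * s)\<^sup>2 * (2 * s) - (2 * t * s + 3 * s\<^sup>2) * (t + s) = s * (3 * t * s + 5 * s\<^sup>2)"
          by (simp add: algebra_simps power2_eq_square)
        also have "\<dots> \<ge> 0" using t0 s by auto
        finally show ?thesis by simp
      qed
      then have "2 * t * s + 3 * s\<^sup>2 \<le> (t + 2 * s)\<^sup>2 * (2 * (s / (t + s)))"
        using t0 s by (simp add: field_simps)
      then have "\<alpha> * (2 * t * s + 3 * s\<^sup>2) \<le> \<alpha> * ((t + 2 * s)\<^sup>2 * (2 * (s / (t + s))))"
        using assms by (intro mult_left_mono) auto
      ultimately show ?thesis by (simp add: mult_ac)
    qed
    also have "s / (t + s) \<le> ln q"
    proof -
      have "ln (1 / q) \<le> 1 / q - 1" using q by (intro ln_le_minus_one) auto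
      moreover have "1 / q - 1 = - (s / (t + s))" using t0 s by (simp add: q_def field_simps)
      ultimately show ?thesis using q by (simp add: ln_div)
    qed
    then have "2 * real k * (s / (t + s)) \<le> 2 * real k * ln q" by (intro mult_left_mono) auto
    finally have "exp (\<alpha> * (2 * t * s + 3 * s\<^sup>2)) \<le> exp (real (2 * k) * ln q)" by simp
    also have "\<dots> = q ^ (2 * k)" using q by (subst exp_of_nat_mult) auto
    finally have *: "exp (\<alpha> * (2 * t * s + 3 * s\<^sup>2)) \<le> (q\<^sup>2) ^ k" by (simp add: power_mult)
    have "(\<alpha> * t\<^sup>2) ^ k * exp (- (\<alpha> * t\<^sup>2)) =
       (\<alpha> * t\<^sup>2) ^ k * (exp (\<alpha> * (2 * t * s + 3 * s\<^sup>2)) * (e * exp (- (\<alpha> * (t + s)\<^sup>2))))"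
      by (simp add: e_def algebra_simps power2_eq_square flip: exp_add)
    also have "\<dots> \<le> (\<alpha> * t\<^sup>2) ^ k * ((q\<^sup>2) ^ k * (e * exp (- (\<alpha> * (t + s)\<^sup>2))))"
      using * assms by (intro mult_left_mono mult_right_mono) (auto simp: e_def)
    also have "\<dots> = (\<alpha> * (t + s)\<^sup>2) ^ k * (e * exp (- (\<alpha> * (t + s)\<^sup>2)))"
      using t0 by (simp add: q_def power_mult_distrib power_divide)
    finally have "(\<alpha> * t\<^sup>2) ^ k * exp (- (\<alpha> * t\<^sup>2)) \<le>
        (\<alpha> * (t + s)\<^sup>2) ^ k * (e * exp (- (\<alpha> * (t + s)\<^sup>2)))" .
    then have "t * ((\<alpha> * t\<^sup>2) ^ k * exp (- (\<alpha> * t\<^sup>2))) \<le>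
        (t + s) * ((\<alpha> * (t + s)\<^sup>2) ^ k * (e * exp (- (\<alpha> * (t + s)\<^sup>2))))"
      by (rule mult_mono[rotated]) (use t0 s assms in auto)
    then have "(2 * \<alpha> / fact k) * (t * ((\<alpha> * t\<^sup>2) ^ k * exp (- (\<alpha> * t\<^sup>2)))) \<le>
        (2 * \<alpha> / fact k) * ((t + s) * ((\<alpha> * (t + s)\<^sup>2) ^ k * (e * exp (- (\<alpha> * (t + s)\<^sup>2)))))"
      using assms by (intro mult_left_mono) auto
    then show ?thesis unfolding h_def by (simp only: mult_ac times_divide_eq_left times_divide_eq_right)
  qed
  have "D 0 \<le> D r"
  proof (rule DERIV_nonneg_imp_nondecreasing[OF assms(3)])
    fix t assume t: "0 \<le> t" "t \<le> r"
    have "(D has_real_derivative e * h (t + s) - h t) (at t)"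
      unfolding D_def by (intro DERIV_diff DERIV_cmult dF dF')
    then show "\<exists>y. (D has_real_derivative y) (at t) \<and> 0 \<le> y" using h[OF t] by auto
  qed
  moreover have "D 0 \<ge> 0" using poisson_below_le_1[of "\<alpha> * s\<^sup>2" "Suc k"] assms
    by (simp add: D_def e_def)
  ultimately have "1 - poisson_below (Suc k) (\<alpha> * r\<^sup>2) \<le> e * (1 - poisson_below (Suc k) (\<alpha> * (r + s)\<^sup>2))"
    by (simp add: D_def)
  also have "\<dots> \<le> e * (1 - poisson_below (Suc k) (\<alpha> * R\<^sup>2))"
    using assms s by (intro mult_left_mono diff_left_mono poisson_below_antimono power_mono)
       (auto simp: e_def s_def)
  also have "e = exp (- (\<alpha> * C\<^sup>2 / 2))" by (simp add: e_def s_def power_divide)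
  finally show ?thesis .
qed

section \<open>Radial integrals and rotations of the plane\<close>

text \<open>A disc of squared radius \<open>t\<close> has area \<open>\<pi> t\<close>, so the square of the modulus has constant density;
  this replaces polar coordinates for radial integrands.\<close>

lemma distr_lborel_norm_square:
  "distr lborel borel (\<lambda>z::complex. (cmod z)\<^sup>2) = density lborel (\<lambda>t. ennreal (pi * indicator {0..} t))"
    (is "?M = ?N")
proof (rule measure_eqI_generator_eq[where E="range (\<lambda>t::real. {..t})" and \<Omega>=UNIV and A="\<lambda>n. {..real n}"])
  show "Int_stable (range (\<lambda>t::real. {..t}))" by (auto simp: Int_stable_def)
  show "sets ?M = sigma_sets UNIV (range (\<lambda>t::real. {..t}))"
    using borel_eq_atMost[where 'a=real] by (metis sets_borel sets_distr sets_measure_of top_greatest Pow_UNIV)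
  show "sets ?N = sigma_sets UNIV (range (\<lambda>t::real. {..t}))"
    using borel_eq_atMost[where 'a=real] by (metis sets_borel sets_density sets_lborel sets_measure_of top_greatest Pow_UNIV)
  show "(\<Union>i. {..real i}) = UNIV" using real_arch_simple by auto
  have M: "emeasure ?M {..t} = ennreal (pi * max 0 t)" for t
  proof -
    have "emeasure ?M {..t} = emeasure lborel {z::complex. (cmod z)\<^sup>2 \<le> t}"
      by (subst emeasure_distr) (auto simp: vimage_def)
    also have "\<dots> = ennreal (pi * max 0 t)"
    proof (cases "t \<ge> 0")
      case True
      then have "{z::complex. (cmod z)\<^sup>2 \<le> t} = cball 0 (sqrt t)"
        by (auto simp: real_le_rsqrt sqrt_ge_absD)
      then show ?thesis using True
        by (simp add: emeasure_cball unit_ball_vol_2)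
    next
      case False
      then have "{z::complex. (cmod z)\<^sup>2 \<le> t} = {}"
        by (smt (verit) Collect_empty_eq zero_le_power2)
      then show ?thesis using False by simp
    qed
    finally show ?thesis .
  qed
  have N: "emeasure ?N {..t} = ennreal (pi * max 0 t)" for t
  proof -
    have "emeasure ?N {..t} = (\<integral>\<^sup>+ x. ennreal pi * indicator {0..t} x \<partial>lborel)"
      by (subst emeasure_density) (auto intro!: nn_integral_cong split: split_indicator)
    also have "\<dots> = ennreal (pi * max 0 t)"
      by (cases "t \<ge> 0") (simp_all add: nn_integral_cmult_indicator ennreal_mult)
    finally show ?thesis .
  qed
  show "emeasure ?M X = emeasure ?N X" if "X \<in> range (\<lambda>t::real. {..t})" for X
    using that M N by auto
  show "emeasure ?M {..real i} \<noteq> \<infinity>" for i by (simp add: M)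
qed auto

lemma nn_integral_radial:
  assumes [measurable]: "\<phi> \<in> borel_measurable borel"
  shows "(\<integral>\<^sup>+ z. \<phi> ((cmod z)\<^sup>2) \<partial>lborel) = (\<integral>\<^sup>+ t. ennreal (pi * indicator {0..} t) * \<phi> t \<partial>lborel)"
proof -
  have "(\<integral>\<^sup>+ z. \<phi> ((cmod z)\<^sup>2) \<partial>lborel) = (\<integral>\<^sup>+ t. \<phi> t \<partial>distr lborel borel (\<lambda>z::complex. (cmod z)\<^sup>2))"
    by (subst nn_integral_distr) auto
  then show ?thesis unfolding distr_lborel_norm_square by (subst (asm) nn_integral_density) auto
qed

text \<open>After the substitution \<open>t = |z|\<^sup>2\<close> the integrand has the primitive
  \<open>- k! / \<alpha>\<^sup>k\<close> times \<open>poisson_below (Suc k) (\<alpha> t)\<close>.\<close>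

lemma nn_integral_monomial_ball:
  assumes "\<alpha> > 0" "R \<ge> 0"
  shows "(\<integral>\<^sup>+ z. ennreal (\<alpha> / pi * ((cmod z)\<^sup>2) ^ k * exp (- \<alpha> * (cmod z)\<^sup>2)) * indicator (ball 0 R) z \<partial>lborel)
    = ennreal (fact k / \<alpha> ^ k * (1 - poisson_below (Suc k) (\<alpha> * R\<^sup>2)))"
proof -
  define h where "h t = \<alpha> * t ^ k * exp (- \<alpha> * t)" for t :: real
  define H where "H t = - (fact k / \<alpha> ^ k) * poisson_below (Suc k) (\<alpha> * t)" for t
  have "(\<integral>\<^sup>+ z. ennreal (\<alpha> / pi * ((cmod z)\<^sup>2) ^ k * exp (- \<alpha> * (cmod z)\<^sup>2)) * indicator (ball 0 R) z \<partial>lborel) =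
     (\<integral>\<^sup>+ z. (\<lambda>t. ennreal (\<alpha> / pi * t ^ k * exp (- \<alpha> * t)) * indicator {..<R\<^sup>2} t) ((cmod z)\<^sup>2) \<partial>lborel)"
  proof (intro nn_integral_cong)
    fix z :: complex
    have "z \<in> ball 0 R \<longleftrightarrow> (cmod z)\<^sup>2 \<in> {..<R\<^sup>2}"
      using assms power_strict_mono[of "cmod z" R 2] power2_less_imp_less[of "cmod z" R] by auto
    then show "ennreal (\<alpha> / pi * ((cmod z)\<^sup>2) ^ k * exp (- \<alpha> * (cmod z)\<^sup>2)) * indicator (ball 0 R) z =
        ennreal (\<alpha> / pi * ((cmod z)\<^sup>2) ^ k * exp (- \<alpha> * (cmod z)\<^sup>2)) * indicator {..<R\<^sup>2} ((cmod z)\<^sup>2)"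
      by (simp only: indicator_def)
  qed
  also have "\<dots> = (\<integral>\<^sup>+ t. ennreal (pi * indicator {0..} t) *
      (ennreal (\<alpha> / pi * t ^ k * exp (- \<alpha> * t)) * indicator {..<R\<^sup>2} t) \<partial>lborel)"
    by (rule nn_integral_radial) measurable
  also have "\<dots> = (\<integral>\<^sup>+ t. ennreal (h t) * indicator {0..R\<^sup>2} t \<partial>lborel)"
  \<comment> \<open>the integrands differ only at the endpoint \<open>R\<^sup>2\<close>\<close>
  proof (rule nn_integral_cong_AE)
    show "AE t in lborel. ennreal (pi * indicator {0..} t) *
        (ennreal (\<alpha> / pi * t ^ k * exp (- \<alpha> * t)) * indicator {..<R\<^sup>2} t) =
        ennreal (h t) * indicator {0..R\<^sup>2} t"
      using AE_lborel_singleton[of "R\<^sup>2"]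
      by eventually_elim (auto split: split_indicator simp: h_def simp flip: ennreal_mult')
  qed
  also have "\<dots> = ennreal (H (R\<^sup>2) - H 0)"
  proof (rule nn_integral_FTC_Icc)
    fix t :: real
    have "(H has_real_derivative h t) (at t)"
    proof -
      have "((\<lambda>t. poisson_below (Suc k) (\<alpha> * t)) has_real_derivative
          - (exp (- (\<alpha> * t)) * (\<alpha> * t) ^ k / fact k) * \<alpha>) (at t)"
        by (rule DERIV_chain2[OF has_real_derivative_poisson_below])
           (auto intro!: derivative_eq_intros)
      from DERIV_cmult[OF this, of "- (fact k / \<alpha> ^ k)"]
      show ?thesis unfolding H_def h_def using assms
        by (simp add: power_mult_distrib mult_ac)
    qed
    then show "DERIV H t :> h t" .
  qed (use assms in \<open>auto simp: h_def intro!: continuous_intros\<close>)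
  also have "H (R\<^sup>2) - H 0 = fact k / \<alpha> ^ k * (1 - poisson_below (Suc k) (\<alpha> * R\<^sup>2))"
    by (simp add: H_def right_diff_distrib)
  finally show ?thesis .
qed

lemma nn_integral_lborel_translate:
  fixes \<phi> :: "'a::euclidean_space \<Rightarrow> ennreal"
  assumes [measurable]: "\<phi> \<in> borel_measurable borel"
  shows "(\<integral>\<^sup>+ x. \<phi> (c + x) \<partial>lborel) = (\<integral>\<^sup>+ x. \<phi> x \<partial>lborel)"
proof -
  have "(\<integral>\<^sup>+ x. \<phi> x \<partial>lborel) = (\<integral>\<^sup>+ x. \<phi> x \<partial>distr lborel borel ((+) c))"
    by (simp add: lborel_distr_plus)
  also have "\<dots> = (\<integral>\<^sup>+ x. \<phi> (c + x) \<partial>lborel)" by (subst nn_integral_distr) auto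
  finally show ?thesis by simp
qed

text \<open>The image measure \<open>M\<close> is invariant under translations and gives discs of radius 1 their area.
  Such a measure is Lebesgue measure: by Fubini, \<open>M A * area D\<close> and \<open>area A * M D\<close> are two evaluations
  of the same double integral over the unit disc \<open>D\<close>, by translating in one or in the other variable.\<close>

lemma lborel_distr_rotation:
  assumes "cmod c = 1"
  shows "distr lborel borel ((*) c) = lborel"
proof (rule measure_eqI)
  define M where "M = distr lborel borel ((*) c)"
  have c0: "c \<noteq> 0" using assms by auto
  have sets_M [measurable_cong, simp]: "sets M = sets borel" by (simp add: M_def)
  have nnM: "(\<integral>\<^sup>+ x. \<phi> x \<partial>M) = (\<integral>\<^sup>+ x. \<phi> (c * x) \<partial>lborel)"
    if "\<phi> \<in> borel_measurable borel" for \<phi>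
    using that unfolding M_def by (subst nn_integral_distr) auto
  have transM: "(\<integral>\<^sup>+ x. \<phi> (a + x) \<partial>M) = (\<integral>\<^sup>+ x. \<phi> x \<partial>M)"
    if [measurable]: "\<phi> \<in> borel_measurable borel" for \<phi> a
  proof -
    have "(\<integral>\<^sup>+ x. \<phi> (a + x) \<partial>M) = (\<integral>\<^sup>+ x. \<phi> (c * (a / c + x)) \<partial>lborel)"
      using c0 by (subst nnM) (auto simp: algebra_simps)
    also have "\<dots> = (\<integral>\<^sup>+ x. \<phi> (c * x) \<partial>lborel)"
      by (rule nn_integral_lborel_translate) measurable
    finally show ?thesis by (simp add: nnM)
  qed
  have ball: "(\<integral>\<^sup>+ x. indicator (ball y 1) x \<partial>M) = ennreal pi" for y
  proof -
    have "(\<integral>\<^sup>+ x. indicator (ball y 1) x \<partial>M) = (\<integral>\<^sup>+ x. indicator (ball y 1) (c * x) \<partial>lborel)"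
      by (intro nnM borel_measurable_indicator) auto
    also have "\<dots> = (\<integral>\<^sup>+ x. indicator (ball (y / c) 1) x \<partial>lborel)"
    proof (intro nn_integral_cong)
      fix x
      have "cmod (y - c * x) = cmod (c * (y / c - x))" using c0 by (simp add: algebra_simps)
      also have "\<dots> = cmod (y / c - x)" using assms by (simp only: norm_mult)
      finally show "(indicator (ball y 1) (c * x) :: ennreal) = indicator (ball (y / c) 1) x"
        by (auto simp: dist_norm split: split_indicator)
    qed
    finally show ?thesis by (simp add: emeasure_ball unit_ball_vol_2)
  qed
  have "sigma_finite_measure M"
  proof (rule sigma_finite_measure.intro, intro exI conjI)
    show "countable (range (\<lambda>n::nat. ball (0::complex) (real n)))" by auto
    show "range (\<lambda>n::nat. ball (0::complex) (real n)) \<subseteq> sets M" by auto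
    show "\<Union> (range (\<lambda>n::nat. ball (0::complex) (real n))) = space M"
      using reals_Archimedean2 by (auto simp: M_def)
    show "\<forall>a\<in>range (\<lambda>n::nat. ball (0::complex) (real n)). emeasure M a \<noteq> \<infinity>"
    proof
      fix a assume "a \<in> range (\<lambda>n::nat. ball (0::complex) (real n))"
      then obtain n where a: "a = ball 0 (real n)" by auto
      have "emeasure M a = emeasure lborel ((*) c -` a)"
        unfolding M_def by (subst emeasure_distr) (auto simp: a)
      also have "(*) c -` a = a" using assms by (auto simp: a norm_mult)
      also have "emeasure lborel a < \<infinity>" unfolding a by (rule emeasure_lborel_ball_finite)
      finally show "emeasure M a \<noteq> \<infinity>" by simp
    qed
  qed
  then interpret M: sigma_finite_measure M .
  interpret P: pair_sigma_finite M lborel ..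
  fix A :: "complex set" assume "A \<in> sets (distr lborel borel ((*) c))"
  then have [measurable]: "A \<in> sets borel" by simp
  define I where "I = (indicator A :: complex \<Rightarrow> ennreal)"
  define J where "J = (indicator (ball 0 1) :: complex \<Rightarrow> ennreal)"
  have [measurable]: "I \<in> borel_measurable borel" "J \<in> borel_measurable borel"
    by (auto simp: I_def J_def intro!: borel_measurable_indicator)
  have Jpi: "(\<integral>\<^sup>+ y. J y \<partial>lborel) = ennreal pi" by (simp add: J_def emeasure_ball unit_ball_vol_2)
  have "emeasure M A * ennreal pi = (\<integral>\<^sup>+ y. (\<integral>\<^sup>+ x. I x \<partial>M) * J y \<partial>lborel)"
    by (simp add: nn_integral_cmult Jpi) (simp add: I_def)
  also have "\<dots> = (\<integral>\<^sup>+ y. (\<integral>\<^sup>+ x. I (y + x) * J y \<partial>M) \<partial>lborel)"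
    by (intro nn_integral_cong) (simp add: nn_integral_multc transM)
  also have "\<dots> = (\<integral>\<^sup>+ x. (\<integral>\<^sup>+ y. I (y + x) * J y \<partial>lborel) \<partial>M)"
    by (rule P.Fubini') measurable
  also have "\<dots> = (\<integral>\<^sup>+ x. (\<integral>\<^sup>+ y. I y * J (y - x) \<partial>lborel) \<partial>M)"
  proof (rule nn_integral_cong)
    fix x
    show "(\<integral>\<^sup>+ y. I (y + x) * J y \<partial>lborel) = (\<integral>\<^sup>+ y. I y * J (y - x) \<partial>lborel)"
      using nn_integral_lborel_translate[of "\<lambda>y. I y * J (y - x)" x] by (simp add: add.commute)
  qed
  also have "\<dots> = (\<integral>\<^sup>+ y. (\<integral>\<^sup>+ x. I y * J (y - x) \<partial>M) \<partial>lborel)"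
    by (rule P.Fubini'[symmetric]) measurable
  also have "\<dots> = (\<integral>\<^sup>+ y. I y * ennreal pi \<partial>lborel)"
  proof (rule nn_integral_cong)
    fix y
    have "J (y - x) = indicator (ball y 1) x" for x 
      by (simp add: J_def dist_norm norm_minus_commute[of y] split: split_indicator)
    then show "(\<integral>\<^sup>+ x. I y * J (y - x) \<partial>M) = I y * ennreal pi"
      using ball[of y] by (simp add: nn_integral_cmult_indicator)
  qed
  also have "\<dots> = emeasure lborel A * ennreal pi"
    by (subst nn_integral_multc) (auto simp: I_def)
  finally have "emeasure M A * ennreal pi * ennreal (1 / pi) = emeasure lborel A * ennreal pi * ennreal (1 / pi)"
    by simp
  then show "emeasure (distr lborel borel ((*) c)) A = emeasure lborel A"
    by (simp add: M_def mult.assoc flip: ennreal_mult')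
qed auto

text \<open>Rotating by the angle \<open>\<pi> / (j - k)\<close> changes the sign of the integrand.\<close>

lemma integral_rotation_orthogonal:
  fixes \<phi> :: "real \<Rightarrow> real" and j k :: nat
  assumes "j \<noteq> k" and [measurable]: "\<phi> \<in> borel_measurable borel"
  shows "(LINT z|lborel. complex_of_real (\<phi> (cmod z)) * (z ^ j * cnj (z ^ k))) = 0"
proof -
  define c where "c = cis (pi / (real j - real k))"
  have c: "cmod c = 1" by (simp add: c_def)
  have "c ^ j * cnj (c ^ k) = cis (real j * (pi / (real j - real k)) + - (real k * (pi / (real j - real k))))"
    by (simp only: c_def Complex.DeMoivre cis_cnj cis_mult)
  also have "real j * (pi / (real j - real k)) + - (real k * (pi / (real j - real k))) =
      pi / (real j - real k) * (real j - real k)"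
    by (simp only: algebra_simps)
  also have "cis (pi / (real j - real k) * (real j - real k)) = - 1" using assms by simp
  finally have c': "c ^ j * cnj (c ^ k) = - 1" .
  have [measurable]: "(*) c \<in> borel_measurable borel" by (intro borel_measurable_continuous_onI continuous_intros)
  let ?F = "\<lambda>z. complex_of_real (\<phi> (cmod z)) * (z ^ j * cnj (z ^ k))"
  have [measurable]: "cnj \<in> borel_measurable borel" by (intro borel_measurable_continuous_onI continuous_intros)
  have "(LINT z|lborel. ?F z) = (LINT z|distr lborel borel ((*) c). ?F z)"
    using c by (simp only: lborel_distr_rotation)
  also have "\<dots> = (LINT z|lborel. ?F (c * z))"
    by (subst integral_distr) measurable
  also have "\<dots> = (LINT z|lborel. - ?F z)"
  proof (intro Bochner_Integration.integral_cong refl)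
    fix z
    have "?F (c * z) = (c ^ j * cnj (c ^ k)) * ?F z"
      using c by (simp add: norm_mult power_mult_distrib mult_ac)
    then show "?F (c * z) = - ?F z" by (simp only: c') simp
  qed
  finally show ?thesis by simp
qed

section \<open>Parseval's identity on discs\<close>

definition disc_weight :: "real \<Rightarrow> real \<Rightarrow> complex \<Rightarrow> real" where
  "disc_weight \<alpha> R z = indicator {..<R} (cmod z) * (\<alpha> / pi * exp (- \<alpha> * (cmod z)\<^sup>2))"

text \<open>The closed form of the integral of \<open>|z|\<^sup>2\<^sup>k\<close> against the weight on the disc of radius \<open>R\<close>.\<close>

definition disc_moment :: "real \<Rightarrow> real \<Rightarrow> nat \<Rightarrow> real" where
  "disc_moment \<alpha> R k = fact k / \<alpha> ^ k * (1 - poisson_below (Suc k) (\<alpha> * R\<^sup>2))"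

lemma disc_moment_nonneg: "\<alpha> > 0 \<Longrightarrow> disc_moment \<alpha> R k \<ge> 0"
  using poisson_below_le_1[of "\<alpha> * R\<^sup>2"] by (simp add: disc_moment_def)

lemma disc_weight_nonneg: "\<alpha> > 0 \<Longrightarrow> disc_weight \<alpha> R z \<ge> 0"
  by (simp add: disc_weight_def)

lemma disc_weight_measurable [measurable]: "disc_weight \<alpha> R \<in> borel_measurable borel"
  unfolding disc_weight_def by measurable

lemma cnj_measurable [measurable]: "cnj \<in> borel_measurable borel"
  by (intro borel_measurable_continuous_onI continuous_intros)

lemma disc_weight_integrable:
  assumes "\<alpha> > 0" and h: "continuous_on UNIV h"
  shows "integrable lborel (\<lambda>z. complex_of_real (disc_weight \<alpha> R z) * h z)"
proof -
  have [measurable]: "h \<in> borel_measurable borel"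
    using h by (rule borel_measurable_continuous_onI)
  have "integrable lborel (\<lambda>z. indicator (cball 0 R) z *\<^sub>R (complex_of_real (\<alpha> / pi * exp (- \<alpha> * (cmod z)\<^sup>2)) * h z))"
    by (rule borel_integrable_compact)
       (auto intro!: continuous_intros continuous_on_subset[OF h])
  then show ?thesis
    by (rule Bochner_Integration.integrable_bound)
       (auto simp: disc_weight_def norm_mult assms split: split_indicator)
qed

lemma disc_weight_monomials:
  assumes "\<alpha> > 0" "R \<ge> 0"
  shows "(LINT z|lborel. complex_of_real (disc_weight \<alpha> R z) * (z ^ j * cnj (z ^ k))) =
    (if j = k then complex_of_real (disc_moment \<alpha> R k) else 0)"
proof (cases "j = k")
  case False
  have "(\<lambda>r. indicator {..<R} r * (\<alpha> / pi * exp (- \<alpha> * r\<^sup>2)) :: real) \<in> borel_measurable borel"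
    by measurable
  from integral_rotation_orthogonal[OF False this] False show ?thesis
    by (simp add: disc_weight_def)
next
  case True
  have "(\<integral>\<^sup>+ z. ennreal (disc_weight \<alpha> R z * ((cmod z)\<^sup>2) ^ k) \<partial>lborel) = ennreal (disc_moment \<alpha> R k)"
    unfolding disc_moment_def nn_integral_monomial_ball[OF assms, symmetric]
    by (intro nn_integral_cong) (auto simp: disc_weight_def mult_ac split: split_indicator)
  then have "(LINT z|lborel. disc_weight \<alpha> R z * ((cmod z)\<^sup>2) ^ k) = disc_moment \<alpha> R k"
    by (subst integral_eq_nn_integral) (auto simp: disc_weight_nonneg disc_moment_nonneg assms)
  then have "(LINT z|lborel. complex_of_real (disc_weight \<alpha> R z * ((cmod z)\<^sup>2) ^ k)) =
      complex_of_real (disc_moment \<alpha> R k)"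
    by (subst integral_complex_of_real) simp
  moreover have "complex_of_real (disc_weight \<alpha> R z * ((cmod z)\<^sup>2) ^ k) =
      complex_of_real (disc_weight \<alpha> R z) * (z ^ k * cnj (z ^ k))" for z
    by (simp only: complex_cnj_power power_mult_distrib[symmetric] complex_norm_square[symmetric]
        of_real_mult of_real_power)
  ultimately show ?thesis unfolding True by (simp only: simp_thms if_True)
qed

definition taylor_coeff :: "(complex \<Rightarrow> complex) \<Rightarrow> nat \<Rightarrow> complex" where
  "taylor_coeff g k = (deriv ^^ k) g 0 / fact k"

lemma entire_taylor_sums:
  assumes "g holomorphic_on UNIV"
  shows "(\<lambda>k. taylor_coeff g k * z ^ k) sums g z"
  using holomorphic_power_series[of g 0 "cmod z + 1" z] holomorphic_on_subset[OF assms]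
  by (simp add: taylor_coeff_def)

lemma entire_taylor_summable:
  assumes "g holomorphic_on UNIV"
  shows "summable (\<lambda>k. cmod (taylor_coeff g k) * R ^ k)"
proof -
  have "summable (\<lambda>k. taylor_coeff g k * complex_of_real (\<bar>R\<bar> + 1) ^ k)"
    using entire_taylor_sums[OF assms] by (rule sums_summable)
  then have "summable (\<lambda>k. norm (taylor_coeff g k * complex_of_real \<bar>R\<bar> ^ k))"
    by (rule powser_insidea) simp
  then have "summable (\<lambda>k. norm (cmod (taylor_coeff g k) * R ^ k))"
    by (simp add: norm_mult norm_power abs_mult power_abs)
  then show ?thesis by (rule summable_norm_cancel)
qed

lemma entire_continuous: "g holomorphic_on UNIV \<Longrightarrow> continuous_on UNIV g"
  by (rule holomorphic_on_imp_continuous_on)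

text \<open>On a disc the Taylor series is dominated by its absolute values on the boundary circle,
  so it can be integrated term by term.\<close>

lemma disc_weight_taylor_sums:
  assumes "\<alpha> > 0" "R \<ge> 0" and g: "g holomorphic_on UNIV" and h: "continuous_on UNIV h"
  shows "(\<lambda>k. taylor_coeff g k * (LINT z|lborel. complex_of_real (disc_weight \<alpha> R z) * (z ^ k * h z))) sums
    (LINT z|lborel. complex_of_real (disc_weight \<alpha> R z) * (g z * h z))"
proof -
  define s where "s n z = (\<Sum>k<n. taylor_coeff g k * z ^ k)" for n z
  define B where "B = (\<Sum>k. cmod (taylor_coeff g k) * R ^ k)"
  have [measurable]: "g \<in> borel_measurable borel" "h \<in> borel_measurable borel"
    using g h by (auto intro!: borel_measurable_continuous_onI entire_continuous)
  have int: "integrable lborel (\<lambda>z. complex_of_real (disc_weight \<alpha> R z) * h z)"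
    by (rule disc_weight_integrable[OF assms(1) h])
  have "(\<lambda>n. LINT z|lborel. complex_of_real (disc_weight \<alpha> R z) * (s n z * h z)) \<longlonglongrightarrow>
      (LINT z|lborel. complex_of_real (disc_weight \<alpha> R z) * (g z * h z))"
  proof (rule integral_dominated_convergence[where w="\<lambda>z. B * cmod (complex_of_real (disc_weight \<alpha> R z) * h z)"])
    show "integrable lborel (\<lambda>z. B * cmod (complex_of_real (disc_weight \<alpha> R z) * h z))"
      using int by (intro integrable_mult_right integrable_norm)
    show "AE z in lborel. (\<lambda>n. complex_of_real (disc_weight \<alpha> R z) * (s n z * h z)) \<longlonglongrightarrow>
        complex_of_real (disc_weight \<alpha> R z) * (g z * h z)"
      using entire_taylor_sums[OF g] unfolding s_def sums_def
      by (intro AE_I2 tendsto_intros) auto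
    show "AE z in lborel. cmod (complex_of_real (disc_weight \<alpha> R z) * (s n z * h z)) \<le>
        B * cmod (complex_of_real (disc_weight \<alpha> R z) * h z)" for n
    proof (rule AE_I2)
      fix z :: complex
      show "cmod (complex_of_real (disc_weight \<alpha> R z) * (s n z * h z)) \<le>
        B * cmod (complex_of_real (disc_weight \<alpha> R z) * h z)"
      proof (cases "cmod z < R")
        case True
        have "cmod (s n z) \<le> (\<Sum>k<n. cmod (taylor_coeff g k * z ^ k))" unfolding s_def by (rule norm_sum)
        also have "\<dots> \<le> (\<Sum>k<n. cmod (taylor_coeff g k) * R ^ k)"
          using True by (intro sum_mono) (auto simp: norm_mult norm_power intro!: mult_left_mono power_mono)
        also have "\<dots> \<le> B" unfolding B_def
          using entire_taylor_summable[OF g, of R] assms by (intro sum_le_suminf) auto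
        finally have "cmod (s n z) * cmod (complex_of_real (disc_weight \<alpha> R z) * h z) \<le>
           B * cmod (complex_of_real (disc_weight \<alpha> R z) * h z)" by (rule mult_right_mono) auto
        then show ?thesis by (simp add: norm_mult mult_ac)
      qed (simp add: disc_weight_def)
    qed
  qed (auto simp: s_def)
  also have "(\<lambda>n. LINT z|lborel. complex_of_real (disc_weight \<alpha> R z) * (s n z * h z)) =
    (\<lambda>n. \<Sum>k<n. taylor_coeff g k * (LINT z|lborel. complex_of_real (disc_weight \<alpha> R z) * (z ^ k * h z)))"
  proof
    fix n
    have int: "integrable lborel (\<lambda>z. complex_of_real (disc_weight \<alpha> R z) * (z ^ k * h z))" for k
      by (intro disc_weight_integrable assms continuous_intros)
    have "(LINT z|lborel. complex_of_real (disc_weight \<alpha> R z) * (s n z * h z)) =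
      (LINT z|lborel. (\<Sum>k<n. taylor_coeff g k * (complex_of_real (disc_weight \<alpha> R z) * (z ^ k * h z))))"
      by (simp add: s_def sum_distrib_left sum_distrib_right mult_ac)
    also have "\<dots> = (\<Sum>k<n. LINT z|lborel. taylor_coeff g k * (complex_of_real (disc_weight \<alpha> R z) * (z ^ k * h z)))"
      using int by (intro Bochner_Integration.integral_sum integrable_mult_right)
    finally show "(LINT z|lborel. complex_of_real (disc_weight \<alpha> R z) * (s n z * h z)) =
      (\<Sum>k<n. taylor_coeff g k * (LINT z|lborel. complex_of_real (disc_weight \<alpha> R z) * (z ^ k * h z)))"
      by simp
  qed
  finally show ?thesis unfolding sums_def .
qed

text \<open>Expanding \<open>g\<close> and using orthogonality leaves one term. This expresses a Taylor coefficient as an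
  integral over any disc centred at 0.\<close>

lemma disc_weight_taylor_coeff:
  assumes "\<alpha> > 0" "R \<ge> 0" and g: "g holomorphic_on UNIV"
  shows "(LINT z|lborel. complex_of_real (disc_weight \<alpha> R z) * (g z * cnj (z ^ k))) =
    taylor_coeff g k * complex_of_real (disc_moment \<alpha> R k)"
proof -
  have "continuous_on UNIV (\<lambda>z. cnj (z ^ k))" by (intro continuous_intros)
  then have "(\<lambda>j. taylor_coeff g j * (if j = k then complex_of_real (disc_moment \<alpha> R k) else 0)) sums
    (LINT z|lborel. complex_of_real (disc_weight \<alpha> R z) * (g z * cnj (z ^ k)))"
    using disc_weight_taylor_sums[OF assms, of "\<lambda>z. cnj (z ^ k)"]
    by (simp only: disc_weight_monomials[OF assms(1,2)])
  moreover have "(\<lambda>j. taylor_coeff g j * (if j = k then complex_of_real (disc_moment \<alpha> R k) else 0)) sums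
     (taylor_coeff g k * complex_of_real (disc_moment \<alpha> R k))"
    using sums_single[of k "\<lambda>k. taylor_coeff g k * complex_of_real (disc_moment \<alpha> R k)"]
    by (simp add: if_distrib cong: if_cong)
  ultimately show ?thesis by (rule sums_unique2)
qed

text \<open>Parseval's identity on a disc, obtained by integrating the Taylor series of \<open>g\<close> against the
  conjugate of \<open>g\<close> itself; the remaining integrals are conjugates of Taylor coefficients.\<close>

lemma disc_weight_parseval:
  assumes "\<alpha> > 0" "R \<ge> 0" and g: "g holomorphic_on UNIV"
  shows "(\<lambda>k. (cmod (taylor_coeff g k))\<^sup>2 * disc_moment \<alpha> R k) sums
    (LINT z|lborel. disc_weight \<alpha> R z * (cmod (g z))\<^sup>2)"
proof -
  have conj: "(LINT z|lborel. complex_of_real (disc_weight \<alpha> R z) * (z ^ k * cnj (g z))) =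
      cnj (taylor_coeff g k) * complex_of_real (disc_moment \<alpha> R k)" for k
  proof -
    have "(LINT z|lborel. complex_of_real (disc_weight \<alpha> R z) * (z ^ k * cnj (g z))) =
      (LINT z|lborel. cnj (complex_of_real (disc_weight \<alpha> R z) * (g z * cnj (z ^ k))))"
      by (simp add: mult_ac)
    also have "\<dots> = cnj (LINT z|lborel. complex_of_real (disc_weight \<alpha> R z) * (g z * cnj (z ^ k)))"
      by (rule Bochner_Integration.integral_cnj)
    finally show ?thesis by (simp only: disc_weight_taylor_coeff[OF assms]) simp
  qed
  have "(\<lambda>k. taylor_coeff g k * (cnj (taylor_coeff g k) * complex_of_real (disc_moment \<alpha> R k))) sums
    (LINT z|lborel. complex_of_real (disc_weight \<alpha> R z) * (g z * cnj (g z)))"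
    using disc_weight_taylor_sums[OF assms, of "\<lambda>z. cnj (g z)"] entire_continuous[OF g]
    by (simp only: conj) (auto intro!: continuous_intros)
  moreover have "taylor_coeff g k * (cnj (taylor_coeff g k) * complex_of_real (disc_moment \<alpha> R k)) =
     complex_of_real ((cmod (taylor_coeff g k))\<^sup>2 * disc_moment \<alpha> R k)" for k
    by (simp add: complex_norm_square mult_ac del: of_real_power)
  moreover have "complex_of_real (disc_weight \<alpha> R z) * (g z * cnj (g z)) =
     complex_of_real (disc_weight \<alpha> R z * (cmod (g z))\<^sup>2)" for z
    by (simp add: complex_norm_square mult_ac del: of_real_power)
  ultimately have "(\<lambda>k. complex_of_real ((cmod (taylor_coeff g k))\<^sup>2 * disc_moment \<alpha> R k)) sums
     (LINT z|lborel. complex_of_real (disc_weight \<alpha> R z * (cmod (g z))\<^sup>2))"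
    by simp
  then show ?thesis by (simp only: integral_complex_of_real sums_of_real_iff)
qed

section \<open>Mass of an entire function and translations\<close>

text \<open>The measure \<open>(\<alpha> / \<pi>) |f|\<^sup>2 exp (- \<alpha> |z|\<^sup>2) dm\<close> as an extended-valued object: no integrability of
  \<open>f\<close> is presupposed, and countable unions of discs can be handled by subadditivity.\<close>

definition fock_mass :: "real \<Rightarrow> (complex \<Rightarrow> complex) \<Rightarrow> complex measure" where
  "fock_mass \<alpha> f = density lborel (\<lambda>z. ennreal (\<alpha> / pi * ((cmod (f z))\<^sup>2 * exp (- \<alpha> * (cmod z)\<^sup>2))))"

lemma sets_fock_mass [simp, measurable_cong]: "sets (fock_mass \<alpha> f) = sets borel"
  by (simp add: fock_mass_def)

lemma space_fock_mass [simp]: "space (fock_mass \<alpha> f) = UNIV"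
  by (simp add: fock_mass_def)

lemma entire_measurable: "f holomorphic_on UNIV \<Longrightarrow> f \<in> borel_measurable borel"
  by (intro borel_measurable_continuous_onI entire_continuous)

lemma emeasure_fock_mass:
  assumes "f holomorphic_on UNIV" "A \<in> sets borel"
  shows "emeasure (fock_mass \<alpha> f) A =
    (\<integral>\<^sup>+ z. ennreal (\<alpha> / pi * ((cmod (f z))\<^sup>2 * exp (- \<alpha> * (cmod z)\<^sup>2))) * indicator A z \<partial>lborel)"
proof -
  have [measurable]: "f \<in> borel_measurable borel" using assms by (intro entire_measurable)
  show ?thesis unfolding fock_mass_def using assms by (subst emeasure_density) auto
qed

lemma emeasure_fock_mass_disc:
  assumes "\<alpha> > 0" "R \<ge> 0" and g: "g holomorphic_on UNIV"
  shows "emeasure (fock_mass \<alpha> g) (ball 0 R) = (\<Sum>k. ennreal ((cmod (taylor_coeff g k))\<^sup>2 * disc_moment \<alpha> R k))"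
proof -
  have "emeasure (fock_mass \<alpha> g) (ball 0 R) = (\<integral>\<^sup>+ z. ennreal (disc_weight \<alpha> R z * (cmod (g z))\<^sup>2) \<partial>lborel)"
    using assms by (subst emeasure_fock_mass)
      (auto intro!: nn_integral_cong simp: disc_weight_def mult_ac split: split_indicator)
  also have "\<dots> = ennreal (LINT z|lborel. disc_weight \<alpha> R z * (cmod (g z))\<^sup>2)"
  proof (rule nn_integral_eq_integral)
    have "integrable lborel (\<lambda>z. complex_of_real (disc_weight \<alpha> R z) * complex_of_real ((cmod (g z))\<^sup>2))"
      by (intro disc_weight_integrable assms continuous_intros entire_continuous)
    then have "integrable lborel (\<lambda>z. complex_of_real (disc_weight \<alpha> R z * (cmod (g z))\<^sup>2))" by simp
    then show "integrable lborel (\<lambda>z. disc_weight \<alpha> R z * (cmod (g z))\<^sup>2)"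
      by (simp only: complex_of_real_integrable_eq)
  qed (use assms in \<open>auto simp: disc_weight_nonneg\<close>)
  also have "\<dots> = (\<Sum>k. ennreal ((cmod (taylor_coeff g k))\<^sup>2 * disc_moment \<alpha> R k))"
    using disc_weight_parseval[OF assms] disc_moment_nonneg[OF assms(1)]
    by (intro suminf_ennreal_eq[symmetric]) auto
  finally show ?thesis .
qed

lemma fock_translation_holomorphic:
  "f holomorphic_on UNIV \<Longrightarrow> fock_translation \<alpha> l f holomorphic_on UNIV"
  unfolding fock_translation_def
  by (intro holomorphic_intros holomorphic_on_compose_gen[of "\<lambda>z. z - l" _ f UNIV, unfolded o_def]) auto

text \<open>The translation moves the Gaussian-weighted modulus along with the point; every estimate on a disc
  around \<open>l\<close> thereby reduces to a disc around 0.\<close>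

lemma norm_fock_translation:
  "(cmod (fock_translation \<alpha> (- l) f z))\<^sup>2 * exp (- \<alpha> * (cmod z)\<^sup>2) =
   (cmod (f (l + z)))\<^sup>2 * exp (- \<alpha> * (cmod (l + z))\<^sup>2)"
proof -
  have "(cmod (l + z))\<^sup>2 = (cmod l)\<^sup>2 + (cmod z)\<^sup>2 + 2 * Re (cnj l * z)"
    by (simp only: cmod_power2) (simp add: power2_eq_square algebra_simps)
  then show ?thesis
    by (simp add: fock_translation_def norm_mult power_mult_distrib mult_ac add.commute
        flip: exp_double exp_add) (simp add: algebra_simps)
qed

lemma emeasure_fock_mass_translate:
  assumes f: "f holomorphic_on UNIV"
  shows "emeasure (fock_mass \<alpha> (fock_translation \<alpha> (- l) f)) (ball 0 R) = emeasure (fock_mass \<alpha> f) (ball l R)"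
proof -
  have [measurable]: "f \<in> borel_measurable borel" using f by (rule entire_measurable)
  have [measurable]: "ball l R \<in> sets borel" by (rule borel_open[OF open_ball])
  have "emeasure (fock_mass \<alpha> (fock_translation \<alpha> (- l) f)) (ball 0 R) =
    (\<integral>\<^sup>+ z. (\<lambda>z. ennreal (\<alpha> / pi * ((cmod (f z))\<^sup>2 * exp (- \<alpha> * (cmod z)\<^sup>2))) * indicator (ball l R) z) (l + z) \<partial>lborel)"
    by (simp only: emeasure_fock_mass[OF fock_translation_holomorphic[OF f] borel_open[OF open_ball]]
          norm_fock_translation)
       (auto intro!: nn_integral_cong simp: dist_norm split: split_indicator)
  also have "\<dots> = emeasure (fock_mass \<alpha> f) (ball l R)"
    by (subst nn_integral_lborel_translate) (measurable, simp only: emeasure_fock_mass[OF f borel_open[OF open_ball]])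
  finally show ?thesis .
qed

section \<open>Coefficients as inner products\<close>

lemma poisson_below_tendsto_0: "(poisson_below n \<longlongrightarrow> 0) at_top"
proof -
  have "((\<lambda>x::real. \<Sum>j<n. x ^ j / exp x / fact j) \<longlongrightarrow> (\<Sum>j<n. 0 / fact j)) at_top"
    by (intro tendsto_sum tendsto_divide[OF tendsto_power_div_exp_0 tendsto_const]) auto
  moreover have "(\<lambda>x. \<Sum>j<n. x ^ j / exp x / fact j) = poisson_below n"
    by (auto simp: poisson_below_def exp_minus sum_distrib_left divide_simps fun_eq_iff intro!: sum.cong)
  ultimately show ?thesis by simp
qed

lemma disc_moment_tendsto:
  assumes "\<alpha> > 0"
  shows "(\<lambda>n. disc_moment \<alpha> (real n) k) \<longlonglongrightarrow> fact k / \<alpha> ^ k"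
proof -
  have "filterlim (\<lambda>n. \<alpha> * (real n)\<^sup>2) at_top sequentially"
    using assms by real_asymp
  from filterlim_compose[OF poisson_below_tendsto_0 this]
  have "(\<lambda>n. fact k / \<alpha> ^ k * (1 - poisson_below (Suc k) (\<alpha> * (real n)\<^sup>2))) \<longlonglongrightarrow> fact k / \<alpha> ^ k * (1 - 0)"
    by (intro tendsto_intros)
  then show ?thesis by (simp add: disc_moment_def)
qed

lemma gaussian_moment_integrable:
  assumes "\<alpha> > 0"
  shows "integrable lborel (\<lambda>z. (cmod (z ^ k))\<^sup>2 * exp (- \<alpha> * (cmod z)\<^sup>2))"
proof -
  let ?M = "fock_mass \<alpha> (\<lambda>z. z ^ k)"
  have hol: "(\<lambda>z::complex. z ^ k) holomorphic_on UNIV" by (intro holomorphic_intros)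
  have ball: "emeasure ?M (ball 0 (real n)) \<le> ennreal (fact k / \<alpha> ^ k)" for n
  proof -
    have "emeasure ?M (ball 0 (real n)) =
      (\<integral>\<^sup>+ z. ennreal (\<alpha> / pi * ((cmod z)\<^sup>2) ^ k * exp (- \<alpha> * (cmod z)\<^sup>2)) * indicator (ball 0 (real n)) z \<partial>lborel)"
      by (subst emeasure_fock_mass[OF hol])
         (auto intro!: nn_integral_cong simp: norm_power power_mult[symmetric] mult_ac split: split_indicator)
    also have "\<dots> = ennreal (fact k / \<alpha> ^ k * (1 - poisson_below (Suc k) (\<alpha> * (real n)\<^sup>2)))"
      using assms by (intro nn_integral_monomial_ball) auto
    also have "\<dots> \<le> ennreal (fact k / \<alpha> ^ k)"
    proof (rule ennreal_leI)
      have "fact k / \<alpha> ^ k * (1 - poisson_below (Suc k) (\<alpha> * (real n)\<^sup>2)) \<le> fact k / \<alpha> ^ k * 1"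
        using assms poisson_below_nonneg[of "\<alpha> * (real n)\<^sup>2"] by (intro mult_left_mono) auto
      then show "fact k / \<alpha> ^ k * (1 - poisson_below (Suc k) (\<alpha> * (real n)\<^sup>2)) \<le> fact k / \<alpha> ^ k" by simp
    qed
    finally show ?thesis .
  qed
  have "emeasure ?M UNIV = emeasure ?M (\<Union>n. ball 0 (real n))"
  proof -
    have "(\<Union>n. ball (0::complex) (real n)) = UNIV" using reals_Archimedean2 by auto
    then show ?thesis by simp
  qed
  also have "\<dots> = (SUP n. emeasure ?M (ball 0 (real n)))"
    by (intro SUP_emeasure_incseq[symmetric]) (auto simp: incseq_def)
  also have "\<dots> \<le> ennreal (fact k / \<alpha> ^ k)" using ball by (intro SUP_least) auto
  finally have "emeasure ?M UNIV < \<infinity>" by (simp add: le_less_trans ennreal_less_top)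
  then have "(\<integral>\<^sup>+ z. ennreal (\<alpha> / pi * ((cmod (z ^ k))\<^sup>2 * exp (- \<alpha> * (cmod z)\<^sup>2))) \<partial>lborel) < \<infinity>"
    by (simp add: emeasure_fock_mass[OF hol])
  then have "integrable lborel (\<lambda>z. \<alpha> / pi * ((cmod (z ^ k))\<^sup>2 * exp (- \<alpha> * (cmod z)\<^sup>2)))"
    using assms by (intro integrableI_nonneg) auto
  from integrable_mult_right[OF this, of "pi / \<alpha>"] show ?thesis using assms by simp
qed

lemma integral_lborel_translate:
  fixes F :: "complex \<Rightarrow> complex"
  assumes [measurable]: "F \<in> borel_measurable borel"
  shows "(LINT z|lborel. F (l + z)) = (LINT z|lborel. F z)"
proof -
  have "(LINT z|lborel. F z) = (LINT z|distr lborel borel ((+) l). F z)"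
    by (simp add: lborel_distr_plus)
  also have "\<dots> = (LINT z|lborel. F (l + z))" by (subst integral_distr) auto
  finally show ?thesis by simp
qed

lemma fock_space_translate_integrable:
  assumes f: "f \<in> fock_space \<alpha>"
  shows "integrable lborel (\<lambda>z. (cmod (fock_translation \<alpha> (- l) f z))\<^sup>2 * exp (- \<alpha> * (cmod z)\<^sup>2))"
proof -
  have hol: "f holomorphic_on UNIV" using f by (simp add: fock_space_def)
  have [measurable]: "f \<in> borel_measurable borel" by (rule entire_measurable[OF hol])
  have "integrable (distr lborel borel ((+) l)) (\<lambda>z. (cmod (f z))\<^sup>2 * exp (- \<alpha> * (cmod z)\<^sup>2))"
    using f by (simp add: fock_space_def lborel_distr_plus)
  then show ?thesis unfolding norm_fock_translation
    by (subst (asm) integrable_distr_eq) auto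
qed

text \<open>The limit of the disc formula as the radius tends to infinity; square integrability dominates
  the product of \<open>g\<close> with a monomial.\<close>

lemma gaussian_taylor_coeff:
  assumes "\<alpha> > 0" and g: "g holomorphic_on UNIV"
    and int: "integrable lborel (\<lambda>z. (cmod (g z))\<^sup>2 * exp (- \<alpha> * (cmod z)\<^sup>2))"
  shows "(LINT z|lborel. complex_of_real (\<alpha> / pi * exp (- \<alpha> * (cmod z)\<^sup>2)) * (g z * cnj (z ^ k))) =
    taylor_coeff g k * complex_of_real (fact k / \<alpha> ^ k)"
proof -
  have [measurable]: "g \<in> borel_measurable borel" by (rule entire_measurable[OF g])
  let ?G = "\<lambda>z. complex_of_real (\<alpha> / pi * exp (- \<alpha> * (cmod z)\<^sup>2)) * (g z * cnj (z ^ k))"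
  define w where "w z = \<alpha> / pi * ((cmod (g z))\<^sup>2 * exp (- \<alpha> * (cmod z)\<^sup>2) + (cmod (z ^ k))\<^sup>2 * exp (- \<alpha> * (cmod z)\<^sup>2))" for z
  have "(\<lambda>n. LINT z|lborel. complex_of_real (disc_weight \<alpha> (real n) z) * (g z * cnj (z ^ k))) \<longlonglongrightarrow> (LINT z|lborel. ?G z)"
  proof (rule integral_dominated_convergence[where w=w])
    show "integrable lborel w" unfolding w_def
      by (intro integrable_mult_right Bochner_Integration.integrable_add int gaussian_moment_integrable assms)
    show "AE z in lborel. (\<lambda>n. complex_of_real (disc_weight \<alpha> (real n) z) * (g z * cnj (z ^ k))) \<longlonglongrightarrow> ?G z"
    proof (rule AE_I2)
      fix z :: complex
      have "eventually (\<lambda>n. cmod z < real n) sequentially"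
        using eventually_gt_at_top[of "nat \<lceil>cmod z\<rceil>"] by eventually_elim linarith
      then have "eventually (\<lambda>n. complex_of_real (disc_weight \<alpha> (real n) z) * (g z * cnj (z ^ k)) = ?G z) sequentially"
        by eventually_elim (simp add: disc_weight_def)
      then show "(\<lambda>n. complex_of_real (disc_weight \<alpha> (real n) z) * (g z * cnj (z ^ k))) \<longlonglongrightarrow> ?G z"
        by (rule tendsto_eventually)
    qed
    show "AE z in lborel. cmod (complex_of_real (disc_weight \<alpha> (real n) z) * (g z * cnj (z ^ k))) \<le> w z" for n
    proof (rule AE_I2)
      fix z :: complex
      have "0 \<le> (cmod (g z) - cmod (z ^ k))\<^sup>2" by simp
      then have "2 * (cmod (g z) * cmod (z ^ k)) \<le> (cmod (g z))\<^sup>2 + (cmod (z ^ k))\<^sup>2"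
        by (simp add: power2_diff)
      then have "cmod (g z) * cmod (z ^ k) \<le> (cmod (g z))\<^sup>2 + (cmod (z ^ k))\<^sup>2"
        using mult_nonneg_nonneg[of "cmod (g z)" "cmod (z ^ k)"] by (simp del: mult_nonneg_nonneg)
      moreover have "disc_weight \<alpha> (real n) z \<le> \<alpha> / pi * exp (- \<alpha> * (cmod z)\<^sup>2)"
        using assms by (simp add: disc_weight_def split: split_indicator)
      ultimately have "disc_weight \<alpha> (real n) z * (cmod (g z) * cmod (z ^ k)) \<le>
          \<alpha> / pi * exp (- \<alpha> * (cmod z)\<^sup>2) * ((cmod (g z))\<^sup>2 + (cmod (z ^ k))\<^sup>2)"
        using assms by (intro mult_mono) auto
      then show "cmod (complex_of_real (disc_weight \<alpha> (real n) z) * (g z * cnj (z ^ k))) \<le> w z"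
        using disc_weight_nonneg[OF assms(1), of "real n" z]
        by (simp only: norm_mult complex_mod_cnj norm_of_real abs_of_nonneg) (simp only: w_def algebra_simps)
    qed
  qed measurable
  moreover have "(\<lambda>n. LINT z|lborel. complex_of_real (disc_weight \<alpha> (real n) z) * (g z * cnj (z ^ k))) \<longlonglongrightarrow>
      taylor_coeff g k * complex_of_real (fact k / \<alpha> ^ k)"
    unfolding disc_weight_taylor_coeff[OF assms(1) of_nat_0_le_iff g]
    by (intro tendsto_intros disc_moment_tendsto assms)
  ultimately show ?thesis by (rule LIMSEQ_unique)
qed

text \<open>The \<open>k\<close>-th coefficient of the translate of \<open>f\<close> to the point \<open>l\<close> in the normalised monomials. It is defined
  through a Taylor coefficient, so that it makes sense for every entire function; on the Fock space it is
  the inner product that occurs in the sampling sum.\<close>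

definition fock_coeff :: "real \<Rightarrow> (complex \<Rightarrow> complex) \<Rightarrow> complex \<Rightarrow> nat \<Rightarrow> complex" where
  "fock_coeff \<alpha> f l k = complex_of_real (sqrt (fact k / \<alpha> ^ k)) * taylor_coeff (fock_translation \<alpha> (- l) f) k"

lemma of_real_exp_cmod_square: "complex_of_real (exp (- \<alpha> * (cmod w)\<^sup>2)) = exp (- (complex_of_real \<alpha> * (w * cnj w)))"
  by (simp add: complex_norm_square[symmetric] flip: exp_of_real)

text \<open>Translating the variable by \<open>l\<close> moves the translation from the basis function to \<open>f\<close>, where it becomes
  the inverse translation.\<close>

lemma fock_inner_translated_basis:
  assumes "\<alpha> > 0" and f: "f \<in> fock_space \<alpha>"
  shows "fock_inner \<alpha> f (fock_translation \<alpha> l (fock_basis \<alpha> k)) = fock_coeff \<alpha> f l k"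
proof -
  have hol: "f holomorphic_on UNIV" using f by (simp add: fock_space_def)
  define g where "g = fock_translation \<alpha> (- l) f"
  define \<kappa> where "\<kappa> = sqrt (\<alpha> ^ k) / sqrt (fact k)"
  define F where "F z = f z * cnj (fock_translation \<alpha> l (fock_basis \<alpha> k) z) * complex_of_real (exp (- \<alpha> * (cmod z)\<^sup>2))" for z
  have basis: "fock_basis \<alpha> k holomorphic_on UNIV"
    unfolding fock_basis_def by (intro holomorphic_intros)
  have "continuous_on UNIV F" unfolding F_def
    by (intro continuous_intros entire_continuous hol fock_translation_holomorphic basis)
  then have F: "F \<in> borel_measurable borel" by (rule borel_measurable_continuous_onI)
  have pt: "F (l + z) = complex_of_real \<kappa> * (complex_of_real (exp (- \<alpha> * (cmod z)\<^sup>2)) * (g z * cnj (z ^ k)))" for z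
  proof -
    have "cnj (exp (complex_of_real \<alpha> * cnj l * (l + z) - complex_of_real (\<alpha> / 2 * (cmod l)\<^sup>2))) *
        complex_of_real (exp (- \<alpha> * (cmod (l + z))\<^sup>2)) =
      exp (complex_of_real \<alpha> * cnj (- l) * z - complex_of_real (\<alpha> / 2 * (cmod (- l))\<^sup>2)) *
        complex_of_real (exp (- \<alpha> * (cmod z)\<^sup>2))"
      unfolding of_real_exp_cmod_square exp_cnj exp_add[symmetric]
      by (rule arg_cong[of _ _ exp])
         (simp add: complex_norm_square algebra_simps del: of_real_power)
    then have "f (l + z) * cnj (z ^ k) * complex_of_real \<kappa> * (cnj (exp (complex_of_real \<alpha> * cnj l * (l + z) - complex_of_real (\<alpha> / 2 * (cmod l)\<^sup>2))) *
        complex_of_real (exp (- \<alpha> * (cmod (l + z))\<^sup>2))) = f (l + z) * cnj (z ^ k) * complex_of_real \<kappa> * (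
      exp (complex_of_real \<alpha> * cnj (- l) * z - complex_of_real (\<alpha> / 2 * (cmod (- l))\<^sup>2)) *
        complex_of_real (exp (- \<alpha> * (cmod z)\<^sup>2)))" by (simp only:)
    then show ?thesis
      by (simp only: F_def g_def fock_translation_def fock_basis_def \<kappa>_def[symmetric]
          complex_cnj_mult complex_cnj_complex_of_real add_diff_cancel_left' diff_minus_eq_add mult_ac add.commute)
  qed
  have inner: "fock_inner \<alpha> f (fock_translation \<alpha> l (fock_basis \<alpha> k)) = complex_of_real (\<alpha> / pi) * (LINT z|lborel. F z)"
    by (simp only: fock_inner_def F_def)
  have "(LINT z|lborel. F z) = (LINT z|lborel. F (l + z))"
    by (rule integral_lborel_translate[OF F, symmetric])
  also have "\<dots> = (LINT z|lborel. complex_of_real \<kappa> * (complex_of_real (exp (- \<alpha> * (cmod z)\<^sup>2)) * (g z * cnj (z ^ k))))"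
    by (simp only: pt)
  also have "(LINT z|lborel. complex_of_real \<kappa> * (complex_of_real (exp (- \<alpha> * (cmod z)\<^sup>2)) * (g z * cnj (z ^ k)))) =
      complex_of_real \<kappa> * (LINT z|lborel. complex_of_real (exp (- \<alpha> * (cmod z)\<^sup>2)) * (g z * cnj (z ^ k)))"
    by (rule integral_mult_right_zero)
  finally have "fock_inner \<alpha> f (fock_translation \<alpha> l (fock_basis \<alpha> k)) =
      complex_of_real \<kappa> * (complex_of_real (\<alpha> / pi) * (LINT z|lborel. complex_of_real (exp (- \<alpha> * (cmod z)\<^sup>2)) * (g z * cnj (z ^ k))))"
    by (simp only: inner mult.left_commute)
  also have "complex_of_real (\<alpha> / pi) * (LINT z|lborel. complex_of_real (exp (- \<alpha> * (cmod z)\<^sup>2)) * (g z * cnj (z ^ k))) =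
      (LINT z|lborel. complex_of_real (\<alpha> / pi * exp (- \<alpha> * (cmod z)\<^sup>2)) * (g z * cnj (z ^ k)))"
    by (simp only: integral_mult_right_zero[symmetric] of_real_mult mult.assoc)
  also have "\<dots> = taylor_coeff g k * complex_of_real (fact k / \<alpha> ^ k)"
    unfolding g_def
    by (intro gaussian_taylor_coeff assms fock_translation_holomorphic hol fock_space_translate_integrable)
  also have "complex_of_real \<kappa> * (taylor_coeff g k * complex_of_real (fact k / \<alpha> ^ k)) =
      complex_of_real (\<kappa> * (fact k / \<alpha> ^ k)) * taylor_coeff g k" by simp
  also have "\<kappa> * (fact k / \<alpha> ^ k) = sqrt (fact k / \<alpha> ^ k)"
  proof -
    have "fact k / \<alpha> ^ k = sqrt (fact k / \<alpha> ^ k) * sqrt (fact k / \<alpha> ^ k)" using assms by simp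
    then show ?thesis using assms by (simp add: \<kappa>_def real_sqrt_divide field_simps)
  qed
  finally show ?thesis by (simp add: fock_coeff_def g_def)
qed

section \<open>Local energy against the mass of a disc\<close>

definition fock_local_energy :: "real \<Rightarrow> (complex \<Rightarrow> complex) \<Rightarrow> complex \<Rightarrow> nat \<Rightarrow> ennreal" where
  "fock_local_energy \<alpha> f l n = (\<Sum>k<n. ennreal ((cmod (fock_coeff \<alpha> f l k))\<^sup>2))"

lemma sampling_sum_fock:
  assumes "\<alpha> > 0" and f: "f \<in> fock_space \<alpha>"
  shows "sampling_sum \<alpha> \<Lambda> m f = (\<Sum>\<^sub>\<infinity>l\<in>\<Lambda>. fock_local_energy \<alpha> f l (m l))"
  by (simp add: sampling_sum_def fock_local_energy_def fock_inner_translated_basis[OF assms])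

text \<open>Parseval's identity around \<open>l\<close>: a disc of radius \<open>R\<close> sees the \<open>k\<close>-th coefficient with weight equal to the
  probability that a Poisson variable of mean \<open>\<alpha> R\<^sup>2\<close> exceeds \<open>k\<close>.\<close>

lemma emeasure_fock_mass_ball:
  assumes "\<alpha> > 0" "R \<ge> 0" and f: "f holomorphic_on UNIV"
  shows "emeasure (fock_mass \<alpha> f) (ball l R) =
    (\<Sum>k. ennreal ((cmod (fock_coeff \<alpha> f l k))\<^sup>2 * (1 - poisson_below (Suc k) (\<alpha> * R\<^sup>2))))"
proof -
  have "emeasure (fock_mass \<alpha> f) (ball l R) =
      (\<Sum>k. ennreal ((cmod (taylor_coeff (fock_translation \<alpha> (- l) f) k))\<^sup>2 * disc_moment \<alpha> R k))"
    using emeasure_fock_mass_disc[OF assms(1,2) fock_translation_holomorphic[OF f, of \<alpha> "- l"]]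
      emeasure_fock_mass_translate[OF f] by simp
  moreover have "(cmod (taylor_coeff (fock_translation \<alpha> (- l) f) k))\<^sup>2 * disc_moment \<alpha> R k =
      (cmod (fock_coeff \<alpha> f l k))\<^sup>2 * (1 - poisson_below (Suc k) (\<alpha> * R\<^sup>2))" for k
    using assms by (simp add: fock_coeff_def disc_moment_def norm_mult power_mult_distrib)
  ultimately show ?thesis by simp
qed

text \<open>For \<open>k < n = \<alpha> R\<^sup>2\<close> the weight of the \<open>k\<close>-th coefficient is at least \<open>1/2\<close>, because a Poisson variable of mean
  \<open>n\<close> reaches \<open>n\<close> with probability at least \<open>1/2\<close>.\<close>

lemma local_energy_le_disc_mass:
  assumes "\<alpha> > 0" "R \<ge> 0" "\<alpha> * R\<^sup>2 = real n" and f: "f holomorphic_on UNIV"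
  shows "fock_local_energy \<alpha> f l n \<le> 2 * emeasure (fock_mass \<alpha> f) (ball l R)"
proof -
  define c where "c k = (cmod (fock_coeff \<alpha> f l k))\<^sup>2" for k
  have "fock_local_energy \<alpha> f l n \<le> (\<Sum>k<n. 2 * ennreal (c k * (1 - poisson_below (Suc k) (\<alpha> * R\<^sup>2))))"
    unfolding fock_local_energy_def c_def[symmetric]
  proof (rule sum_mono)
    fix k assume "k \<in> {..<n}"
    then have "poisson_below (Suc k) (real n) \<le> poisson_below n (real n)"
      by (intro poisson_below_mono) auto
    also note poisson_below_mean_le
    finally have "1 \<le> 2 * (1 - poisson_below (Suc k) (\<alpha> * R\<^sup>2))" using assms by simp
    then have "c k * 1 \<le> c k * (2 * (1 - poisson_below (Suc k) (\<alpha> * R\<^sup>2)))"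
      by (intro mult_left_mono) (auto simp: c_def)
    then have "ennreal (c k) \<le> ennreal (2 * (c k * (1 - poisson_below (Suc k) (\<alpha> * R\<^sup>2))))"
      by (intro ennreal_leI) (simp add: mult_ac)
    also have "\<dots> = 2 * ennreal (c k * (1 - poisson_below (Suc k) (\<alpha> * R\<^sup>2)))"
      by (subst ennreal_mult') auto
    finally show "ennreal (c k) \<le> 2 * ennreal (c k * (1 - poisson_below (Suc k) (\<alpha> * R\<^sup>2)))" .
  qed
  also have "\<dots> = 2 * (\<Sum>k<n. ennreal (c k * (1 - poisson_below (Suc k) (\<alpha> * R\<^sup>2))))"
    by (simp add: sum_distrib_left)
  also have "\<dots> \<le> 2 * (\<Sum>k. ennreal (c k * (1 - poisson_below (Suc k) (\<alpha> * R\<^sup>2))))"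
    by (intro mult_left_mono sum_le_suminf) auto
  finally show ?thesis using assms by (simp add: emeasure_fock_mass_ball c_def)
qed

text \<open>Coefficients of index below \<open>n\<close> contribute at most their full size; those of index at least \<open>n\<close> have
  hardly any mass in the smaller disc, compared with what they have in the larger one.\<close>

lemma shrunken_disc_mass_le_local_energy:
  assumes "\<alpha> > 0" "C \<ge> 0" "C \<le> R" "\<alpha> * R\<^sup>2 = real n" and f: "f holomorphic_on UNIV"
  shows "emeasure (fock_mass \<alpha> f) (ball l (R - C)) \<le>
    fock_local_energy \<alpha> f l n + ennreal (exp (- (\<alpha> * C\<^sup>2 / 2))) * emeasure (fock_mass \<alpha> f) (ball l R)"
proof -
  define c where "c k = (cmod (fock_coeff \<alpha> f l k))\<^sup>2" for k
  define \<epsilon> where "\<epsilon> = exp (- (\<alpha> * C\<^sup>2 / 2))"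
  have c: "c k \<ge> 0" for k by (simp add: c_def)
  have "emeasure (fock_mass \<alpha> f) (ball l (R - C)) = (\<Sum>k. ennreal (c k * (1 - poisson_below (Suc k) (\<alpha> * (R - C)\<^sup>2))))"
    unfolding c_def using assms by (intro emeasure_fock_mass_ball) auto
  also have "\<dots> \<le> (\<Sum>k. (if k < n then ennreal (c k) else 0) +
      ennreal \<epsilon> * ennreal (c k * (1 - poisson_below (Suc k) (\<alpha> * R\<^sup>2))))"
  proof (intro suminf_le summableI)
    fix k
    show "ennreal (c k * (1 - poisson_below (Suc k) (\<alpha> * (R - C)\<^sup>2))) \<le> (if k < n then ennreal (c k) else 0) +
      ennreal \<epsilon> * ennreal (c k * (1 - poisson_below (Suc k) (\<alpha> * R\<^sup>2)))"
    proof (cases "k < n")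
      case True
      have "c k * (1 - poisson_below (Suc k) (\<alpha> * (R - C)\<^sup>2)) \<le> c k * 1"
        using poisson_below_nonneg[of "\<alpha> * (R - C)\<^sup>2"] assms c by (intro mult_left_mono) auto
      then have "ennreal (c k * (1 - poisson_below (Suc k) (\<alpha> * (R - C)\<^sup>2))) \<le> ennreal (c k)"
        by (intro ennreal_leI) simp
      then show ?thesis using True by (simp add: add_increasing2)
    next
      case False
      have "c k * (1 - poisson_below (Suc k) (\<alpha> * (R - C)\<^sup>2)) \<le> c k * (\<epsilon> * (1 - poisson_below (Suc k) (\<alpha> * R\<^sup>2)))"
        unfolding \<epsilon>_def using assms False c by (intro mult_left_mono poisson_above_shrink) auto
      then have "ennreal (c k * (1 - poisson_below (Suc k) (\<alpha> * (R - C)\<^sup>2))) \<le>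
          ennreal (\<epsilon> * (c k * (1 - poisson_below (Suc k) (\<alpha> * R\<^sup>2))))"
        by (intro ennreal_leI) (simp add: mult_ac)
      then show ?thesis using False by (simp add: ennreal_mult' \<epsilon>_def)
    qed
  qed
  also have "\<dots> = (\<Sum>k. if k < n then ennreal (c k) else 0) +
      ennreal \<epsilon> * (\<Sum>k. ennreal (c k * (1 - poisson_below (Suc k) (\<alpha> * R\<^sup>2))))"
    by (subst suminf_add[symmetric]) (auto intro: summableI)
  also have "(\<Sum>k. ennreal (c k * (1 - poisson_below (Suc k) (\<alpha> * R\<^sup>2)))) = emeasure (fock_mass \<alpha> f) (ball l R)"
    unfolding c_def using assms by (intro emeasure_fock_mass_ball[symmetric]) auto
  also have "(\<Sum>k. if k < n then ennreal (c k) else 0) = fock_local_energy \<alpha> f l n"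
    by (subst suminf_finite[of "{..<n}"]) (auto simp: fock_local_energy_def c_def)
  finally show ?thesis by (simp add: \<epsilon>_def)
qed

lemma fock_norm2_eq:
  assumes "\<alpha> > 0" "f \<in> fock_space \<alpha>"
  shows "ennreal (fock_norm2 \<alpha> f) = emeasure (fock_mass \<alpha> f) UNIV"
proof -
  have hol: "f holomorphic_on UNIV" using assms by (simp add: fock_space_def)
  have "emeasure (fock_mass \<alpha> f) UNIV = (\<integral>\<^sup>+ z. ennreal (\<alpha> / pi * ((cmod (f z))\<^sup>2 * exp (- \<alpha> * (cmod z)\<^sup>2))) \<partial>lborel)"
    by (simp add: emeasure_fock_mass[OF hol])
  also have "\<dots> = ennreal (LINT z|lborel. \<alpha> / pi * ((cmod (f z))\<^sup>2 * exp (- \<alpha> * (cmod z)\<^sup>2)))"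
    using assms by (intro nn_integral_eq_integral integrable_mult_right) (auto simp: fock_space_def)
  finally show ?thesis by (simp add: fock_norm2_def)
qed

lemma fock_norm2_nonneg: "\<alpha> > 0 \<Longrightarrow> fock_norm2 \<alpha> f \<ge> 0"
  unfolding fock_norm2_def by (intro mult_nonneg_nonneg integral_nonneg) auto

lemma fock_spaceI:
  assumes "\<alpha> > 0" and hol: "f holomorphic_on UNIV" and fin: "emeasure (fock_mass \<alpha> f) UNIV < \<infinity>"
  shows "f \<in> fock_space \<alpha>"
proof -
  have [measurable]: "f \<in> borel_measurable borel" by (rule entire_measurable[OF hol])
  have "(\<integral>\<^sup>+ z. ennreal (\<alpha> / pi * ((cmod (f z))\<^sup>2 * exp (- \<alpha> * (cmod z)\<^sup>2))) \<partial>lborel) < \<infinity>"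
    using fin by (simp add: emeasure_fock_mass[OF hol])
  then have "integrable lborel (\<lambda>z. \<alpha> / pi * ((cmod (f z))\<^sup>2 * exp (- \<alpha> * (cmod z)\<^sup>2)))"
    using assms by (intro integrableI_nonneg) auto
  from integrable_mult_right[OF this, of "pi / \<alpha>"] show ?thesis using assms by (simp add: fock_space_def)
qed

lemma fock_coeff_0:
  "(cmod (fock_coeff \<alpha> f l 0))\<^sup>2 = (cmod (f l))\<^sup>2 * exp (- \<alpha> * (cmod l)\<^sup>2)"
  using norm_fock_translation[of \<alpha> l f 0] by (simp add: fock_coeff_def taylor_coeff_def)

lemma pointwise_le_fock_mass:
  assumes "\<alpha> > 0" and f: "f holomorphic_on UNIV"
  shows "ennreal ((cmod (f l))\<^sup>2 * exp (- \<alpha> * (cmod l)\<^sup>2)) \<le> 2 * emeasure (fock_mass \<alpha> f) UNIV"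
proof -
  have "ennreal ((cmod (f l))\<^sup>2 * exp (- \<alpha> * (cmod l)\<^sup>2)) = fock_local_energy \<alpha> f l 1"
    using fock_coeff_0[of \<alpha> f l] by (simp add: fock_local_energy_def)
  also have "\<dots> \<le> 2 * emeasure (fock_mass \<alpha> f) (ball l (1 / sqrt \<alpha>))"
    using assms by (intro local_energy_le_disc_mass) (auto simp: power_divide)
  also have "\<dots> \<le> 2 * emeasure (fock_mass \<alpha> f) UNIV"
    by (intro mult_left_mono emeasure_mono) auto
  finally show ?thesis .
qed

section \<open>Summation over the divisor\<close>

lemma infsum_ennreal_eq_SUP:
  fixes f :: "'a \<Rightarrow> ennreal"
  shows "(\<Sum>\<^sub>\<infinity>x\<in>A. f x) = (SUP F\<in>{F. finite F \<and> F \<subseteq> A}. sum f F)"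
  by (rule nonneg_infsum_complete) simp

lemma infsum_ennreal_cmult:
  fixes f :: "'a \<Rightarrow> ennreal"
  shows "(\<Sum>\<^sub>\<infinity>x\<in>A. c * f x) = c * (\<Sum>\<^sub>\<infinity>x\<in>A. f x)"
  by (simp add: infsum_ennreal_eq_SUP SUP_mult_left_ennreal flip: sum_distrib_left)

lemma infsum_ennreal_mono:
  fixes f g :: "'a \<Rightarrow> ennreal"
  assumes "\<And>x. x \<in> A \<Longrightarrow> f x \<le> g x"
  shows "(\<Sum>\<^sub>\<infinity>x\<in>A. f x) \<le> (\<Sum>\<^sub>\<infinity>x\<in>A. g x)"
  by (intro infsum_mono nonneg_summable_on_complete assms) auto

lemma sum_le_infsum_ennreal:
  fixes f :: "'a \<Rightarrow> ennreal"
  assumes "finite F" "F \<subseteq> A"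
  shows "(\<Sum>x\<in>F. f x) \<le> (\<Sum>\<^sub>\<infinity>x\<in>A. f x)"
  unfolding infsum_ennreal_eq_SUP using assms by (intro SUP_upper) auto

text \<open>Summing indicator functions under the integral: each point of \<open>A\<close> is counted at most \<open>N\<close> times.\<close>

lemma infsum_emeasure_le_overlap:
  assumes sets: "\<And>l. l \<in> I \<Longrightarrow> B l \<in> sets M" "\<And>l. l \<in> I \<Longrightarrow> B l \<subseteq> A" "A \<in> sets M"
    and overlap: "\<And>z. (\<Sum>\<^sub>\<infinity>l\<in>I. indicator (B l) z :: ennreal) \<le> N"
  shows "(\<Sum>\<^sub>\<infinity>l\<in>I. emeasure M (B l)) \<le> N * emeasure M A"
  unfolding infsum_ennreal_eq_SUP
proof (rule SUP_least)
  fix F assume "F \<in> {F. finite F \<and> F \<subseteq> I}"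
  then have F: "finite F" "F \<subseteq> I" by auto
  have "(\<Sum>l\<in>F. emeasure M (B l)) = (\<Sum>l\<in>F. \<integral>\<^sup>+ z. indicator (B l) z \<partial>M)"
    using F sets by (intro sum.cong) auto
  also have "\<dots> = (\<integral>\<^sup>+ z. (\<Sum>l\<in>F. indicator (B l) z) \<partial>M)"
    using F sets by (intro nn_integral_sum[symmetric] borel_measurable_indicator) auto
  also have "\<dots> \<le> (\<integral>\<^sup>+ z. N * indicator A z \<partial>M)"
  proof (rule nn_integral_mono)
    fix z
    show "(\<Sum>l\<in>F. indicator (B l) z) \<le> N * indicator A z"
    proof (cases "z \<in> A")
      case True
      then show ?thesis using order.trans[OF sum_le_infsum_ennreal[OF F, of "\<lambda>l. indicator (B l) z"] overlap[of z]] by simp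
    next
      case False
      then have "(indicator (B l) z :: ennreal) = 0" if "l \<in> F" for l
        using that F sets by (auto split: split_indicator)
      then show ?thesis by simp
    qed
  qed
  also have "\<dots> = N * emeasure M A" using sets by (simp add: nn_integral_cmult_indicator)
  finally show "(\<Sum>l\<in>F. emeasure M (B l)) \<le> N * emeasure M A" .
qed

lemma emeasure_UN_le_infsum:
  assumes "countable I" and sets: "\<And>l. l \<in> I \<Longrightarrow> B l \<in> sets M"
  shows "emeasure M (\<Union>l\<in>I. B l) \<le> (\<Sum>\<^sub>\<infinity>l\<in>I. emeasure M (B l))"
proof (cases "I = {}")
  case False
  define F where "F n = from_nat_into I ` {..<n}" for n :: nat
  have F: "finite (F n)" "F n \<subseteq> I" for n
    using from_nat_into[OF False] by (auto simp: F_def)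
  have I: "I = (\<Union>n. F n)"
    using False range_from_nat_into[OF False assms(1)] by (auto simp: F_def)
  have "emeasure M (\<Union>l\<in>I. B l) = emeasure M (\<Union>n. \<Union>l\<in>F n. B l)"
    by (rule arg_cong[of _ _ "emeasure M"]) (subst I, auto)
  also have "\<dots> = (SUP n. emeasure M (\<Union>l\<in>F n. B l))"
  proof (rule SUP_emeasure_incseq[symmetric])
    show "range (\<lambda>n. \<Union>l\<in>F n. B l) \<subseteq> sets M" using F sets by blast
    show "incseq (\<lambda>n. \<Union>l\<in>F n. B l)"
      by (rule incseq_SucI) (auto simp: F_def less_Suc_eq)
  qed
  also have "\<dots> \<le> (\<Sum>\<^sub>\<infinity>l\<in>I. emeasure M (B l))"
  proof (rule SUP_least)
    fix n
    have "emeasure M (\<Union>l\<in>F n. B l) \<le> (\<Sum>l\<in>F n. emeasure M (B l))"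
      using F sets by (intro emeasure_subadditive_finite) auto
    also have "\<dots> \<le> (\<Sum>\<^sub>\<infinity>l\<in>I. emeasure M (B l))" using F by (intro sum_le_infsum_ennreal)
    finally show "emeasure M (\<Union>l\<in>F n. B l) \<le> (\<Sum>\<^sub>\<infinity>l\<in>I. emeasure M (B l))" .
  qed
  finally show ?thesis .
qed simp

lemma radius_of_multiplicity:
  assumes "\<alpha> > 0"
  shows "\<alpha> * (sqrt (real n / \<alpha>))\<^sup>2 = real n" "sqrt (real n / \<alpha>) \<ge> 0"
  using assms by simp_all

lemma infsum_local_energy_le_mass:
  assumes "\<alpha> > 0" and f: "f holomorphic_on UNIV" and A: "A \<in> sets borel" "\<And>l. l \<in> \<Lambda> \<Longrightarrow> ball l (sqrt (real (m l) / \<alpha>)) \<subseteq> A"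
    and overlap: "\<And>z. (\<Sum>\<^sub>\<infinity>l\<in>\<Lambda>. indicator (ball l (sqrt (real (m l) / \<alpha>))) z :: ennreal) \<le> N"
  shows "(\<Sum>\<^sub>\<infinity>l\<in>\<Lambda>. fock_local_energy \<alpha> f l (m l)) \<le> 2 * N * emeasure (fock_mass \<alpha> f) A"
proof -
  have "(\<Sum>\<^sub>\<infinity>l\<in>\<Lambda>. fock_local_energy \<alpha> f l (m l)) \<le>
      (\<Sum>\<^sub>\<infinity>l\<in>\<Lambda>. 2 * emeasure (fock_mass \<alpha> f) (ball l (sqrt (real (m l) / \<alpha>))))"
    by (intro infsum_ennreal_mono local_energy_le_disc_mass radius_of_multiplicity assms)
  also have "\<dots> = 2 * (\<Sum>\<^sub>\<infinity>l\<in>\<Lambda>. emeasure (fock_mass \<alpha> f) (ball l (sqrt (real (m l) / \<alpha>))))"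
    by (rule infsum_ennreal_cmult)
  also have "\<dots> \<le> 2 * (N * emeasure (fock_mass \<alpha> f) A)"
    using A overlap by (intro mult_left_mono infsum_emeasure_le_overlap) auto
  finally show ?thesis by (simp add: mult.assoc)
qed

section \<open>Coherent states and necessity\<close>

text \<open>The normalised reproducing kernel at \<open>z\<close>.\<close>

definition coherent_state :: "real \<Rightarrow> complex \<Rightarrow> complex \<Rightarrow> complex" where
  "coherent_state \<alpha> z = fock_translation \<alpha> z (\<lambda>_. 1)"

lemma coherent_state_holomorphic: "coherent_state \<alpha> z holomorphic_on UNIV"
  unfolding coherent_state_def by (intro fock_translation_holomorphic holomorphic_intros)

lemma higher_deriv_exp_linear:
  "(deriv ^^ k) (\<lambda>\<zeta>. K * exp (c * \<zeta>)) = (\<lambda>\<zeta>::complex. K * c ^ k * exp (c * \<zeta>))"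
proof (induction k)
  case (Suc k)
  have "deriv (\<lambda>\<zeta>. K * c ^ k * exp (c * \<zeta>)) \<zeta> = K * c ^ Suc k * exp (c * \<zeta>)" for \<zeta>
    by (rule DERIV_imp_deriv) (auto intro!: derivative_eq_intros)
  then have "deriv (\<lambda>\<zeta>. K * c ^ k * exp (c * \<zeta>)) = (\<lambda>\<zeta>. K * c ^ Suc k * exp (c * \<zeta>))" by (rule ext)
  then show ?case by (simp only: funpow.simps o_apply Suc)
qed simp

text \<open>The translate is a multiple of \<open>\<zeta> \<mapsto> exp (\<alpha> \<zeta> cnj (z - l))\<close>, whose coefficients squared are Poisson
  probabilities of mean \<open>\<alpha> |z - l|\<^sup>2\<close>.\<close>

lemma coherent_state_coeff:
  assumes "\<alpha> > 0"
  shows "(cmod (fock_coeff \<alpha> (coherent_state \<alpha> z) l k))\<^sup>2 =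
    exp (- (\<alpha> * (cmod (z - l))\<^sup>2)) * (\<alpha> * (cmod (z - l))\<^sup>2) ^ k / fact k"
proof -
  define c where "c = complex_of_real \<alpha> * cnj (z - l)"
  define K where "K = exp (complex_of_real \<alpha> * cnj z * l - complex_of_real (\<alpha> / 2 * (cmod l)\<^sup>2) - complex_of_real (\<alpha> / 2 * (cmod z)\<^sup>2))"
  have "fock_translation \<alpha> (- l) (coherent_state \<alpha> z) = (\<lambda>\<zeta>. K * exp (c * \<zeta>))"
    by (simp add: fun_eq_iff coherent_state_def fock_translation_def K_def c_def algebra_simps flip: exp_add)
  then have t: "taylor_coeff (fock_translation \<alpha> (- l) (coherent_state \<alpha> z)) k = K * c ^ k / fact k"
    by (simp add: taylor_coeff_def higher_deriv_exp_linear)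
  have "(cmod (z - l))\<^sup>2 = (cmod z)\<^sup>2 + (cmod l)\<^sup>2 - 2 * Re (cnj z * l)"
    by (simp only: cmod_power2) (simp add: power2_eq_square algebra_simps)
  then have "(cmod K)\<^sup>2 = exp (- (\<alpha> * (cmod (z - l))\<^sup>2))"
    by (simp only:) (simp add: K_def algebra_simps flip: exp_double)
  moreover have "(cmod c)\<^sup>2 = \<alpha> * (\<alpha> * (cmod (z - l))\<^sup>2)"
    by (simp only: c_def norm_mult complex_mod_cnj norm_of_real) (simp add: power_mult_distrib power2_eq_square)
  then have "((cmod c)\<^sup>2) ^ k = \<alpha> ^ k * (\<alpha> * (cmod (z - l))\<^sup>2) ^ k" by (simp only: power_mult_distrib)
  moreover have "(cmod (fock_coeff \<alpha> (coherent_state \<alpha> z) l k))\<^sup>2 =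
      fact k / \<alpha> ^ k * ((cmod K)\<^sup>2 * ((cmod c)\<^sup>2) ^ k / (fact k)\<^sup>2)"
    using assms by (simp add: fock_coeff_def t norm_mult norm_divide norm_power power_mult_distrib power_divide
        mult.commute flip: power_mult)
  ultimately show ?thesis using assms by (simp add: power2_eq_square)
qed

lemma coherent_state_local_energy:
  assumes "\<alpha> > 0"
  shows "fock_local_energy \<alpha> (coherent_state \<alpha> z) l n = ennreal (poisson_below n (\<alpha> * (cmod (z - l))\<^sup>2))"
  using assms by (simp add: fock_local_energy_def coherent_state_coeff[OF assms] poisson_below_def
      sum_distrib_left sum_ennreal)

lemma coherent_state_mass_ball:
  assumes "\<alpha> > 0" "R \<ge> 0"
  shows "emeasure (fock_mass \<alpha> (coherent_state \<alpha> z)) (ball z R) = ennreal (1 - exp (- (\<alpha> * R\<^sup>2)))"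
proof -
  have "emeasure (fock_mass \<alpha> (coherent_state \<alpha> z)) (ball z R) =
     (\<Sum>k. ennreal (0 ^ k / fact k * (1 - poisson_below (Suc k) (\<alpha> * R\<^sup>2))))"
    by (simp add: emeasure_fock_mass_ball[OF assms coherent_state_holomorphic] coherent_state_coeff[OF assms(1)])
  also have "\<dots> = (\<Sum>k\<in>{0}. ennreal (0 ^ k / fact k * (1 - poisson_below (Suc k) (\<alpha> * R\<^sup>2))))"
    by (rule suminf_finite) (auto simp: power_0_left)
  finally show ?thesis by (simp add: poisson_below_def)
qed

lemma coherent_state_mass:
  assumes "\<alpha> > 0"
  shows "emeasure (fock_mass \<alpha> (coherent_state \<alpha> z)) UNIV = 1"
proof -
  let ?M = "fock_mass \<alpha> (coherent_state \<alpha> z)"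
  have "(\<lambda>n. emeasure ?M (ball z (real n))) \<longlonglongrightarrow> emeasure ?M (\<Union>n. ball z (real n))"
    by (rule Lim_emeasure_incseq) (auto simp: incseq_def)
  moreover have "(\<Union>n. ball z (real n)) = UNIV" using reals_Archimedean2 by auto
  moreover have "(\<lambda>n. ennreal (1 - exp (- (\<alpha> * (real n)\<^sup>2)))) \<longlonglongrightarrow> ennreal 1"
    by (rule tendsto_ennrealI) (use assms in real_asymp)
  ultimately show ?thesis
    using assms by (simp add: coherent_state_mass_ball LIMSEQ_unique)
qed

lemma coherent_state_tail:
  assumes "\<alpha> > 0" "R \<ge> 0"
  shows "emeasure (fock_mass \<alpha> (coherent_state \<alpha> z)) (UNIV - ball z R) = ennreal (exp (- (\<alpha> * R\<^sup>2)))"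
proof -
  have "emeasure (fock_mass \<alpha> (coherent_state \<alpha> z)) (UNIV - ball z R) =
     emeasure (fock_mass \<alpha> (coherent_state \<alpha> z)) UNIV - emeasure (fock_mass \<alpha> (coherent_state \<alpha> z)) (ball z R)"
    by (rule emeasure_Diff) (auto simp: coherent_state_mass_ball[OF assms])
  also have "\<dots> = ennreal 1 - ennreal (1 - exp (- (\<alpha> * R\<^sup>2)))"
    by (simp add: coherent_state_mass_ball[OF assms] coherent_state_mass[OF assms(1)])
  also have "\<dots> = ennreal (1 - (1 - exp (- (\<alpha> * R\<^sup>2))))"
    using assms by (intro ennreal_minus) auto
  finally show ?thesis by simp
qed

lemma coherent_state_fock: "\<alpha> > 0 \<Longrightarrow> coherent_state \<alpha> z \<in> fock_space \<alpha>"
  by (rule fock_spaceI) (auto simp: coherent_state_holomorphic coherent_state_mass)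

text \<open>Every disc containing \<open>z\<close> contributes at least \<open>1/e\<close> to the sampling sum of the coherent state at \<open>z\<close>,
  whose norm is 1.\<close>

lemma sampling_imp_finite_overlap:
  assumes "\<alpha> > 0" and div: "divisor \<Lambda> m" and samp: "sampling_divisor \<alpha> \<Lambda> m"
  shows "finite_overlap \<alpha> \<Lambda> m"
proof -
  obtain B where B: "\<And>f. f \<in> fock_space \<alpha> \<Longrightarrow> sampling_sum \<alpha> \<Lambda> m f \<le> ennreal B * ennreal (fock_norm2 \<alpha> f)"
    using samp unfolding sampling_divisor_def by blast
  have "(\<Sum>\<^sub>\<infinity>l\<in>\<Lambda>. indicator (ball l (sqrt (real (m l) / \<alpha>))) z :: ennreal) \<le> ennreal (exp 1) * ennreal B" for z
  proof -
    let ?f = "coherent_state \<alpha> z"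
    have "(\<Sum>\<^sub>\<infinity>l\<in>\<Lambda>. indicator (ball l (sqrt (real (m l) / \<alpha>))) z :: ennreal) \<le>
        (\<Sum>\<^sub>\<infinity>l\<in>\<Lambda>. ennreal (exp 1) * fock_local_energy \<alpha> ?f l (m l))"
    proof (rule infsum_ennreal_mono)
      fix l assume "l \<in> \<Lambda>"
      then have m: "m l \<ge> 1" using div by (auto simp: divisor_def Suc_le_eq)
      show "indicator (ball l (sqrt (real (m l) / \<alpha>))) z \<le> ennreal (exp 1) * fock_local_energy \<alpha> ?f l (m l)"
      proof (cases "z \<in> ball l (sqrt (real (m l) / \<alpha>))")
        case True
        then have "(cmod (z - l))\<^sup>2 \<le> (sqrt (real (m l) / \<alpha>))\<^sup>2"
          by (intro power_mono) (auto simp: dist_norm norm_minus_commute)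
        then have "\<alpha> * (cmod (z - l))\<^sup>2 \<le> \<alpha> * (sqrt (real (m l) / \<alpha>))\<^sup>2"
          using assms(1) by (intro mult_left_mono) auto
        then have "\<alpha> * (cmod (z - l))\<^sup>2 \<le> real (m l)" using radius_of_multiplicity[OF assms(1)] by simp
        then have "poisson_below (m l) (real (m l)) \<le> poisson_below (m l) (\<alpha> * (cmod (z - l))\<^sup>2)"
          using assms(1) by (intro poisson_below_antimono) auto
        with poisson_below_mean_ge[OF m] have "exp (- 1) \<le> poisson_below (m l) (\<alpha> * (cmod (z - l))\<^sup>2)" by linarith
        then have "exp 1 * exp (- 1) \<le> exp 1 * poisson_below (m l) (\<alpha> * (cmod (z - l))\<^sup>2)"
          by (intro mult_left_mono) auto
        then have "ennreal 1 \<le> ennreal (exp 1 * poisson_below (m l) (\<alpha> * (cmod (z - l))\<^sup>2))"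
          by (intro ennreal_leI) (simp flip: exp_add)
        then show ?thesis using True
          by (simp add: coherent_state_local_energy[OF assms(1)] ennreal_mult')
      qed simp
    qed
    also have "\<dots> = ennreal (exp 1) * sampling_sum \<alpha> \<Lambda> m ?f"
      by (simp add: infsum_ennreal_cmult sampling_sum_fock[OF assms(1) coherent_state_fock[OF assms(1)]])
    also have "\<dots> \<le> ennreal (exp 1) * (ennreal B * ennreal (fock_norm2 \<alpha> ?f))"
      by (intro mult_left_mono B coherent_state_fock assms) auto
    finally show ?thesis
      by (simp add: fock_norm2_eq[OF assms(1) coherent_state_fock[OF assms(1)]] coherent_state_mass[OF assms(1)])
  qed
  then have "(SUP z. \<Sum>\<^sub>\<infinity>l\<in>\<Lambda>. indicator (ball l (sqrt (real (m l) / \<alpha>))) z :: ennreal) \<le> ennreal (exp 1) * ennreal B"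
    by (intro SUP_least)
  also have "\<dots> < \<infinity>" by (simp add: ennreal_mult_less_top)
  finally show ?thesis unfolding finite_overlap_def .
qed

lemma finite_overlapE:
  assumes "finite_overlap \<alpha> \<Lambda> m"
  obtains N :: real where "N \<ge> 0"
    "\<And>z. (\<Sum>\<^sub>\<infinity>l\<in>\<Lambda>. indicator (ball l (sqrt (real (m l) / \<alpha>))) z :: ennreal) \<le> ennreal N"
proof -
  let ?S = "SUP z. \<Sum>\<^sub>\<infinity>l\<in>\<Lambda>. indicator (ball l (sqrt (real (m l) / \<alpha>))) z :: ennreal"
  have fin: "?S < \<infinity>" using assms unfolding finite_overlap_def .
  show ?thesis
  proof (rule that[of "enn2real ?S"])
    fix z
    have "(\<Sum>\<^sub>\<infinity>l\<in>\<Lambda>. indicator (ball l (sqrt (real (m l) / \<alpha>))) z :: ennreal) \<le> ?S"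
      by (rule SUP_upper) simp
    also have "?S = ennreal (enn2real ?S)" using fin by simp
    finally show "(\<Sum>\<^sub>\<infinity>l\<in>\<Lambda>. indicator (ball l (sqrt (real (m l) / \<alpha>))) z :: ennreal) \<le> ennreal (enn2real ?S)" .
  qed simp
qed

text \<open>If \<open>z\<close> lies outside all enlarged discs, then all discs avoid the disc of radius \<open>C\<close> around \<open>z\<close>, outside of
  which the coherent state at \<open>z\<close> has only mass \<open>exp (- \<alpha> C\<^sup>2)\<close>. By finite overlap its sampling sum is at most a
  constant times this mass, which contradicts sampling once \<open>C\<close> is large.\<close>

lemma sampling_imp_covering:
  assumes "\<alpha> > 0" and samp: "sampling_divisor \<alpha> \<Lambda> m" and overlap: "finite_overlap \<alpha> \<Lambda> m"
  shows "\<exists>C>0. (\<Union>l\<in>\<Lambda>. ball l (sqrt (real (m l) / \<alpha>) + C)) = UNIV"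
proof -
  obtain A where A: "A > 0" "\<And>f. f \<in> fock_space \<alpha> \<Longrightarrow> ennreal (fock_norm2 \<alpha> f) \<le> ennreal A * sampling_sum \<alpha> \<Lambda> m f"
    using samp unfolding sampling_divisor_def by blast
  obtain N where N: "N \<ge> 0" "\<And>z. (\<Sum>\<^sub>\<infinity>l\<in>\<Lambda>. indicator (ball l (sqrt (real (m l) / \<alpha>))) z :: ennreal) \<le> ennreal N"
    using finite_overlapE[OF overlap] by blast
  define x where "x = 2 * A * N"
  \<comment> \<open>then \<open>x * exp (- \<alpha> C\<^sup>2) < 1\<close>, because \<open>exp (x + 1) > x\<close>\<close>
  define C where "C = sqrt ((x + 1) / \<alpha>)"
  have x: "x \<ge> 0" using A N by (simp add: x_def)
  have C: "C > 0" "\<alpha> * C\<^sup>2 = x + 1" using assms(1) x by (auto simp: C_def)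
  have "z \<in> (\<Union>l\<in>\<Lambda>. ball l (sqrt (real (m l) / \<alpha>) + C))" for z
  proof (rule ccontr)
    assume z: "z \<notin> (\<Union>l\<in>\<Lambda>. ball l (sqrt (real (m l) / \<alpha>) + C))"
    let ?f = "coherent_state \<alpha> z"
    note f = coherent_state_fock[OF assms(1), of z]
    have "ball l (sqrt (real (m l) / \<alpha>)) \<subseteq> UNIV - ball z C" if "l \<in> \<Lambda>" for l
    proof
      fix w assume w: "w \<in> ball l (sqrt (real (m l) / \<alpha>))"
      have "dist l z \<ge> sqrt (real (m l) / \<alpha>) + C" using z that by (auto simp: not_less)
      moreover have "dist l z \<le> dist l w + dist z w" by (rule dist_triangle2)
      ultimately show "w \<in> UNIV - ball z C" using w by auto
    qed
    then have "(\<Sum>\<^sub>\<infinity>l\<in>\<Lambda>. fock_local_energy \<alpha> ?f l (m l)) \<le> 2 * ennreal N * emeasure (fock_mass \<alpha> ?f) (UNIV - ball z C)"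
      by (intro infsum_local_energy_le_mass assms coherent_state_holomorphic N) auto
    also have "\<dots> = ennreal (2 * N * exp (- (x + 1)))"
      using C N by (simp add: coherent_state_tail[OF assms(1)] ennreal_mult' )
    finally have "ennreal A * sampling_sum \<alpha> \<Lambda> m ?f \<le> ennreal A * ennreal (2 * N * exp (- (x + 1)))"
      by (intro mult_left_mono) (auto simp: sampling_sum_fock[OF assms(1) f])
    with A(2)[OF f] have "1 \<le> ennreal A * ennreal (2 * N * exp (- (x + 1)))"
      by (auto simp: fock_norm2_eq[OF assms(1) f] coherent_state_mass[OF assms(1)] intro: order.trans)
    also have "\<dots> = ennreal (x * exp (- (x + 1)))"
      using A N by (simp add: x_def mult_ac flip: ennreal_mult')
    finally have "1 \<le> x * exp (- (x + 1))" by simp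
    moreover have "x < exp (x + 1)" using exp_ge_add_one_self[of "x + 1"] by simp
    then have "x * exp (- (x + 1)) < exp (x + 1) * exp (- (x + 1))" by (intro mult_strict_right_mono) auto
    then have "x * exp (- (x + 1)) < 1" by (simp flip: exp_add)
    ultimately show False by simp
  qed
  then show ?thesis using C by blast
qed

section \<open>The upper sampling inequality\<close>

lemma sampling_upper:
  assumes "\<alpha> > 0" and overlap: "finite_overlap \<alpha> \<Lambda> m"
  obtains B where "B > 0" "\<And>f. f \<in> fock_space \<alpha> \<Longrightarrow> sampling_sum \<alpha> \<Lambda> m f \<le> ennreal B * ennreal (fock_norm2 \<alpha> f)"
proof -
  obtain N where N: "N \<ge> 0" "\<And>z. (\<Sum>\<^sub>\<infinity>l\<in>\<Lambda>. indicator (ball l (sqrt (real (m l) / \<alpha>))) z :: ennreal) \<le> ennreal N"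
    using finite_overlapE[OF overlap] by blast
  show ?thesis
  proof (rule that[of "2 * N + 1"])
    fix f assume f: "f \<in> fock_space \<alpha>"
    then have hol: "f holomorphic_on UNIV" by (simp add: fock_space_def)
    have "sampling_sum \<alpha> \<Lambda> m f \<le> 2 * ennreal N * emeasure (fock_mass \<alpha> f) UNIV"
      unfolding sampling_sum_fock[OF assms(1) f] by (intro infsum_local_energy_le_mass assms hol N) auto
    also have "2 * ennreal N = ennreal (2 * N)" by (simp add: ennreal_mult')
    also have "ennreal (2 * N) * emeasure (fock_mass \<alpha> f) UNIV \<le> ennreal (2 * N + 1) * emeasure (fock_mass \<alpha> f) UNIV"
      by (intro mult_right_mono ennreal_leI) auto
    finally show "sampling_sum \<alpha> \<Lambda> m f \<le> ennreal (2 * N + 1) * ennreal (fock_norm2 \<alpha> f)"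
      by (simp add: fock_norm2_eq[OF assms(1) f])
  qed (use N in simp)
qed

section \<open>The maximum principle at points of high multiplicity\<close>

definition fock_density :: "real \<Rightarrow> (complex \<Rightarrow> complex) \<Rightarrow> complex \<Rightarrow> real" where
  "fock_density \<alpha> f z = (cmod (f z))\<^sup>2 * exp (- \<alpha> * (cmod z)\<^sup>2)"

lemma fock_density_nonneg: "fock_density \<alpha> f z \<ge> 0"
  by (simp add: fock_density_def)

lemma fock_density_mult: "fock_density \<alpha> (\<lambda>z. p z * f z) z = (cmod (p z))\<^sup>2 * fock_density \<alpha> f z"
  by (simp add: fock_density_def norm_mult power_mult_distrib mult_ac)

text \<open>Dividing the translate of \<open>f\<close> by its zero of order \<open>n\<close> leaves an entire function, to which the maximum
  principle on the disc of radius \<open>R\<close> applies. At relative radius \<open>t\<close> this costs the factor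
  \<open>(t\<^sup>2 exp (1 - t\<^sup>2))\<^sup>n\<close>, which is at most \<open>exp (- n (1 - t)\<^sup>2)\<close>; since \<open>n = \<alpha> R\<^sup>2\<close>, the exponent depends only on
  the distance to the boundary circle.\<close>

lemma fock_density_max_principle:
  assumes "\<alpha> > 0" and R: "R \<ge> 0" "\<alpha> * R\<^sup>2 = real n" and C: "C \<ge> 0"
    and h: "h holomorphic_on UNIV" and f: "\<And>z. f z = (z - l) ^ n * h z"
    and M: "\<And>w. fock_density \<alpha> f w \<le> M" and z: "z \<in> ball l (R - C)"
  shows "fock_density \<alpha> f z \<le> exp (- (\<alpha> * C\<^sup>2)) * M"
proof -
  define r where "r = cmod (z - l)"
  have r: "0 \<le> r" "r < R - C" using z by (auto simp: r_def dist_norm norm_minus_commute)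
  have R0: "R > 0" using r C by linarith
  have M0: "M \<ge> 0" using M[of 0] fock_density_nonneg[of \<alpha> f 0] by linarith
  define H where "H = fock_translation \<alpha> (- l) h"
  have H: "H holomorphic_on UNIV" unfolding H_def by (rule fock_translation_holomorphic[OF h])
  have dens: "fock_density \<alpha> f (l + \<zeta>) = ((cmod \<zeta>)\<^sup>2) ^ n * ((cmod (H \<zeta>))\<^sup>2 * exp (- \<alpha> * (cmod \<zeta>)\<^sup>2))" for \<zeta>
    unfolding H_def norm_fock_translation
    by (simp add: fock_density_def f norm_mult norm_power power_mult_distrib flip: power_mult) (simp add: mult.commute)
  define B where "B = exp (real n) * M / (R\<^sup>2) ^ n"
  have B0: "B \<ge> 0" using M0 by (simp add: B_def)
  have "cmod (H (z - l)) \<le> sqrt B"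
  proof (rule maximum_modulus_frontier[of H "cball 0 R"])
    show "H holomorphic_on interior (cball 0 R)" by (rule holomorphic_on_subset[OF H]) auto
    show "continuous_on (closure (cball 0 R)) H" by (rule continuous_on_subset[OF entire_continuous[OF H]]) auto
    fix \<zeta> assume "\<zeta> \<in> frontier (cball (0::complex) R)"
    then have \<zeta>: "cmod \<zeta> = R" by simp
    have "(R\<^sup>2) ^ n * ((cmod (H \<zeta>))\<^sup>2 * exp (- real n)) \<le> M"
      using M[of "l + \<zeta>"] R(2) by (simp add: dens \<zeta>)
    then have "(cmod (H \<zeta>))\<^sup>2 \<le> B"
      using R0 by (simp add: B_def field_simps exp_minus)
    then show "cmod (H \<zeta>) \<le> sqrt B" by (rule real_le_rsqrt)
  qed (use r C in \<open>auto simp: r_def\<close>)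
  then have "(cmod (H (z - l)))\<^sup>2 \<le> (sqrt B)\<^sup>2" by (intro power_mono) auto
  then have HB: "(cmod (H (z - l)))\<^sup>2 \<le> B" using B0 by simp
  define t where "t = r / R"
  have t: "0 \<le> t" using r R0 by (simp add: t_def)
  have rt: "r = t * R" using R0 by (simp add: t_def)
  have "fock_density \<alpha> f z = (r\<^sup>2) ^ n * ((cmod (H (z - l)))\<^sup>2 * exp (- (\<alpha> * r\<^sup>2)))"
    using dens[of "z - l"] by (simp add: r_def)
  also have "\<dots> \<le> (r\<^sup>2) ^ n * (B * exp (- (\<alpha> * r\<^sup>2)))"
    using HB by (intro mult_left_mono mult_right_mono) auto
  also have "\<alpha> * r\<^sup>2 = real n * t\<^sup>2" using R(2) by (simp add: rt power_mult_distrib mult_ac)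
  also have "(r\<^sup>2) ^ n * (B * exp (- (real n * t\<^sup>2))) = (t\<^sup>2 * exp (1 - t\<^sup>2)) ^ n * M"
    using R0 by (simp add: B_def rt power_mult_distrib exp_diff power_divide exp_minus divide_simps
        flip: exp_of_nat_mult)
  also have "(t\<^sup>2 * exp (1 - t\<^sup>2)) ^ n \<le> exp (- ((1 - t)\<^sup>2)) ^ n"
  proof (rule power_mono)
    have "t \<le> exp (t - 1)" using exp_ge_add_one_self[of "t - 1"] by simp
    then have "t\<^sup>2 \<le> (exp (t - 1))\<^sup>2" using t by (intro power_mono)
    then have "t\<^sup>2 * exp (1 - t\<^sup>2) \<le> (exp (t - 1))\<^sup>2 * exp (1 - t\<^sup>2)" by (intro mult_right_mono) auto
    also have "\<dots> = exp (- ((1 - t)\<^sup>2))"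
      by (simp add: power2_eq_square algebra_simps flip: exp_add)
    finally show "t\<^sup>2 * exp (1 - t\<^sup>2) \<le> exp (- ((1 - t)\<^sup>2))" .
  qed simp
  also have "exp (- ((1 - t)\<^sup>2)) ^ n = exp (- (real n * (1 - t)\<^sup>2))"
    by (simp flip: exp_of_nat_mult)
  also have "real n * (1 - t)\<^sup>2 = \<alpha> * (R - r)\<^sup>2"
    unfolding R(2)[symmetric] rt by (simp add: power2_eq_square algebra_simps)
  also have "exp (- (\<alpha> * (R - r)\<^sup>2)) \<le> exp (- (\<alpha> * C\<^sup>2))"
    using assms(1) r C by (auto intro!: mult_left_mono power_mono)
  finally show ?thesis using M0 by (simp add: mult_right_mono)
qed

text \<open>If the supremum \<open>s\<close> were larger than \<open>B\<close>, only points off \<open>K\<close> could approach it, so \<open>s \<le> \<theta> * s\<close> and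
  \<open>s\<close> could not be positive.\<close>

lemma sup_attained_where_not_contracting:
  fixes U :: "'a \<Rightarrow> real"
  assumes bdd: "bdd_above (range U)" and nonneg: "\<And>z. U z \<ge> 0" and "0 \<le> \<theta>" "\<theta> < 1" "B \<ge> 0"
    and K: "\<And>z. z \<in> K \<Longrightarrow> U z \<le> B"
    and contr: "\<And>z M. z \<notin> K \<Longrightarrow> (\<And>w. U w \<le> M) \<Longrightarrow> U z \<le> \<theta> * M"
  shows "U z \<le> B"
proof -
  define s where "s = (SUP z. U z)"
  have s: "U z \<le> s" for z unfolding s_def by (rule cSUP_upper[OF UNIV_I bdd])
  have "s \<le> max B (\<theta> * s)"
    unfolding s_def by (rule cSUP_least) (use K contr[OF _ s] s_def in \<open>force simp: le_max_iff_disj\<close>)+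
  moreover have "s \<ge> 0" using s nonneg by (meson order.trans)
  ultimately have "s \<le> B"
    using assms(4,5) by (smt (verit) mult_le_cancel_right1 mult_less_cancel_right1)
  then show ?thesis using s by (meson order.trans)
qed

lemma entire_factor_taylor_zero:
  assumes g: "g holomorphic_on UNIV" and z: "\<And>k. k < n \<Longrightarrow> taylor_coeff g k = 0"
  obtains h where "h holomorphic_on UNIV" "\<And>z. g z = z ^ n * h z"
proof -
  define h where "h z = (\<Sum>k. taylor_coeff g (k + n) * z ^ k)" for z
  have sm: "(\<lambda>k. taylor_coeff g (k + n) * z ^ k) sums h z" for z
  proof -
    have "summable (\<lambda>k. taylor_coeff g (k + n) * z ^ k)"
    proof (cases "z = 0")
      case True
      then show ?thesis by simp
    next
      case False
      have "summable (\<lambda>k. taylor_coeff g (k + n) * z ^ (k + n))"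
        using entire_taylor_sums[OF g, of z] by (subst summable_iff_shift) (rule sums_summable)
      then have "summable (\<lambda>k. (1 / z ^ n) * (taylor_coeff g (k + n) * z ^ (k + n)))"
        by (rule summable_mult)
      then show ?thesis using False by (simp add: power_add)
    qed
    then show ?thesis unfolding h_def by (rule summable_sums)
  qed
  show ?thesis
  proof
    have "h holomorphic_on ball 0 r" for r
      by (rule power_series_holomorphic[of 0 r "\<lambda>k. taylor_coeff g (k + n)"]) (use sm in simp)
    then have "h field_differentiable at z" for z
      using holomorphic_on_imp_differentiable_at[of h "ball 0 (cmod z + 1)" z] by simp
    then show "h holomorphic_on UNIV" by (simp add: holomorphic_on_def field_differentiable_at_within)
    fix z
    have "(\<lambda>k. z ^ n * (taylor_coeff g (k + n) * z ^ k)) sums (z ^ n * h z)"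
      using sm by (rule sums_mult)
    then have "(\<lambda>k. taylor_coeff g (k + n) * z ^ (k + n)) sums (z ^ n * h z)"
      by (simp add: power_add mult_ac)
    then have "(\<lambda>k. taylor_coeff g k * z ^ k) sums (z ^ n * h z)"
      by (subst (asm) sums_zero_iff_shift) (use z in auto)
    then show "g z = z ^ n * h z" using entire_taylor_sums[OF g] sums_unique2 by blast
  qed
qed

lemma entire_factor_local_energy_zero:
  assumes "\<alpha> > 0" and f: "f holomorphic_on UNIV" and 0: "fock_local_energy \<alpha> f l n = 0"
  obtains h where "h holomorphic_on UNIV" "\<And>z. f z = (z - l) ^ n * h z"
proof -
  define g where "g = fock_translation \<alpha> (- l) f"
  have g: "g holomorphic_on UNIV" unfolding g_def by (rule fock_translation_holomorphic[OF f])
  have "taylor_coeff g k = 0" if "k < n" for k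
  proof -
    have "fock_coeff \<alpha> f l k = 0" using 0 that by (auto simp: fock_local_energy_def simp del: sum_ennreal)
    then show ?thesis using assms(1) by (simp add: fock_coeff_def g_def)
  qed
  then obtain h where h: "h holomorphic_on UNIV" "\<And>z. g z = z ^ n * h z"
    using entire_factor_taylor_zero[OF g] by blast
  define e where "e z = exp (- (complex_of_real \<alpha> * cnj (- l) * (z - l) - complex_of_real (\<alpha> / 2 * (cmod (- l))\<^sup>2)))" for z
  have e: "g (z - l) * e z = f z" for z
    by (simp add: g_def fock_translation_def e_def mult.commute mult.left_commute flip: exp_add)
  show ?thesis
  proof
    show "(\<lambda>z. h (z - l) * e z) holomorphic_on UNIV" unfolding e_def
      by (intro holomorphic_intros holomorphic_on_compose_gen[of "\<lambda>z. z - l" _ h UNIV, unfolded o_def] h(1)) auto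
    show "f z = (z - l) ^ n * (h (z - l) * e z)" for z
      using e[of z] by (simp add: h(2) mult.assoc)
  qed
qed

text \<open>Finitely many discs and a compact set do not cover the plane, so there are infinitely many such points.
  If they were bounded, they would accumulate at some \<open>p\<close>, and infinitely many discs of radius larger than
  \<open>C\<close> would contain \<open>p\<close>.\<close>

lemma far_points_of_large_multiplicity:
  assumes "\<alpha> > 0" and overlap: "finite_overlap \<alpha> \<Lambda> m" and "C > 0" and "compact K"
    and cover: "UNIV - K \<subseteq> (\<Union>l\<in>{l\<in>\<Lambda>. real (m l) > \<alpha> * C\<^sup>2}. ball l (sqrt (real (m l) / \<alpha>) - C))"
  obtains l where "l \<in> \<Lambda>" "real (m l) > \<alpha> * C\<^sup>2" "cmod l \<ge> L"
proof (rule ccontr)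
  define I where "I = {l\<in>\<Lambda>. real (m l) > \<alpha> * C\<^sup>2}"
  note found = that
  assume no: "\<not> thesis"
  have L: "cmod l < L" if "l \<in> I" for l
  proof (rule ccontr)
    assume "\<not> cmod l < L"
    then show False using found[of l] no that by (auto simp: I_def)
  qed
  have bI: "bounded I" using L by (auto simp: bounded_iff intro!: exI[of _ L] less_imp_le)
  show False
  proof (cases "finite I")
    case True
    then have "bounded (K \<union> (\<Union>l\<in>I. ball l (sqrt (real (m l) / \<alpha>) - C)))"
      using \<open>compact K\<close> True by (simp add: bounded_UN compact_imp_bounded)
    moreover have "K \<union> (\<Union>l\<in>I. ball l (sqrt (real (m l) / \<alpha>) - C)) = UNIV"
      using cover unfolding I_def by blast
    ultimately show False using not_bounded_UNIV[where 'a=complex] by simp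
  next
    case False
    then obtain p where p: "p islimpt I" using bI bounded_infinite_imp_islimpt[of I I] by auto
    then have inf: "infinite (I \<inter> ball p C)"
      using \<open>C > 0\<close> by (simp add: islimpt_eq_infinite_ball)
    have big: "C < sqrt (real (m l) / \<alpha>)" if "l \<in> I" for l
      using that assms(1,3) by (intro real_less_rsqrt) (auto simp: I_def field_simps)
    obtain N where N: "N \<ge> 0" "\<And>z. (\<Sum>\<^sub>\<infinity>l\<in>\<Lambda>. indicator (ball l (sqrt (real (m l) / \<alpha>))) z :: ennreal) \<le> ennreal N"
      using finite_overlapE[OF overlap] by blast
    obtain k :: nat where k: "N < real k" using reals_Archimedean2 by blast
    obtain F where F: "F \<subseteq> I \<inter> ball p C" "finite F" "card F = k"
      using infinite_arbitrarily_large[OF inf] by blast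
    have "ennreal (real k) = (\<Sum>l\<in>F. indicator (ball l (sqrt (real (m l) / \<alpha>))) p :: ennreal)"
    proof -
      have "(indicator (ball l (sqrt (real (m l) / \<alpha>))) p :: ennreal) = 1" if "l \<in> F" for l
      proof -
        have "l \<in> I" "dist l p < C" using that F by (auto simp: dist_commute)
        then have "dist l p < sqrt (real (m l) / \<alpha>)" using big[of l] by linarith
        then show ?thesis by simp
      qed
      then show ?thesis using F by (simp add: ennreal_of_nat_eq_real_of_nat)
    qed
    also have "\<dots> \<le> ennreal N"
      using F I_def by (intro order.trans[OF sum_le_infsum_ennreal N(2)]) auto
    finally show False using k N(1) by (simp add: ennreal_le_iff)
  qed
qed

section \<open>Uniqueness\<close>

lemma fock_density_continuous: "f holomorphic_on UNIV \<Longrightarrow> continuous_on A (fock_density \<alpha> f)"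
  unfolding fock_density_def
  by (intro continuous_intros continuous_on_subset[OF entire_continuous]) auto

lemma fock_density_le_mass:
  assumes "\<alpha> > 0" and f: "f holomorphic_on UNIV" and mass: "emeasure (fock_mass \<alpha> f) UNIV \<le> ennreal c" "c \<ge> 0"
  shows "fock_density \<alpha> f z \<le> 2 * c"
proof -
  have "ennreal (fock_density \<alpha> f z) \<le> 2 * emeasure (fock_mass \<alpha> f) UNIV"
    unfolding fock_density_def by (rule pointwise_le_fock_mass[OF assms(1) f])
  also have "\<dots> \<le> 2 * ennreal c" by (intro mult_left_mono mass) auto
  also have "\<dots> = ennreal (2 * c)" by (simp add: ennreal_mult')
  finally show ?thesis using mass by (simp add: ennreal_le_iff)
qed

lemma sqrt_diff_radius:
  assumes "\<alpha> > 0" "N \<le> n"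
  shows "sqrt (real n / \<alpha>) - sqrt (real N / \<alpha>) \<le> sqrt (real (n - N) / \<alpha>)"
proof -
  have "sqrt (real (n - N) / \<alpha> + real N / \<alpha>) \<le> sqrt (real (n - N) / \<alpha>) + sqrt (real N / \<alpha>)"
    using assms by (intro sqrt_add_le_add_sqrt) auto
  moreover have "real (n - N) / \<alpha> + real N / \<alpha> = real n / \<alpha>"
    using assms by (simp add: add_divide_distrib[symmetric] of_nat_diff)
  ultimately show ?thesis by simp
qed

text \<open>Cancelling a zero at \<open>l0\<close> does not affect the order of vanishing at another point \<open>l\<close>: the quotient
  \<open>q\<close> has explicit holomorphic expressions off \<open>l\<close> and off \<open>l0\<close>.\<close>

lemma divide_off_point:
  assumes f: "f holomorphic_on UNIV" and F: "F holomorphic_on UNIV" and h: "h holomorphic_on UNIV"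
    and p: "p holomorphic_on UNIV"
    and fh: "\<And>z. f z = (z - l) ^ n * h z"
    and Ff: "\<And>z. z \<noteq> l0 \<Longrightarrow> F z * (z - l0) ^ N = p z * f z" and ne: "l \<noteq> l0"
  obtains q where "q holomorphic_on UNIV" "\<And>z. F z = (z - l) ^ n * q z"
proof -
  define q where "q z = (if z = l then p l * h l / (l - l0) ^ N else F z / (z - l) ^ n)" for z
  have eq: "q z = p z * h z / (z - l0) ^ N" if "z \<noteq> l0" for z
  proof (cases "z = l")
    case False
    have "F z * (z - l0) ^ N = (z - l) ^ n * (p z * h z)" using Ff[OF that] fh by (simp add: mult_ac)
    then show ?thesis using False that by (simp add: q_def field_simps)
  qed (simp add: q_def)
  have "q holomorphic_on (- {l0})"
    by (rule holomorphic_transform[of "\<lambda>z. p z * h z / (z - l0) ^ N"])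
       (auto intro!: holomorphic_intros holomorphic_on_subset[OF p] holomorphic_on_subset[OF h] simp: eq)
  moreover have "q holomorphic_on (- {l})"
    by (rule holomorphic_transform[of "\<lambda>z. F z / (z - l) ^ n"])
       (auto intro!: holomorphic_intros holomorphic_on_subset[OF F] simp: q_def)
  ultimately have "q holomorphic_on (- {l0} \<union> - {l})"
    by (intro holomorphic_on_Un) auto
  moreover have "- {l0} \<union> - {l} = UNIV" using ne by auto
  ultimately have q: "q holomorphic_on UNIV" by simp
  have "F z = (z - l) ^ n * q z" for z
  proof (cases "z = l")
    case True
    show ?thesis
    proof (cases "n = 0")
      case True
      have "F l * (l - l0) ^ N = p l * h l" using Ff[of l] fh[of l] ne True by simp
      then show ?thesis using ne True \<open>z = l\<close> by (simp add: q_def field_simps)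
    next
      case False
      have "F l * (l - l0) ^ N = 0" using Ff[of l] fh[of l] ne False by simp
      then show ?thesis using ne False True by simp
    qed
  qed (simp add: q_def)
  with q show ?thesis using that by blast
qed

text \<open>Boundedness of the density of \<open>z\<^sup>N f\<close> is not clear a priori. One compares with
  \<open>F = z\<^sup>N f / (1 - z / l0)\<^sup>N\<close> for a far away \<open>l0\<close> in \<open>\<Lambda>\<close> of multiplicity at least \<open>N\<close>: it is entire, its
  density is bounded, and at each point of \<open>\<Lambda>\<close> its order of vanishing has dropped by at most \<open>N\<close>. Dropping
  \<open>N\<close> shrinks a radius by at most \<open>sqrt (N / \<alpha>)\<close>, which the covering hypothesis with
  \<open>C = sqrt (N / \<alpha>) + 1\<close> absorbs. So the density of \<open>F\<close> is bounded by its values on a compact set that does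
  not depend on \<open>l0\<close>, and there \<open>|1 - z / l0| \<ge> 1/2\<close>.\<close>

lemma uniqueness_polynomial_growth:
  assumes "\<alpha> > 0" and overlap: "finite_overlap \<alpha> \<Lambda> m"
    and cover: "\<And>C. C > 0 \<Longrightarrow> \<exists>K. compact K \<and>
               (\<Union>l\<in>{l\<in>\<Lambda>. real (m l) > \<alpha> * C\<^sup>2}. ball l (sqrt (real (m l) / \<alpha>) - C)) = UNIV - K"
    and f: "f holomorphic_on UNIV" and B: "\<And>z. fock_density \<alpha> f z \<le> B"
    and zero: "\<And>l. l \<in> \<Lambda> \<Longrightarrow> fock_local_energy \<alpha> f l (m l) = 0"
  shows "\<exists>B'. \<forall>z. (cmod (z ^ N))\<^sup>2 * fock_density \<alpha> f z \<le> B'"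
proof -
  have B0: "B \<ge> 0" using B[of 0] fock_density_nonneg[of \<alpha> f 0] by linarith
  define C where "C = sqrt (real N / \<alpha>) + 1"
  have C: "C > 0" "C \<ge> 1" using assms(1) by (auto simp: C_def add_nonneg_pos)
  have NC: "real N \<le> \<alpha> * C\<^sup>2"
  proof -
    have "(sqrt (real N / \<alpha>))\<^sup>2 \<le> C\<^sup>2" using assms(1) by (intro power_mono) (auto simp: C_def)
    then show ?thesis using assms(1) by (simp add: field_simps)
  qed
  obtain K where K: "compact K" "(\<Union>l\<in>{l\<in>\<Lambda>. real (m l) > \<alpha> * C\<^sup>2}. ball l (sqrt (real (m l) / \<alpha>) - C)) = UNIV - K"
    using cover[OF C(1)] by blast
  obtain \<rho> where \<rho>: "\<rho> > 0" "\<And>z. z \<in> K \<Longrightarrow> cmod z \<le> \<rho>"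
    using compact_imp_bounded[OF K(1)] by (auto simp: bounded_pos)
  have main: "fock_density \<alpha> f z * (cmod (z ^ N))\<^sup>2 \<le> ((2 * \<rho>) ^ N)\<^sup>2 * B * (2 ^ N)\<^sup>2" for z
  proof -
    \<comment> \<open>\<open>|l0| \<ge> 2 \<rho>\<close> keeps \<open>1 - w / l0\<close> away from 0 for \<open>w\<close> in \<open>K\<close>, and \<open>|l0| \<ge> |z|\<close> gives
      \<open>|1 - z / l0| \<le> 2\<close> at the point under consideration\<close>
    obtain l0 where l0: "l0 \<in> \<Lambda>" "real (m l0) > \<alpha> * C\<^sup>2" "cmod l0 \<ge> max (2 * \<rho>) (cmod z)"
      using far_points_of_large_multiplicity[OF assms(1) overlap C(1) K(1)] K(2) by (metis order_refl)
    then have l0': "cmod l0 > 0" "l0 \<noteq> 0" "cmod l0 \<ge> 2 * \<rho>" "cmod z \<le> cmod l0" using \<rho>(1) by auto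
    have ml0: "N \<le> m l0" using l0(2) NC by linarith
    obtain h0 where h0: "h0 holomorphic_on UNIV" "\<And>z. f z = (z - l0) ^ m l0 * h0 z"
      using entire_factor_local_energy_zero[OF assms(1) f zero[OF l0(1)]] by blast
    \<comment> \<open>the constant \<open>(- l0)\<^sup>N\<close> turns the denominator \<open>(w - l0)\<^sup>N\<close> into \<open>(1 - w / l0)\<^sup>N\<close>\<close>
    define p where "p w = w ^ N * (- l0) ^ N" for w :: complex
    define F where "F w = p w * ((w - l0) ^ (m l0 - N) * h0 w)" for w
    have p: "p holomorphic_on UNIV" unfolding p_def by (intro holomorphic_intros)
    have F: "F holomorphic_on UNIV" unfolding F_def by (intro holomorphic_intros p h0)
    have Ff: "F w * (w - l0) ^ N = p w * f w" for w
    proof -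
      have "(w - l0) ^ (m l0 - N) * (w - l0) ^ N = (w - l0) ^ m l0"
        using ml0 by (simp flip: power_add)
      then show ?thesis by (simp add: F_def h0(2) mult_ac)
    qed
    have dens: "fock_density \<alpha> F w * (cmod (1 - w / l0) ^ N)\<^sup>2 = (cmod w ^ N)\<^sup>2 * fock_density \<alpha> f w" for w
    proof -
      have "(w - l0) ^ N = (- l0) ^ N * (1 - w / l0) ^ N"
        using l0' by (simp add: power_mult_distrib[symmetric] field_simps)
      then have "(- l0) ^ N * (F w * (1 - w / l0) ^ N) = (- l0) ^ N * (w ^ N * f w)"
        using Ff[of w] by (simp add: p_def mult_ac)
      then have "F w * (1 - w / l0) ^ N = w ^ N * f w" using l0' by simp
      then have "(cmod (F w * (1 - w / l0) ^ N))\<^sup>2 = (cmod (w ^ N * f w))\<^sup>2" by simp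
      then show ?thesis by (simp add: fock_density_def norm_mult norm_power power_mult_distrib mult_ac)
    qed
    have bound: "fock_density \<alpha> F w \<le> (c ^ N)\<^sup>2 * B" if c: "c \<ge> 0" "cmod w \<le> c * cmod (1 - w / l0)" "cmod (1 - w / l0) > 0" for w c
    proof -
      have "(cmod w ^ N)\<^sup>2 \<le> ((c * cmod (1 - w / l0)) ^ N)\<^sup>2" using c by (intro power_mono) auto
      then have "(cmod w ^ N)\<^sup>2 * fock_density \<alpha> f w \<le> ((c * cmod (1 - w / l0)) ^ N)\<^sup>2 * B"
        using B fock_density_nonneg by (intro mult_mono) auto
      then have "fock_density \<alpha> F w * (cmod (1 - w / l0) ^ N)\<^sup>2 \<le> (c ^ N)\<^sup>2 * B * (cmod (1 - w / l0) ^ N)\<^sup>2"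
        unfolding dens by (simp add: power_mult_distrib mult_ac)
      moreover have "(cmod (1 - w / l0) ^ N)\<^sup>2 > 0" using c(3) by (intro zero_less_power)
      ultimately show ?thesis by (rule mult_right_le_imp_le)
    qed
    have bdd: "bdd_above (range (fock_density \<alpha> F))"
    proof -
      have "compact (fock_density \<alpha> F ` cball 0 (2 * cmod l0))"
        by (intro compact_continuous_image fock_density_continuous F) auto
      then obtain B1 where B1': "\<forall>x\<in>fock_density \<alpha> F ` cball 0 (2 * cmod l0). norm x \<le> B1"
        using compact_imp_bounded bounded_iff by metis
      have B1: "fock_density \<alpha> F w \<le> B1" if "w \<in> cball 0 (2 * cmod l0)" for w
        using bspec[OF B1' imageI[OF that]] by simp
      have "fock_density \<alpha> F w \<le> max B1 (((2 * cmod l0) ^ N)\<^sup>2 * B)" for w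
      proof (cases "w \<in> cball 0 (2 * cmod l0)")
        case False
        then have w: "cmod w > 2 * cmod l0" by simp
        have "cmod (w / l0) - cmod 1 \<le> cmod (1 - w / l0)" using norm_triangle_ineq3[of "w / l0" 1]
          by (simp add: norm_minus_commute)
        then have "cmod w / cmod l0 - 1 \<le> cmod (1 - w / l0)" by (simp add: norm_divide)
        then have "cmod w - cmod l0 \<le> cmod l0 * cmod (1 - w / l0)" using l0' by (simp add: field_simps)
        then have *: "cmod w \<le> 2 * cmod l0 * cmod (1 - w / l0)" using w by linarith
        moreover have "cmod (1 - w / l0) > 0" using * w l0' by (auto simp: zero_less_norm_iff)
        ultimately show ?thesis using bound[of "2 * cmod l0" w] l0' by (simp add: le_max_iff_disj)
      qed (use B1 in \<open>simp add: le_max_iff_disj\<close>)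
      then show ?thesis by (auto simp: bdd_above_def)
    qed
    have "fock_density \<alpha> F z \<le> ((2 * \<rho>) ^ N)\<^sup>2 * B"
    proof (rule sup_attained_where_not_contracting[where \<theta>="exp (- (\<alpha> * 1\<^sup>2))" and K=K, OF bdd fock_density_nonneg])
      fix w assume "w \<in> K"
      then have w: "cmod w \<le> \<rho>" by (rule \<rho>)
      have "cmod (w / l0) \<le> 1 / 2" using w l0' \<rho>(1) by (simp add: norm_divide divide_simps)
      then have "1 / 2 \<le> cmod (1 - w / l0)" using norm_triangle_ineq2[of 1 "w / l0"] by simp
      then have "\<rho> * 2 * (1 / 2) \<le> \<rho> * 2 * cmod (1 - w / l0)" using \<rho>(1) by (intro mult_left_mono) auto
      then have "cmod w \<le> 2 * \<rho> * cmod (1 - w / l0)" using w by simp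
      then show "fock_density \<alpha> F w \<le> ((2 * \<rho>) ^ N)\<^sup>2 * B"
        using bound[of "2 * \<rho>" w] \<rho>(1) \<open>1 / 2 \<le> cmod (1 - w / l0)\<close> by linarith
    next
      fix w M assume w: "w \<notin> K" and M: "\<And>w. fock_density \<alpha> F w \<le> M"
      then obtain l where l: "l \<in> \<Lambda>" "real (m l) > \<alpha> * C\<^sup>2" "w \<in> ball l (sqrt (real (m l) / \<alpha>) - C)"
        using K(2) by blast
      have ml: "N \<le> m l" using l(2) NC by linarith
      obtain h where h: "h holomorphic_on UNIV" "\<And>z. f z = (z - l) ^ m l * h z"
        using entire_factor_local_energy_zero[OF assms(1) f zero[OF l(1)]] by blast
      obtain q where q: "q holomorphic_on UNIV" "\<And>z. F z = (z - l) ^ (m l - N) * q z"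
      proof (cases "l = l0")
        case True
        show ?thesis by (rule that[of "\<lambda>w. p w * h0 w"])
          (auto intro!: holomorphic_intros p h0 simp: F_def True)
      next
        case False
        have "(z - l) ^ m l = (z - l) ^ (m l - N) * (z - l) ^ N" for z using ml by (simp flip: power_add)
        then have "f z = (z - l) ^ (m l - N) * ((z - l) ^ N * h z)" for z using h(2) by (simp add: mult.assoc)
        moreover have "(\<lambda>z. (z - l) ^ N * h z) holomorphic_on UNIV" by (intro holomorphic_intros h(1))
        ultimately show ?thesis using divide_off_point[OF f F _ p _ Ff False] that by blast
      qed
      show "fock_density \<alpha> F w \<le> exp (- (\<alpha> * 1\<^sup>2)) * M"
      proof (rule fock_density_max_principle[OF assms(1) radius_of_multiplicity(2)[OF assms(1)] radius_of_multiplicity(1)[OF assms(1)] _ q M])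
        show "w \<in> ball l (sqrt (real (m l - N) / \<alpha>) - 1)"
          using l(3) sqrt_diff_radius[OF assms(1) ml] by (auto simp: C_def)
      qed simp
    qed (use assms(1) B0 in auto)
    then have "fock_density \<alpha> F z * (cmod (1 - z / l0) ^ N)\<^sup>2 \<le> ((2 * \<rho>) ^ N)\<^sup>2 * B * (2 ^ N)\<^sup>2"
    proof (rule mult_mono)
      have "cmod (1 - z / l0) \<le> 1 + cmod (z / l0)" using norm_triangle_ineq4[of 1 "z / l0"] by simp
      also have "cmod (z / l0) \<le> 1" using l0' by (simp add: norm_divide)
      finally show "(cmod (1 - z / l0) ^ N)\<^sup>2 \<le> (2 ^ N)\<^sup>2" by (intro power_mono) auto
    qed (use B0 in auto)
    then show ?thesis unfolding dens by (simp add: norm_power mult.commute)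
  qed
  then show ?thesis by (auto simp: mult.commute)
qed

text \<open>The maximum principle with one fixed compact set applies to \<open>z\<^sup>N f\<close> for all \<open>N\<close> at once and gives
  \<open>|z|\<^sup>2\<^sup>N\<close> times the density of \<open>f\<close> at most \<open>\<rho>\<^sup>2\<^sup>N\<close> times a constant, where \<open>\<rho>\<close> bounds that set. Letting
  \<open>N\<close> grow, \<open>f\<close> vanishes for \<open>|z| > \<rho>\<close>.\<close>

lemma uniqueness_set:
  assumes "\<alpha> > 0" and overlap: "finite_overlap \<alpha> \<Lambda> m"
    and cover: "\<And>C. C > 0 \<Longrightarrow> \<exists>K. compact K \<and>
               (\<Union>l\<in>{l\<in>\<Lambda>. real (m l) > \<alpha> * C\<^sup>2}. ball l (sqrt (real (m l) / \<alpha>) - C)) = UNIV - K"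
    and f: "f holomorphic_on UNIV" and B: "\<And>z. fock_density \<alpha> f z \<le> B"
    and zero: "\<And>l. l \<in> \<Lambda> \<Longrightarrow> fock_local_energy \<alpha> f l (m l) = 0"
  shows "f z = 0"
proof -
  have B0: "B \<ge> 0" using B[of 0] fock_density_nonneg[of \<alpha> f 0] by linarith
  obtain K where K: "compact K" "(\<Union>l\<in>{l\<in>\<Lambda>. real (m l) > \<alpha> * 1\<^sup>2}. ball l (sqrt (real (m l) / \<alpha>) - 1)) = UNIV - K"
    using cover[of 1] by auto
  obtain \<rho> where \<rho>: "\<rho> > 0" "\<And>z. z \<in> K \<Longrightarrow> cmod z \<le> \<rho>"
    using compact_imp_bounded[OF K(1)] by (auto simp: bounded_pos)
  have growth: "(cmod z ^ N)\<^sup>2 * fock_density \<alpha> f z \<le> (\<rho> ^ N)\<^sup>2 * B" for z N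
  proof -
    define F where "F w = w ^ N * f w" for w
    have dens: "fock_density \<alpha> F w = (cmod w ^ N)\<^sup>2 * fock_density \<alpha> f w" for w
      unfolding F_def fock_density_mult by (simp add: norm_power)
    have bdd: "bdd_above (range (fock_density \<alpha> F))"
      using uniqueness_polynomial_growth[OF assms, of N] unfolding dens bdd_above_def by (auto simp: norm_power)
    have "fock_density \<alpha> F z \<le> (\<rho> ^ N)\<^sup>2 * B"
    proof (rule sup_attained_where_not_contracting[where \<theta>="exp (- (\<alpha> * 1\<^sup>2))" and K=K, OF bdd fock_density_nonneg])
      fix w assume "w \<in> K"
      then show "fock_density \<alpha> F w \<le> (\<rho> ^ N)\<^sup>2 * B"
        unfolding dens using \<rho> B fock_density_nonneg by (intro mult_mono power_mono) auto
    next
      fix w M assume w: "w \<notin> K" and M: "\<And>w. fock_density \<alpha> F w \<le> M"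
      then obtain l where l: "l \<in> \<Lambda>" "w \<in> ball l (sqrt (real (m l) / \<alpha>) - 1)"
        using K(2) by blast
      obtain h where h: "h holomorphic_on UNIV" "\<And>z. f z = (z - l) ^ m l * h z"
        using entire_factor_local_energy_zero[OF assms(1) f zero[OF l(1)]] by blast
      show "fock_density \<alpha> F w \<le> exp (- (\<alpha> * 1\<^sup>2)) * M"
        by (rule fock_density_max_principle[OF assms(1) radius_of_multiplicity(2)[OF assms(1)] radius_of_multiplicity(1)[OF assms(1)] _ _ _ M l(2),
              of "\<lambda>w. w ^ N * h w"])
           (auto intro!: holomorphic_intros h(1) simp: F_def h(2))
    qed (use assms(1) B0 in auto)
    then show ?thesis by (simp only: dens)
  qed
  have outside: "f w = 0" if "cmod w > \<rho>" for w
  proof (rule ccontr)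
    assume "f w \<noteq> 0"
    then have U: "fock_density \<alpha> f w > 0" by (simp add: fock_density_def)
    define c where "c = (cmod w / \<rho>)\<^sup>2"
    have c: "c > 1" using that \<rho>(1) by (simp add: c_def)
    obtain N where N: "B / fock_density \<alpha> f w < c ^ N" using real_arch_pow[OF c] by blast
    have "c ^ N * fock_density \<alpha> f w * (\<rho> ^ N)\<^sup>2 = (cmod w ^ N)\<^sup>2 * fock_density \<alpha> f w"
      using \<rho>(1) by (simp add: c_def power_divide mult.commute flip: power_mult)
    also have "\<dots> \<le> B * (\<rho> ^ N)\<^sup>2" using growth[where z=w and N=N] by (simp add: mult.commute)
    finally have "c ^ N * fock_density \<alpha> f w \<le> B" using \<rho>(1) by simp
    then show False using N U by (simp add: field_simps)
  qed
  have "cmod (f z) \<le> 0"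
  proof (rule maximum_modulus_frontier[of f "cball 0 (\<rho> + 1 + cmod z)"])
    show "f holomorphic_on interior (cball 0 (\<rho> + 1 + cmod z))" by (rule holomorphic_on_subset[OF f]) auto
    show "continuous_on (closure (cball 0 (\<rho> + 1 + cmod z))) f"
      by (rule continuous_on_subset[OF entire_continuous[OF f]]) auto
    fix w assume "w \<in> frontier (cball (0::complex) (\<rho> + 1 + cmod z))"
    then have "cmod w = \<rho> + 1 + cmod z" by simp
    then have "cmod w > \<rho>" using norm_ge_zero[of z] by linarith
    then show "cmod (f w) \<le> 0" by (simp add: outside)
  qed (use \<rho> in auto)
  then show ?thesis by simp
qed

section \<open>The lower sampling inequality\<close>

lemma disc_moment_pos:
  assumes "\<alpha> > 0"
  shows "disc_moment \<alpha> (sqrt (real (Suc k) / \<alpha>)) k > 0"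
  using poisson_below_mean_le[of "Suc k"] radius_of_multiplicity[OF assms, of "Suc k"] assms
  by (simp add: disc_moment_def)

text \<open>A coefficient is an integral over a disc, on which the functions are bounded by a common constant;
  dominated convergence applies.\<close>

lemma fock_coeff_tendsto:
  assumes "\<alpha> > 0" and hol: "\<And>n. f n holomorphic_on UNIV" and g: "g holomorphic_on UNIV"
    and lim: "\<And>z. (\<lambda>n. f n z) \<longlonglongrightarrow> g z" and B: "\<And>n z. fock_density \<alpha> (f n) z \<le> B"
  shows "(\<lambda>n. fock_coeff \<alpha> (f n) l k) \<longlonglongrightarrow> fock_coeff \<alpha> g l k"
proof -
  \<comment> \<open>the moment for this radius is positive by \<open>disc_moment_pos\<close>\<close>
  define R where "R = sqrt (real (Suc k) / \<alpha>)"
  have R: "R \<ge> 0" using assms(1) by (simp add: R_def)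
  have B0: "B \<ge> 0" using B[of 0 0] fock_density_nonneg[of \<alpha> "f 0" 0] by linarith
  let ?T = "fock_translation \<alpha> (- l)"
  have holT: "?T (f n) holomorphic_on UNIV" "?T g holomorphic_on UNIV" for n
    by (auto intro!: fock_translation_holomorphic hol g)
  have [measurable]: "?T (f n) \<in> borel_measurable borel" "?T g \<in> borel_measurable borel" for n
    by (auto intro!: entire_measurable holT)
  define b where "b = sqrt (B * exp (\<alpha> * R\<^sup>2))"
  have bound: "cmod (?T (f n) z) \<le> b" if "cmod z < R" for n z
  proof -
    have "(cmod (?T (f n) z))\<^sup>2 * exp (- \<alpha> * (cmod z)\<^sup>2) \<le> B"
      using B[of n "l + z"] unfolding norm_fock_translation fock_density_def .
    then have "(cmod (?T (f n) z))\<^sup>2 \<le> B * exp (\<alpha> * (cmod z)\<^sup>2)" by (simp add: exp_minus field_simps)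
    also have "\<dots> \<le> B * exp (\<alpha> * R\<^sup>2)"
      using that B0 assms(1) by (intro mult_left_mono) (auto intro!: mult_left_mono power_mono)
    finally show ?thesis unfolding b_def by (rule real_le_rsqrt)
  qed
  have "(\<lambda>n. LINT z|lborel. complex_of_real (disc_weight \<alpha> R z) * (?T (f n) z * cnj (z ^ k))) \<longlonglongrightarrow>
      (LINT z|lborel. complex_of_real (disc_weight \<alpha> R z) * (?T g z * cnj (z ^ k)))"
  proof (rule integral_dominated_convergence[where w="\<lambda>z. b * cmod (complex_of_real (disc_weight \<alpha> R z) * cnj (z ^ k))"])
    show "integrable lborel (\<lambda>z. b * cmod (complex_of_real (disc_weight \<alpha> R z) * cnj (z ^ k)))"
      by (intro integrable_mult_right integrable_norm disc_weight_integrable assms(1) continuous_intros)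
    have "(\<lambda>n. ?T (f n) z) \<longlonglongrightarrow> ?T g z" for z
      unfolding fock_translation_def by (intro tendsto_intros lim)
    then show "AE z in lborel. (\<lambda>n. complex_of_real (disc_weight \<alpha> R z) * (?T (f n) z * cnj (z ^ k))) \<longlonglongrightarrow>
        complex_of_real (disc_weight \<alpha> R z) * (?T g z * cnj (z ^ k))"
      by (intro AE_I2 tendsto_mult tendsto_const)
    show "AE z in lborel. cmod (complex_of_real (disc_weight \<alpha> R z) * (?T (f n) z * cnj (z ^ k))) \<le>
        b * cmod (complex_of_real (disc_weight \<alpha> R z) * cnj (z ^ k))" for n
    proof (rule AE_I2)
      fix z :: complex
      show "cmod (complex_of_real (disc_weight \<alpha> R z) * (?T (f n) z * cnj (z ^ k))) \<le>
        b * cmod (complex_of_real (disc_weight \<alpha> R z) * cnj (z ^ k))"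
      proof (cases "cmod z < R")
        case True
        have "cmod (?T (f n) z) * cmod (complex_of_real (disc_weight \<alpha> R z) * cnj (z ^ k)) \<le>
          b * cmod (complex_of_real (disc_weight \<alpha> R z) * cnj (z ^ k))"
          by (rule mult_right_mono[OF bound[OF True]]) simp
        then show ?thesis by (simp add: norm_mult mult_ac)
      qed (simp add: disc_weight_def)
    qed
  qed measurable
  then have "(\<lambda>n. taylor_coeff (?T (f n)) k * complex_of_real (disc_moment \<alpha> R k)) \<longlonglongrightarrow>
      taylor_coeff (?T g) k * complex_of_real (disc_moment \<alpha> R k)"
    by (simp only: disc_weight_taylor_coeff[OF assms(1) R holT(1)] disc_weight_taylor_coeff[OF assms(1) R holT(2)])
  then have "(\<lambda>n. taylor_coeff (?T (f n)) k * complex_of_real (disc_moment \<alpha> R k) / complex_of_real (disc_moment \<alpha> R k)) \<longlonglongrightarrow>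
      taylor_coeff (?T g) k * complex_of_real (disc_moment \<alpha> R k) / complex_of_real (disc_moment \<alpha> R k)"
    using disc_moment_pos[OF assms(1), of k] by (intro tendsto_divide tendsto_const) (auto simp: R_def)
  then have "(\<lambda>n. taylor_coeff (?T (f n)) k) \<longlonglongrightarrow> taylor_coeff (?T g) k"
    using disc_moment_pos[OF assms(1), of k] by (simp add: R_def)
  then show ?thesis unfolding fock_coeff_def by (intro tendsto_mult tendsto_const)
qed

lemma fock_mass_scale:
  assumes f: "f holomorphic_on UNIV" and "A \<in> sets borel"
  shows "emeasure (fock_mass \<alpha> (\<lambda>z. c * f z)) A = ennreal ((cmod c)\<^sup>2) * emeasure (fock_mass \<alpha> f) A"
proof -
  have [measurable]: "f \<in> borel_measurable borel" "A \<in> sets borel" using assms by (auto intro: entire_measurable)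
  have "emeasure (fock_mass \<alpha> (\<lambda>z. c * f z)) A =
    (\<integral>\<^sup>+ z. ennreal ((cmod c)\<^sup>2) * (ennreal (\<alpha> / pi * ((cmod (f z))\<^sup>2 * exp (- \<alpha> * (cmod z)\<^sup>2))) * indicator A z) \<partial>lborel)"
    using assms by (subst emeasure_fock_mass)
      (auto intro!: nn_integral_cong holomorphic_intros simp: norm_mult power_mult_distrib mult_ac split: split_indicator simp flip: ennreal_mult')
  also have "\<dots> = ennreal ((cmod c)\<^sup>2) * emeasure (fock_mass \<alpha> f) A"
    by (subst nn_integral_cmult) (auto simp: emeasure_fock_mass[OF assms])
  finally show ?thesis .
qed

lemma fock_coeff_scale:
  assumes "f holomorphic_on UNIV"
  shows "fock_coeff \<alpha> (\<lambda>z. c * f z) l k = c * fock_coeff \<alpha> f l k"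
proof -
  have "fock_translation \<alpha> (- l) (\<lambda>z. c * f z) = (\<lambda>z. c * fock_translation \<alpha> (- l) f z)"
    by (simp add: fock_translation_def fun_eq_iff)
  moreover have "(deriv ^^ k) (\<lambda>z. c * fock_translation \<alpha> (- l) f z) 0 = c * (deriv ^^ k) (fock_translation \<alpha> (- l) f) 0"
    by (rule higher_deriv_cmult[of _ UNIV]) (auto intro!: fock_translation_holomorphic assms)
  ultimately show ?thesis by (simp add: fock_coeff_def taylor_coeff_def)
qed

lemma fock_local_energy_scale:
  assumes "f holomorphic_on UNIV"
  shows "fock_local_energy \<alpha> (\<lambda>z. c * f z) l n = ennreal ((cmod c)\<^sup>2) * fock_local_energy \<alpha> f l n"
  unfolding fock_local_energy_def fock_coeff_scale[OF assms] sum_distrib_left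
  by (intro sum.cong) (auto simp: norm_mult power_mult_distrib ennreal_mult')

lemma fock_mass_limit_le:
  assumes hol: "\<And>n. f n holomorphic_on UNIV" and g: "g holomorphic_on UNIV"
    and lim: "\<And>z. (\<lambda>n. f n z) \<longlonglongrightarrow> g z" and B: "\<And>n. emeasure (fock_mass \<alpha> (f n)) UNIV \<le> B"
  shows "emeasure (fock_mass \<alpha> g) UNIV \<le> B"
proof -
  let ?d = "\<lambda>f z. ennreal (\<alpha> / pi * ((cmod (f z))\<^sup>2 * exp (- \<alpha> * (cmod z)\<^sup>2)))"
  have [measurable]: "f n \<in> borel_measurable borel" for n by (rule entire_measurable[OF hol])
  have mass: "emeasure (fock_mass \<alpha> h) UNIV = (\<integral>\<^sup>+ z. ?d h z \<partial>lborel)" if "h holomorphic_on UNIV" for h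
    by (simp add: emeasure_fock_mass[OF that])
  have "?d g z = liminf (\<lambda>n. ?d (f n) z)" for z
  proof -
    have "(\<lambda>n. ?d (f n) z) \<longlonglongrightarrow> ?d g z" by (intro tendsto_ennrealI tendsto_intros lim)
    then show ?thesis by (intro lim_imp_Liminf[symmetric]) auto
  qed
  then have "emeasure (fock_mass \<alpha> g) UNIV = (\<integral>\<^sup>+ z. liminf (\<lambda>n. ?d (f n) z) \<partial>lborel)"
    by (simp only: mass[OF g])
  also have "\<dots> \<le> liminf (\<lambda>n. \<integral>\<^sup>+ z. ?d (f n) z \<partial>lborel)"
    by (rule nn_integral_liminf) measurable
  also have "\<dots> \<le> liminf (\<lambda>n. B)"
    using B by (intro Liminf_mono always_eventually) (simp add: mass[OF hol])
  also have "\<dots> = B" by (simp add: Liminf_const)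
  finally show ?thesis .
qed

lemma fock_mass_small_on:
  assumes "\<alpha> > 0" and f: "f holomorphic_on UNIV" and K: "K \<in> sets borel" and \<delta>: "\<And>z. z \<in> K \<Longrightarrow> cmod (f z) \<le> \<delta>"
  shows "emeasure (fock_mass \<alpha> f) K \<le> ennreal (\<delta>\<^sup>2)"
proof -
  let ?c = "coherent_state \<alpha> 0"
  have c1: "?c = (\<lambda>_. 1)" by (simp add: coherent_state_def fock_translation_def fun_eq_iff)
  have "emeasure (fock_mass \<alpha> f) K \<le> (\<integral>\<^sup>+ z. ennreal (\<delta>\<^sup>2) * ennreal (\<alpha> / pi * exp (- \<alpha> * (cmod z)\<^sup>2)) \<partial>lborel)"
    unfolding emeasure_fock_mass[OF f K]
  proof (rule nn_integral_mono)
    fix z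
    show "ennreal (\<alpha> / pi * ((cmod (f z))\<^sup>2 * exp (- \<alpha> * (cmod z)\<^sup>2))) * indicator K z \<le>
        ennreal (\<delta>\<^sup>2) * ennreal (\<alpha> / pi * exp (- \<alpha> * (cmod z)\<^sup>2))"
    proof (cases "z \<in> K")
      case True
      have "(cmod (f z))\<^sup>2 * (\<alpha> / pi * exp (- \<alpha> * (cmod z)\<^sup>2)) \<le> \<delta>\<^sup>2 * (\<alpha> / pi * exp (- \<alpha> * (cmod z)\<^sup>2))"
        using \<delta>[OF True] assms(1) by (intro mult_right_mono power_mono) auto
      then have "ennreal ((cmod (f z))\<^sup>2 * (\<alpha> / pi * exp (- \<alpha> * (cmod z)\<^sup>2))) \<le> ennreal (\<delta>\<^sup>2 * (\<alpha> / pi * exp (- \<alpha> * (cmod z)\<^sup>2)))"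
        by (rule ennreal_leI)
      then show ?thesis using True by (simp add: mult_ac flip: ennreal_mult')
    qed simp
  qed
  also have "\<dots> = ennreal (\<delta>\<^sup>2) * emeasure (fock_mass \<alpha> ?c) UNIV"
  proof -
    have "emeasure (fock_mass \<alpha> ?c) UNIV = (\<integral>\<^sup>+ z. ennreal (\<alpha> / pi * exp (- \<alpha> * (cmod z)\<^sup>2)) \<partial>lborel)"
      by (subst emeasure_fock_mass[OF coherent_state_holomorphic]) (simp_all add: c1)
    then show ?thesis by (subst nn_integral_cmult) simp_all
  qed
  finally show ?thesis by (simp add: coherent_state_mass[OF assms(1)])
qed

text \<open>Sum the estimate for shrunken discs over the discs that cover the complement of \<open>K\<close>. By finite overlap the
  error terms add up to at most \<open>exp (- \<alpha> C\<^sup>2 / 2) * N\<close> times the norm; \<open>C\<close> is so large that this is at most half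
  of it, and it is absorbed on the left.\<close>

lemma sampling_lower_modulo_compact:
  assumes "\<alpha> > 0" and div: "divisor \<Lambda> m" and overlap: "finite_overlap \<alpha> \<Lambda> m"
    and cover: "\<And>C. C > 0 \<Longrightarrow> \<exists>K. compact K \<and>
               (\<Union>l\<in>{l\<in>\<Lambda>. real (m l) > \<alpha> * C\<^sup>2}. ball l (sqrt (real (m l) / \<alpha>) - C)) = UNIV - K"
  obtains K where "compact K" "\<And>f. f \<in> fock_space \<alpha> \<Longrightarrow>
     emeasure (fock_mass \<alpha> f) UNIV \<le> 2 * (emeasure (fock_mass \<alpha> f) K + sampling_sum \<alpha> \<Lambda> m f)"
proof -
  obtain N where N: "N \<ge> 0" "\<And>z. (\<Sum>\<^sub>\<infinity>l\<in>\<Lambda>. indicator (ball l (sqrt (real (m l) / \<alpha>))) z :: ennreal) \<le> ennreal N"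
    using finite_overlapE[OF overlap] by blast
  define C where "C = sqrt (4 * N / \<alpha>) + 1"
  have C: "C > 0" using assms(1) N by (simp add: C_def add_nonneg_pos)
  define \<epsilon> where "\<epsilon> = exp (- (\<alpha> * C\<^sup>2 / 2))"
  have \<epsilon>: "\<epsilon> * N \<le> 1 / 2"
  proof -
    have "(sqrt (4 * N / \<alpha>))\<^sup>2 \<le> C\<^sup>2" using assms(1) N by (intro power_mono) (auto simp: C_def)
    then have "2 * N \<le> \<alpha> * C\<^sup>2 / 2" using assms(1) N by (simp add: field_simps)
    then have "2 * N \<le> exp (\<alpha> * C\<^sup>2 / 2)" using exp_ge_add_one_self[of "\<alpha> * C\<^sup>2 / 2"] by linarith
    then have "\<epsilon> * (2 * N) \<le> \<epsilon> * exp (\<alpha> * C\<^sup>2 / 2)" by (intro mult_left_mono) (auto simp: \<epsilon>_def)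
    then show ?thesis by (simp add: \<epsilon>_def flip: exp_add)
  qed
  obtain K where K: "compact K"
     "(\<Union>l\<in>{l\<in>\<Lambda>. real (m l) > \<alpha> * C\<^sup>2}. ball l (sqrt (real (m l) / \<alpha>) - C)) = UNIV - K"
    using cover[OF C] by blast
  define I where "I = {l\<in>\<Lambda>. real (m l) > \<alpha> * C\<^sup>2}"
  have I: "I \<subseteq> \<Lambda>" "countable I" using div by (auto simp: I_def divisor_def intro: countable_subset)
  have Kb: "K \<in> sets borel" using K(1) by (simp add: borel_compact)
  show ?thesis
  proof (rule that[OF K(1)])
    fix f assume f: "f \<in> fock_space \<alpha>"
    then have hol: "f holomorphic_on UNIV" by (simp add: fock_space_def)
    let ?M = "fock_mass \<alpha> f"
    let ?R = "\<lambda>l. sqrt (real (m l) / \<alpha>)"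
    have fin: "emeasure ?M UNIV < \<infinity>" using fock_norm2_eq[OF assms(1) f] by (metis ennreal_less_top infinity_ennreal_def)
    have "emeasure ?M (UNIV - K) = emeasure ?M (\<Union>l\<in>I. ball l (?R l - C))" using K(2) by (simp add: I_def)
    also have "\<dots> \<le> (\<Sum>\<^sub>\<infinity>l\<in>I. emeasure ?M (ball l (?R l - C)))"
      by (rule emeasure_UN_le_infsum[OF I(2)]) auto
    also have "\<dots> \<le> (\<Sum>\<^sub>\<infinity>l\<in>\<Lambda>. fock_local_energy \<alpha> f l (m l) + ennreal \<epsilon> * emeasure ?M (ball l (?R l)))"
    proof (rule infsum_mono_neutral)
      fix l assume "l \<in> I \<inter> \<Lambda>"
      then have "C\<^sup>2 \<le> real (m l) / \<alpha>" using assms(1) by (simp add: I_def field_simps)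
      then have "C \<le> ?R l" by (rule real_le_rsqrt)
      then show "emeasure ?M (ball l (?R l - C)) \<le> fock_local_energy \<alpha> f l (m l) + ennreal \<epsilon> * emeasure ?M (ball l (?R l))"
        unfolding \<epsilon>_def using C by (intro shrunken_disc_mass_le_local_energy assms(1) radius_of_multiplicity(1) hol) auto
    qed (use I in \<open>auto intro!: nonneg_summable_on_complete\<close>)
    also have "\<dots> = (\<Sum>\<^sub>\<infinity>l\<in>\<Lambda>. fock_local_energy \<alpha> f l (m l)) + ennreal \<epsilon> * (\<Sum>\<^sub>\<infinity>l\<in>\<Lambda>. emeasure ?M (ball l (?R l)))"
      by (subst infsum_add) (auto intro!: nonneg_summable_on_complete simp: infsum_ennreal_cmult)
    also have "(\<Sum>\<^sub>\<infinity>l\<in>\<Lambda>. emeasure ?M (ball l (?R l))) \<le> ennreal N * emeasure ?M UNIV"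
      using N(2) by (intro infsum_emeasure_le_overlap) auto
    finally have "emeasure ?M (UNIV - K) \<le> sampling_sum \<alpha> \<Lambda> m f + ennreal \<epsilon> * (ennreal N * emeasure ?M UNIV)"
      by (simp add: sampling_sum_fock[OF assms(1) f] add_left_mono mult_left_mono)
    moreover have "ennreal \<epsilon> * (ennreal N * emeasure ?M UNIV) \<le> ennreal (1 / 2) * emeasure ?M UNIV"
    proof -
      have "ennreal \<epsilon> * ennreal N \<le> ennreal (1 / 2)"
        using ennreal_leI[OF \<epsilon>] by (subst ennreal_mult'[symmetric]) (auto simp only: \<epsilon>_def exp_ge_zero)
      then show ?thesis by (simp only: mult.assoc[symmetric]) (rule mult_right_mono, auto)
    qed
    ultimately have 1: "emeasure ?M (UNIV - K) \<le> sampling_sum \<alpha> \<Lambda> m f + ennreal (1 / 2) * emeasure ?M UNIV"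
      by (meson add_left_mono order.trans)
    have "emeasure ?M UNIV = emeasure ?M (K \<union> (UNIV - K))" by simp
    also have "\<dots> \<le> emeasure ?M K + emeasure ?M (UNIV - K)"
      using Kb by (intro emeasure_subadditive) auto
    finally have 2: "emeasure ?M UNIV \<le> emeasure ?M K + (sampling_sum \<alpha> \<Lambda> m f + ennreal (1 / 2) * emeasure ?M UNIV)"
      using 1 by (meson add_left_mono order.trans)
    show "emeasure ?M UNIV \<le> 2 * (emeasure ?M K + sampling_sum \<alpha> \<Lambda> m f)"
    proof (cases "sampling_sum \<alpha> \<Lambda> m f = \<infinity>")
      case True
      then show ?thesis by (simp add: ennreal_mult_top)
    next
      case False
      obtain a where a: "emeasure ?M UNIV = ennreal a" "a \<ge> 0" using fin by (cases "emeasure ?M UNIV") auto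
      have "emeasure ?M K \<le> emeasure ?M UNIV" by (intro emeasure_mono) auto
      then have "emeasure ?M K < \<infinity>" using fin by (rule le_less_trans)
      then obtain b where b: "emeasure ?M K = ennreal b" "b \<ge> 0" by (cases "emeasure ?M K") auto
      obtain s where s: "sampling_sum \<alpha> \<Lambda> m f = ennreal s" "s \<ge> 0" using False by (cases "sampling_sum \<alpha> \<Lambda> m f") auto
      have nn: "0 \<le> s + 1 / 2 * a" "0 \<le> 1 / 2 * a" "(0::real) \<le> 1 / 2" using a s by auto
      have "ennreal a \<le> ennreal (b + (s + 1 / 2 * a))"
        using 2 unfolding a(1) b(1) s(1)
        by (simp only: ennreal_plus[OF b(2) nn(1)] ennreal_plus[OF s(2) nn(2)] ennreal_mult'[OF nn(3)])
      then have "a \<le> b + (s + 1 / 2 * a)" by (rule iffD1[OF ennreal_le_iff, rotated]) (use b(2) nn in linarith)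
      then have "a \<le> 2 * (b + s)" by (simp add: field_simps)
      then have "ennreal a \<le> ennreal (2 * (b + s))" by (rule ennreal_leI)
      also have "\<dots> = 2 * (ennreal b + ennreal s)" using b s by (simp add: ennreal_mult' ennreal_plus)
      finally show ?thesis unfolding a b s .
    qed
  qed
qed

text \<open>A compactness argument removes the integral over \<open>K\<close>. Normalised functions with sampling sums tending to
  0 have, by Montel's theorem, a subsequence converging locally uniformly to some \<open>g\<close> in the Fock space all of
  whose sampled coefficients vanish. Hence \<open>g = 0\<close> by uniqueness, so the functions become small on \<open>K\<close>,
  which contradicts the estimate modulo \<open>K\<close>.\<close>

lemma sampling_lower:
  assumes "\<alpha> > 0" and div: "divisor \<Lambda> m" and overlap: "finite_overlap \<alpha> \<Lambda> m"
    and cover: "\<And>C. C > 0 \<Longrightarrow> \<exists>K. compact K \<and>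
               (\<Union>l\<in>{l\<in>\<Lambda>. real (m l) > \<alpha> * C\<^sup>2}. ball l (sqrt (real (m l) / \<alpha>) - C)) = UNIV - K"
  obtains A where "A > 0" "\<And>f. f \<in> fock_space \<alpha> \<Longrightarrow> ennreal (fock_norm2 \<alpha> f) \<le> ennreal A * sampling_sum \<alpha> \<Lambda> m f"
proof (rule ccontr)
  note found = that
  assume no: "\<not> thesis"
  have "\<exists>f. f \<in> fock_space \<alpha> \<and> \<not> ennreal (fock_norm2 \<alpha> f) \<le> ennreal (real (Suc n)) * sampling_sum \<alpha> \<Lambda> m f" for n
    using found[of "real (Suc n)"] no by auto
  then obtain F where F: "\<And>n. F n \<in> fock_space \<alpha>"
      "\<And>n. ennreal (real (Suc n)) * sampling_sum \<alpha> \<Lambda> m (F n) < ennreal (fock_norm2 \<alpha> (F n))"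
    by (metis not_le)
  have Fhol: "F n holomorphic_on UNIV" for n using F(1)[of n] by (simp add: fock_space_def)
  define c where "c n = complex_of_real (1 / sqrt (fock_norm2 \<alpha> (F n)))" for n
  have pos: "fock_norm2 \<alpha> (F n) > 0" for n
    using F(2)[of n] fock_norm2_nonneg[OF assms(1), of "F n"] by (cases "fock_norm2 \<alpha> (F n) = 0") auto
  have c: "(cmod (c n))\<^sup>2 = 1 / fock_norm2 \<alpha> (F n)" for n
    using pos[of n] by (simp add: c_def norm_divide power_divide)
  define G where "G n = (\<lambda>z. c n * F n z)" for n
  have Ghol: "G n holomorphic_on UNIV" for n unfolding G_def by (intro holomorphic_intros Fhol)
  have Gmass: "emeasure (fock_mass \<alpha> (G n)) UNIV = 1" for n
    unfolding G_def fock_mass_scale[OF Fhol sets.top[of borel, simplified space_borel]] c fock_norm2_eq[OF assms(1) F(1), symmetric]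
    using pos[of n] by (simp flip: ennreal_mult')
  have Gfock: "G n \<in> fock_space \<alpha>" for n by (rule fock_spaceI[OF assms(1) Ghol]) (simp add: Gmass)
  have GS: "sampling_sum \<alpha> \<Lambda> m (G n) \<le> ennreal (1 / real (Suc n))" for n
  proof -
    have "ennreal (real (Suc n)) * sampling_sum \<alpha> \<Lambda> m (G n) =
        ennreal (1 / fock_norm2 \<alpha> (F n)) * (ennreal (real (Suc n)) * sampling_sum \<alpha> \<Lambda> m (F n))"
    proof -
      have "sampling_sum \<alpha> \<Lambda> m (G n) = ennreal (1 / fock_norm2 \<alpha> (F n)) * sampling_sum \<alpha> \<Lambda> m (F n)"
        unfolding sampling_sum_fock[OF assms(1) F(1)] sampling_sum_fock[OF assms(1) Gfock]
        unfolding G_def fock_local_energy_scale[OF Fhol] c infsum_ennreal_cmult ..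
      then show ?thesis by (simp only: mult.left_commute)
    qed
    also have "\<dots> \<le> ennreal (1 / fock_norm2 \<alpha> (F n)) * ennreal (fock_norm2 \<alpha> (F n))"
      using F(2)[of n] by (intro mult_left_mono) auto
    also have "\<dots> = 1" using pos[of n] by (simp flip: ennreal_mult')
    finally have "ennreal (1 / real (Suc n)) * (ennreal (real (Suc n)) * sampling_sum \<alpha> \<Lambda> m (G n)) \<le> ennreal (1 / real (Suc n)) * 1"
      by (intro mult_left_mono) auto
    then show ?thesis by (simp add: mult.assoc[symmetric] del: of_nat_Suc flip: ennreal_mult')
  qed
  have Gdens: "fock_density \<alpha> (G n) z \<le> 2" for n z
    using fock_density_le_mass[OF assms(1) Ghol, of n 1] by (simp add: Gmass)
  obtain g r where g: "g holomorphic_on UNIV" and r: "strict_mono (r :: nat \<Rightarrow> nat)"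
    and lim: "\<And>x. (\<lambda>n. G (r n) x) \<longlonglongrightarrow> g x"
    and unif: "\<And>K. compact K \<Longrightarrow> uniform_limit K (G \<circ> r) g sequentially"
  proof (rule Montel[of UNIV "range G" G])
    show "\<exists>B. \<forall>h\<in>range G. \<forall>z\<in>K. cmod (h z) \<le> B" if K: "compact K" for K
    proof -
      obtain \<rho> where \<rho>: "\<rho> > 0" "\<And>z. z \<in> K \<Longrightarrow> cmod z \<le> \<rho>"
        using compact_imp_bounded[OF K] by (auto simp: bounded_pos)
      have "cmod (G n z) \<le> sqrt (2 * exp (\<alpha> * \<rho>\<^sup>2))" if "z \<in> K" for n z
      proof (rule real_le_rsqrt)
        have "(cmod (G n z))\<^sup>2 \<le> 2 * exp (\<alpha> * (cmod z)\<^sup>2)"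
          using Gdens[of n z] by (simp add: fock_density_def exp_minus field_simps)
        also have "\<dots> \<le> 2 * exp (\<alpha> * \<rho>\<^sup>2)" using \<rho>(2)[OF that] assms(1)
          by (auto intro!: mult_left_mono power_mono)
        finally show "(cmod (G n z))\<^sup>2 \<le> 2 * exp (\<alpha> * \<rho>\<^sup>2)" .
      qed
      then show ?thesis by auto
    qed
  qed (use Ghol in auto)
  have gmass: "emeasure (fock_mass \<alpha> g) UNIV \<le> 1"
    by (rule fock_mass_limit_le[OF Ghol g lim]) (simp add: Gmass)
  have gzero: "fock_local_energy \<alpha> g l (m l) = 0" if l: "l \<in> \<Lambda>" for l
  proof -
    have "fock_coeff \<alpha> g l k = 0" if k: "k < m l" for k
    proof -
      have bound: "(cmod (fock_coeff \<alpha> (G (r n)) l k))\<^sup>2 \<le> 1 / real (Suc n)" for n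
      proof -
        have "ennreal ((cmod (fock_coeff \<alpha> (G (r n)) l k))\<^sup>2) \<le> fock_local_energy \<alpha> (G (r n)) l (m l)"
          unfolding fock_local_energy_def using k by (intro member_le_sum[of k]) auto
        also have "\<dots> \<le> sampling_sum \<alpha> \<Lambda> m (G (r n))"
          using sum_le_infsum_ennreal[of "{l}" \<Lambda> "\<lambda>l. fock_local_energy \<alpha> (G (r n)) l (m l)"] l
          by (simp add: sampling_sum_fock[OF assms(1) Gfock])
        also have "\<dots> \<le> ennreal (1 / real (Suc (r n)))" by (rule GS)
        finally have "(cmod (fock_coeff \<alpha> (G (r n)) l k))\<^sup>2 \<le> 1 / real (Suc (r n))" by (simp add: ennreal_le_iff)
        also have "\<dots> \<le> 1 / real (Suc n)" using seq_suble[OF r, of n] by (intro divide_left_mono) auto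
        finally show ?thesis .
      qed
      have "(\<lambda>n. fock_coeff \<alpha> (G (r n)) l k) \<longlonglongrightarrow> fock_coeff \<alpha> g l k"
        by (rule fock_coeff_tendsto[OF assms(1) Ghol g lim Gdens])
      then have "(\<lambda>n. (cmod (fock_coeff \<alpha> (G (r n)) l k))\<^sup>2) \<longlonglongrightarrow> (cmod (fock_coeff \<alpha> g l k))\<^sup>2"
        by (intro tendsto_intros)
      moreover have "(\<lambda>n. 1 / real (Suc n)) \<longlonglongrightarrow> 0" by (rule LIMSEQ_Suc[OF lim_1_over_n])
      ultimately have "(cmod (fock_coeff \<alpha> g l k))\<^sup>2 \<le> 0"
        by (rule LIMSEQ_le) (use bound in auto)
      then show ?thesis by simp
    qed
    then show ?thesis by (simp add: fock_local_energy_def)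
  qed
  have gdens: "fock_density \<alpha> g z \<le> 2" for z
    using fock_density_le_mass[OF assms(1) g, of 1] gmass by simp
  have g0: "g z = 0" for z
    by (rule uniqueness_set[OF assms(1) overlap cover g gdens gzero])
  obtain K where K: "compact K" "\<And>f. f \<in> fock_space \<alpha> \<Longrightarrow>
     emeasure (fock_mass \<alpha> f) UNIV \<le> 2 * (emeasure (fock_mass \<alpha> f) K + sampling_sum \<alpha> \<Lambda> m f)"
    using sampling_lower_modulo_compact[OF assms] by blast
  have "eventually (\<lambda>n. \<forall>z\<in>K. dist ((G \<circ> r) n z) (g z) < 1 / 2) sequentially"
    by (rule uniform_limitD[OF unif[OF K(1)]]) simp
  then obtain n0 where n0: "\<And>n. n \<ge> n0 \<Longrightarrow> \<forall>z\<in>K. cmod (G (r n) z) < 1 / 2"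
    by (auto simp: eventually_sequentially g0)
  \<comment> \<open>from here on the right side of the estimate modulo \<open>K\<close> is at most \<open>2 * (1/4 + 1/8) < 1\<close>\<close>
  define n where "n = max n0 7"
  have "emeasure (fock_mass \<alpha> (G (r n))) K \<le> ennreal ((1 / 2)\<^sup>2)"
    using n0[of n] K(1) by (intro fock_mass_small_on assms(1) Ghol borel_compact) (auto simp: n_def less_imp_le)
  moreover have "sampling_sum \<alpha> \<Lambda> m (G (r n)) \<le> ennreal (1 / 8)"
  proof -
    have "sampling_sum \<alpha> \<Lambda> m (G (r n)) \<le> ennreal (1 / real (Suc (r n)))" by (rule GS)
    also have "\<dots> \<le> ennreal (1 / 8)"
      using seq_suble[OF r, of n] by (intro ennreal_leI divide_left_mono) (auto simp: n_def)
    finally show ?thesis .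
  qed
  ultimately have "2 * (emeasure (fock_mass \<alpha> (G (r n))) K + sampling_sum \<alpha> \<Lambda> m (G (r n))) \<le> 2 * (ennreal ((1 / 2)\<^sup>2) + ennreal (1 / 8))"
    by (intro mult_left_mono add_mono) auto
  with K(2)[OF Gfock[of "r n"]] have "1 \<le> 2 * (ennreal ((1 / 2)\<^sup>2) + ennreal (1 / 8))"
    by (simp add: Gmass)
  also have "\<dots> = ennreal (2 * ((1 / 2)\<^sup>2 + 1 / 8))"
    by (simp only: ennreal_mult'[of 2] ennreal_plus[symmetric]) simp
  also have "2 * ((1 / 2)\<^sup>2 + 1 / 8) = (3 / 4 :: real)" by (simp add: power2_eq_square)
  finally have "ennreal 1 \<le> ennreal (3 / 4)" by (simp only: ennreal_1)
  then show False by (subst (asm) ennreal_le_iff) auto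
qed

section \<open>Characterisation of sampling divisors\<close>

theorem theorem1:
  fixes \<alpha> :: real and \<Lambda> :: "complex set" and m :: "complex \<Rightarrow> nat"
  assumes "\<alpha> > 0" and "divisor \<Lambda> m"
  shows "(sampling_divisor \<alpha> \<Lambda> m \<longrightarrow>
            finite_overlap \<alpha> \<Lambda> m \<and>
            (\<exists>C>0. (\<Union>l\<in>\<Lambda>. ball l (sqrt (real (m l) / \<alpha>) + C)) = UNIV)) \<and>
         (finite_overlap \<alpha> \<Lambda> m \<and>
            (\<forall>C>0. \<exists>K. compact K \<and>
               (\<Union>l\<in>{l\<in>\<Lambda>. real (m l) > \<alpha> * C\<^sup>2}. ball l (sqrt (real (m l) / \<alpha>) - C)) = UNIV - K) \<longrightarrow>
          sampling_divisor \<alpha> \<Lambda> m)"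
proof (intro conjI impI)
  assume samp: "sampling_divisor \<alpha> \<Lambda> m"
  show overlap: "finite_overlap \<alpha> \<Lambda> m" by (rule sampling_imp_finite_overlap[OF assms samp])
  show "\<exists>C>0. (\<Union>l\<in>\<Lambda>. ball l (sqrt (real (m l) / \<alpha>) + C)) = UNIV"
    by (rule sampling_imp_covering[OF assms(1) samp overlap])
next
  assume "finite_overlap \<alpha> \<Lambda> m \<and>
            (\<forall>C>0. \<exists>K. compact K \<and>
               (\<Union>l\<in>{l\<in>\<Lambda>. real (m l) > \<alpha> * C\<^sup>2}. ball l (sqrt (real (m l) / \<alpha>) - C)) = UNIV - K)"
  then have overlap: "finite_overlap \<alpha> \<Lambda> m"
    and cover: "\<And>C. C > 0 \<Longrightarrow> \<exists>K. compact K \<and>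
               (\<Union>l\<in>{l\<in>\<Lambda>. real (m l) > \<alpha> * C\<^sup>2}. ball l (sqrt (real (m l) / \<alpha>) - C)) = UNIV - K"
    by auto
  obtain A where A: "A > 0" "\<And>f. f \<in> fock_space \<alpha> \<Longrightarrow> ennreal (fock_norm2 \<alpha> f) \<le> ennreal A * sampling_sum \<alpha> \<Lambda> m f"
    using sampling_lower[OF assms overlap cover] by blast
  obtain B where B: "B > 0" "\<And>f. f \<in> fock_space \<alpha> \<Longrightarrow> sampling_sum \<alpha> \<Lambda> m f \<le> ennreal B * ennreal (fock_norm2 \<alpha> f)"
    using sampling_upper[OF assms(1) overlap] by blast
  show "sampling_divisor \<alpha> \<Lambda> m" unfolding sampling_divisor_def using A B by blast
qed

end
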